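(* Let $r,d\in\mathbb{N}$. There exists a deterministic algorithm which solves the power problem in the free solvable group $S_{r,d}$ in quasi-quadratic time $\tilde O((|u|+|v|)^2)$: given words $u,v\in F(X_r)$, it outputs some $k\in\mathbb{Z}$ with $u=v^k$ in $S_{r,d}$ if such $k$ exists, and outputs $Fail$ otherwise.
   Context: $F=F(X_r)$ is the free group with basis $X_r=\{x_1,\dots,x_r\}$; elements are given as words over $X_r^{\pm}=\{x_1^{\pm1},\dots,x_r^{\pm1}\}$ and $|w|$ denotes word length. Put $F^{(0)}=F$, $F^{(i)}=[F^{(i-1)},F^{(i-1)}]$; the free solvable group of rank $r$ and class $d$ is $S_{r,d}=F/F^{(d)}$. Computational model: a random access machine with integers written in binary (adding two $n$-bit integers costs $O(n)$, multiplying them costs $O(n\log n\log\log n)$). Each letter of $X_r^{\pm}$ is encoded by a unique bit-string of length $\lceil\log_2 r\rceil+1$, a word by the concatenation of the codes of its letters, and a pair of words by using one additional separator letter. $\tilde O(n^2)$ (quasi-quadratic) means $O(n^2\log^k n)$ for some constant $k\in\mathbb{N}$. *)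

theory Defs
  imports "HOL-Algebra.Generated_Groups" "HOL-Library.Landau_Symbols" "HOL-Library.Log_Nat"
begin

section \<open>Free groups and free solvable groups\<close>

text \<open>The letter \<open>(x, True)\<close> stands for the generator \<open>x\<close>, and \<open>(x, False)\<close> for its formal inverse.\<close>

type_synonym 'a letter = "'a \<times> bool"
type_synonym 'a word = "'a letter list"

definition inv_letter :: "'a letter \<Rightarrow> 'a letter"
  where "inv_letter a = (fst a, \<not> snd a)"

definition letters :: "'a set \<Rightarrow> 'a letter set"
  where "letters X = X \<times> UNIV"

definition reduced :: "'a word \<Rightarrow> bool"
  where "reduced = successively (\<lambda>a b. b \<noteq> inv_letter a)"

fun cons_reduced :: "'a letter \<Rightarrow> 'a word \<Rightarrow> 'a word"
  where
    "cons_reduced a [] = [a]"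
  | "cons_reduced a (b # w) = (if b = inv_letter a then w else a # b # w)"

definition reduce :: "'a word \<Rightarrow> 'a word"
  where "reduce w = foldr cons_reduced w []"

definition free_group :: "'a set \<Rightarrow> 'a word monoid"
  where "free_group X =
    \<lparr>carrier = {w \<in> lists (letters X). reduced w}, mult = (\<lambda>u v. reduce (u @ v)), one = []\<rparr>"

lemma inv_letter_inv_letter [simp]: "inv_letter (inv_letter a) = a"
  by (simp add: inv_letter_def)

lemma inv_letter_neq [simp]: "inv_letter a \<noteq> a"
  by (simp add: inv_letter_def prod_eq_iff)

lemma reduced_Nil [simp]: "reduced []"
  by (simp add: reduced_def)

lemma reduced_Cons: "reduced (a # w) \<longleftrightarrow> (w \<noteq> [] \<longrightarrow> hd w \<noteq> inv_letter a) \<and> reduced w"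
  by (cases w) (auto simp: reduced_def)

lemma reduced_cons_reduced: "reduced w \<Longrightarrow> reduced (cons_reduced a w)"
  by (cases w) (auto simp: reduced_Cons)

lemma cons_reduced_cancel:
  assumes "reduced w"
  shows "cons_reduced a (cons_reduced (inv_letter a) w) = w"
  using assms by (cases w rule: list.exhaust[case_names Nil Cons]; cases "tl w") (auto simp: reduced_Cons)

lemma reduced_foldr: "reduced w \<Longrightarrow> reduced (foldr cons_reduced u w)"
  by (induction u) (auto simp: reduced_cons_reduced)

lemma foldr_cons_reduced:
  assumes "reduced w"
  shows "foldr cons_reduced (cons_reduced a u) w = cons_reduced a (foldr cons_reduced u w)"
proof (cases u)
  case (Cons b u')
  then show ?thesis
    using cons_reduced_cancel[OF reduced_foldr[OF assms], of a u'] by simp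
qed simp

lemma foldr_reduce:
  "reduced w \<Longrightarrow> foldr cons_reduced (reduce u) w = foldr cons_reduced u w"
  by (induction u) (auto simp: reduce_def foldr_cons_reduced)

lemma reduce_reduced: "reduced w \<Longrightarrow> reduce w = w"
proof (induction w)
  case (Cons a w)
  then show ?case by (cases w) (auto simp: reduce_def reduced_Cons)
qed (simp add: reduce_def)

lemma reduced_reduce [simp]: "reduced (reduce w)"
  by (simp add: reduce_def reduced_foldr)

lemma reduce_append: "reduce (u @ v) = foldr cons_reduced u (reduce v)"
  by (simp add: reduce_def)

lemma cons_reduced_in_lists:
  "a \<in> A \<Longrightarrow> w \<in> lists A \<Longrightarrow> cons_reduced a w \<in> lists A"
  by (cases w) auto

lemma reduce_in_lists: "w \<in> lists A \<Longrightarrow> reduce w \<in> lists A"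
  by (induction w) (auto simp: reduce_def cons_reduced_in_lists simp del: in_lists_conv_set)

lemma reduce_in_free_group [simp]:
  "w \<in> lists (letters X) \<Longrightarrow> reduce w \<in> carrier (free_group X)"
  by (simp add: free_group_def reduce_in_lists del: in_lists_conv_set)

lemma reduce_inverse: "reduce (map inv_letter (rev w) @ w) = []"
proof (induction w)
  case (Cons a w)
  have "reduce (map inv_letter (rev (a # w)) @ a # w) =
      foldr cons_reduced (map inv_letter (rev w))
        (cons_reduced (inv_letter a) (cons_reduced (inv_letter (inv_letter a)) (reduce w)))"
    by (simp add: reduce_def)
  also have "\<dots> = foldr cons_reduced (map inv_letter (rev w)) (reduce w)"
    by (simp only: cons_reduced_cancel reduced_reduce)
  also have "\<dots> = []"
    using Cons by (simp add: reduce_append)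
  finally show ?case .
qed (simp add: reduce_def)

theorem group_free_group: "group (free_group X)"
proof (rule groupI)
  fix u v assume "u \<in> carrier (free_group X)" "v \<in> carrier (free_group X)"
  then have "u @ v \<in> lists (letters X)" by (simp add: free_group_def)
  then show "u \<otimes>\<^bsub>free_group X\<^esub> v \<in> carrier (free_group X)"
    by (simp add: free_group_def reduce_in_lists del: in_lists_conv_set)
next
  fix u v w :: "'a word"
  have "reduce (reduce (u @ v) @ w) = reduce (u @ reduce (v @ w))"
    by (simp add: reduce_append[of "reduce (u @ v)"] foldr_reduce reduce_append[of u "reduce _"]
        reduce_reduced) (simp add: reduce_def)
  then show "u \<otimes>\<^bsub>free_group X\<^esub> v \<otimes>\<^bsub>free_group X\<^esub> w = u \<otimes>\<^bsub>free_group X\<^esub> (v \<otimes>\<^bsub>free_group X\<^esub> w)"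
    by (simp add: free_group_def)
next
  fix w assume w: "w \<in> carrier (free_group X)"
  let ?w = "map inv_letter (rev w)"
  have "?w \<in> lists (letters X)"
    using w by (fastforce simp: free_group_def letters_def inv_letter_def)
  moreover have "reduce (reduce ?w @ w) = []"
    by (simp add: reduce_append foldr_reduce flip: reduce_inverse[of w])
  ultimately show "\<exists>v\<in>carrier (free_group X). v \<otimes>\<^bsub>free_group X\<^esub> w = \<one>\<^bsub>free_group X\<^esub>"
    by (intro bexI[of _ "reduce ?w"]) (simp_all add: reduce_in_free_group free_group_def reduce_in_lists del: in_lists_conv_set)
qed (auto simp: free_group_def reduce_reduced)

definition derived_term :: "('a, 'b) monoid_scheme \<Rightarrow> nat \<Rightarrow> 'a set"
  where "derived_term G i = (derived G ^^ i) (carrier G)"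

definition free_solvable_group :: "nat \<Rightarrow> nat \<Rightarrow> nat word set monoid"
  where "free_solvable_group r d = free_group {1..r} Mod derived_term (free_group {1..r}) d"

text \<open>The element of the free solvable group represented by a (not necessarily reduced) word.\<close>

definition word_class :: "nat \<Rightarrow> nat \<Rightarrow> nat word \<Rightarrow> nat word set"
  where "word_class r d w =
    derived_term (free_group {1..r}) d #>\<^bsub>free_group {1..r}\<^esub> reduce w"

lemma (in group) derived_term_normal: "derived_term G i \<lhd> G"
proof (induction i)
  case 0
  show ?case
    by (intro normal_invI) (auto simp: derived_term_def subgroup_self)
next
  case (Suc i)
  interpret N: normal "derived_term G i" G by (rule Suc)
  have "generate G (derived_set G (derived_term G i)) \<lhd> G"
  proof (rule normal_generateI)
    show "derived_set G (derived_term G i) \<subseteq> carrier G"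
      using derived_set_in_carrier[OF N.subset] .
    fix h g assume "h \<in> derived_set G (derived_term G i)" and g: "g \<in> carrier G"
    then obtain a b where ab: "a \<in> derived_term G i" "b \<in> derived_term G i"
      and h: "h = a \<otimes> b \<otimes> inv a \<otimes> inv b" by auto
    let ?c = "\<lambda>x. g \<otimes> x \<otimes> inv g"
    have car: "a \<in> carrier G" "b \<in> carrier G" using ab N.subset by auto
    have cancel: "inv g \<otimes> (g \<otimes> x) = x" if "x \<in> carrier G" for x
      using that g by (simp flip: m_assoc)
    have "?c h = ?c a \<otimes> ?c b \<otimes> inv (?c a) \<otimes> inv (?c b)"
      using car g by (simp add: h m_assoc inv_mult_group cancel)
    moreover have "?c a \<in> derived_term G i" "?c b \<in> derived_term G i"
      using ab g by (auto intro: N.inv_op_closed2)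
    ultimately show "?c h \<in> derived_set G (derived_term G i)" by blast
  qed
  then show ?case by (simp add: derived_term_def derived_def)
qed

theorem group_free_solvable_group: "group (free_solvable_group r d)"
  unfolding free_solvable_group_def
  by (intro normal.factorgroup_is_group group.derived_term_normal group_free_group)

lemma word_class_in_carrier:
  assumes "w \<in> lists (letters {1..r})"
  shows "word_class r d w \<in> carrier (free_solvable_group r d)"
  using reduce_in_free_group[OF assms]
  by (auto simp: word_class_def free_solvable_group_def FactGroup_def RCOSETS_def)

section \<open>Random access machines with binary integers\<close>

text \<open>
  A machine has registers and a separate random access memory, both indexed by natural numbers and
  holding integers.  A program mentions only finitely many registers; memory is addressed through
  register contents.
\<close>

datatype instr =
    Const nat int           \<comment> \<open>\<open>Const i c\<close>: \<open>R\<^sub>i := c\<close>\<close>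
  | Copy nat nat            \<comment> \<open>\<open>Copy i j\<close>: \<open>R\<^sub>i := R\<^sub>j\<close>\<close>
  | Add nat nat nat         \<comment> \<open>\<open>Add i j k\<close>: \<open>R\<^sub>i := R\<^sub>j + R\<^sub>k\<close>\<close>
  | Sub nat nat nat
  | Mult nat nat nat
  | Load nat nat            \<comment> \<open>\<open>Load i j\<close>: \<open>R\<^sub>i := M[R\<^sub>j]\<close>\<close>
  | Store nat nat           \<comment> \<open>\<open>Store i j\<close>: \<open>M[R\<^sub>i] := R\<^sub>j\<close>\<close>
  | Jump nat                \<comment> \<open>continue at the given position of the program\<close>
  | JumpZero nat nat        \<comment> \<open>\<open>JumpZero i l\<close>: continue at \<open>l\<close> if \<open>R\<^sub>i = 0\<close>\<close>
  | JumpPos nat nat         \<comment> \<open>\<open>JumpPos i l\<close>: continue at \<open>l\<close> if \<open>R\<^sub>i > 0\<close>\<close>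

type_synonym program = "instr list"

record config =
  pc :: nat
  reg :: "nat \<Rightarrow> int"
  mem :: "nat \<Rightarrow> int"

definition set_reg :: "nat \<Rightarrow> int \<Rightarrow> config \<Rightarrow> config"
  where "set_reg i x c = c\<lparr>pc := Suc (pc c), reg := (reg c)(i := x)\<rparr>"

text \<open>An access to a negative address has no successor configuration: the machine is stuck without
  having halted.\<close>

fun exec :: "instr \<Rightarrow> config \<Rightarrow> config option"
  where
    "exec (Const i x) c = Some (set_reg i x c)"
  | "exec (Copy i j) c = Some (set_reg i (reg c j) c)"
  | "exec (Add i j k) c = Some (set_reg i (reg c j + reg c k) c)"
  | "exec (Sub i j k) c = Some (set_reg i (reg c j - reg c k) c)"
  | "exec (Mult i j k) c = Some (set_reg i (reg c j * reg c k) c)"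
  | "exec (Load i j) c =
      (if reg c j < 0 then None else Some (set_reg i (mem c (nat (reg c j))) c))"
  | "exec (Store i j) c =
      (if reg c i < 0 then None
       else Some (c\<lparr>pc := Suc (pc c), mem := (mem c)(nat (reg c i) := reg c j)\<rparr>))"
  | "exec (Jump l) c = Some (c\<lparr>pc := l\<rparr>)"
  | "exec (JumpZero i l) c = Some (c\<lparr>pc := if reg c i = 0 then l else Suc (pc c)\<rparr>)"
  | "exec (JumpPos i l) c = Some (c\<lparr>pc := if reg c i > 0 then l else Suc (pc c)\<rparr>)"

text \<open>Length of the binary representation, including a sign bit.\<close>

definition bits :: "int \<Rightarrow> nat"
  where "bits x = Suc (floorlog 2 (nat \<bar>x\<bar>))"

text \<open>
  \<open>floorlog 2 n\<close> is \<open>\<lfloor>log\<^sub>2 n\<rfloor> + 1\<close> for positive \<open>n\<close>, so \<open>mult_cost n\<close> has order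
  \<open>n log n log log n\<close> and is positive for \<open>n \<ge> 1\<close>.
\<close>

definition mult_cost :: "nat \<Rightarrow> nat"
  where "mult_cost n = n * floorlog 2 n * floorlog 2 (floorlog 2 n)"

text \<open>Bit cost: every instruction pays for the length of the integers it handles, addresses
  included.\<close>

fun cost :: "instr \<Rightarrow> config \<Rightarrow> nat"
  where
    "cost (Const i x) c = bits x"
  | "cost (Copy i j) c = bits (reg c j)"
  | "cost (Add i j k) c = max (bits (reg c j)) (bits (reg c k))"
  | "cost (Sub i j k) c = max (bits (reg c j)) (bits (reg c k))"
  | "cost (Mult i j k) c = mult_cost (max (bits (reg c j)) (bits (reg c k)))"
  | "cost (Load i j) c = bits (reg c j) + bits (mem c (nat (reg c j)))"
  | "cost (Store i j) c = bits (reg c i) + bits (reg c j)"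
  | "cost (Jump l) c = 1"
  | "cost (JumpZero i l) c = bits (reg c i)"
  | "cost (JumpPos i l) c = bits (reg c i)"

definition halted :: "program \<Rightarrow> config \<Rightarrow> bool"
  where "halted P c \<longleftrightarrow> length P \<le> pc c"

text \<open>\<open>run P c t c'\<close>: finitely many steps of total cost \<open>t\<close> lead from \<open>c\<close> to \<open>c'\<close>.\<close>

inductive run :: "program \<Rightarrow> config \<Rightarrow> nat \<Rightarrow> config \<Rightarrow> bool" for P
  where
    refl: "run P c 0 c"
  | step: "run P c (cost (P ! pc c) c + t) c''"
      if "\<not> halted P c" "exec (P ! pc c) c = Some c'" "run P c' t c''"

theorem run_deterministic:
  assumes "run P c t c'" "halted P c'" "run P c s c''" "halted P c''"
  shows "t = s \<and> c' = c''"
  using assms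
proof (induction arbitrary: s rule: run.induct)
  case (refl c)
  then show ?case by (auto elim: run.cases)
next
  case (step c c1 t c2)
  from step.prems(2) obtain s' where "s = cost (P ! pc c) c + s'" "run P c1 s' c''"
    by (cases rule: run.cases) (use step.hyps(1,2) step.prems(3) in auto)
  then show ?case
    using step.IH[of s'] step.prems by simp
qed

text \<open>The input is a string of integers stored from address 0 on; its length is in register 0.\<close>

definition initial_config :: "int list \<Rightarrow> config"
  where "initial_config s =
    \<lparr>pc = 0, reg = (\<lambda>_. 0)(0 := int (length s)), mem = (\<lambda>i. if i < length s then s ! i else 0)\<rparr>"

section \<open>The power problem\<close>

definition letter_code :: "nat \<Rightarrow> (nat letter \<Rightarrow> bool list) \<Rightarrow> bool"
  where "letter_code r code \<longleftrightarrow> inj_on code (letters {1..r}) \<and>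
    (\<forall>a\<in>letters {1..r}. length (code a) = nat \<lceil>log 2 (real r)\<rceil> + 1)"

text \<open>One memory cell per bit; the separator is the symbol 2.\<close>

definition encode_word :: "(nat letter \<Rightarrow> bool list) \<Rightarrow> nat word \<Rightarrow> int list"
  where "encode_word code w = map of_bool (concat (map code w))"

definition encode_pair :: "(nat letter \<Rightarrow> bool list) \<Rightarrow> nat word \<Rightarrow> nat word \<Rightarrow> int list"
  where "encode_pair code u v = encode_word code u @ [2] @ encode_word code v"

datatype answer = Fail | Exponent int

text \<open>A machine reports failure by halting with 0 in register 0; otherwise its output is the
  content of register 1.\<close>

definition answer_of :: "config \<Rightarrow> answer"
  where "answer_of c = (if reg c 0 = 0 then Fail else Exponent (reg c 1))"

fun correct_answer :: "nat \<Rightarrow> nat \<Rightarrow> nat word \<Rightarrow> nat word \<Rightarrow> answer \<Rightarrow> bool"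
  where
    "correct_answer r d u v (Exponent k) \<longleftrightarrow>
      word_class r d u = word_class r d v [^]\<^bsub>free_solvable_group r d\<^esub> k"
  | "correct_answer r d u v Fail \<longleftrightarrow>
      (\<nexists>k::int. word_class r d u = word_class r d v [^]\<^bsub>free_solvable_group r d\<^esub> k)"

definition solves_power_problem_within ::
    "nat \<Rightarrow> nat \<Rightarrow> (nat letter \<Rightarrow> bool list) \<Rightarrow> program \<Rightarrow> (nat \<Rightarrow> real) \<Rightarrow> bool"
  where "solves_power_problem_within r d code P T \<longleftrightarrow>
    (\<forall>u\<in>lists (letters {1..r}). \<forall>v\<in>lists (letters {1..r}).
      \<exists>t c. run P (initial_config (encode_pair code u v)) t c \<and> halted P c \<and>
        correct_answer r d u v (answer_of c) \<and> real t \<le> T (length u + length v))"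

definition quasi_quadratic :: "(nat \<Rightarrow> real) \<Rightarrow> bool"
  where "quasi_quadratic T \<longleftrightarrow> (\<exists>k::nat. T \<in> O(\<lambda>n. real n ^ 2 * ln (real n) ^ k))"

end

theory Submission
  imports Defs "HOL-Algebra.FiniteProduct"
begin

text \<open>
The proof rests on two facts about the derived series \<open>F\<^sup>(\<^sup>i\<^sup>)\<close> of the free group and on one about
programs.

For a normal subgroup \<open>N\<close> of the free group, a word traces a path in the Cayley graph of the quotient
by \<open>N\<close>, and its flow records how often each edge is traversed, counted with sign.  Two words are equal
modulo \<open>[N, N]\<close> iff their flows are equal (\<open>derived_coset_eq_iff_flow_eq\<close>).  The edges on the path of a
word are determined by the classes of its prefixes modulo \<open>N\<close>.  Hence the classes of all prefixes modulo
one term of the derived series give those modulo the next one: walk from each prefix to the end of the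
word and keep count of the edges; a prefix met on the way is equal to the first one iff all counters
are zero.  A word of length \<open>n\<close> takes \<open>O(n\<^sup>2)\<close> steps for each of the \<open>d\<close> levels.

Testing whether \<open>u = v\<^sup>k\<close> directly for a candidate \<open>k\<close> is too expensive, because the length of \<open>v\<^sup>k\<close> may be
quadratic.  But powers of \<open>v\<close> commute with \<open>v\<close>, and whether \<open>u\<close> does is a question about the word
\<open>u v u\<^sup>-\<^sup>1 v\<^sup>-\<^sup>1\<close> of linear length.  Conversely, suppose that \<open>u\<close> and \<open>v\<close> commute, and let \<open>j < d\<close> be the last
level at which \<open>v\<close> represents the identity.  Then \<open>u = v\<^sup>k\<close> holds iff the flow of \<open>u\<close> at level \<open>j\<close> is \<open>k\<close>
times that of \<open>v\<close> (\<open>power_iff_flow_multiple\<close>).  Indeed, proportional flows put \<open>x = u v\<^sup>-\<^sup>k\<close> into the next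
term of the derived series.  Once \<open>x\<close> lies in a term after \<open>j\<close>, its flow there is invariant under
translation by \<open>v\<close>, because \<open>x\<close> and \<open>v\<close> commute.  As \<open>v\<close> has infinite order modulo that term and flows have
finite support, the flow is zero, so \<open>x\<close> lies in the following term as well, and so on up to the term \<open>d\<close>.
If the flow of \<open>v\<close> at level \<open>j\<close> is not zero, only exponents up to the length of \<open>u\<close> are possible, and one
more pass over \<open>v\<close> tests each of them (\<open>answer_correct\<close>).

The algorithm is written in a structured language with arrays, in which one operand of every addition
is bounded by a constant.  The numbers therefore grow at most linearly in time: a run of \<open>O(n\<^sup>2)\<close> steps
only meets numbers of \<open>O(log n)\<close> bits, and each step costs the machine a power of \<open>log n\<close>
(\<open>compile_correct\<close>).
\<close>

section \<open>Flows of words in Cayley graphs\<close>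

lemma reduce_append_reduce: "reduce (reduce u @ reduce v) = reduce (u @ v)"
  by (simp add: reduce_append reduce_reduced foldr_reduce)

lemma mult_free_group: "reduce u \<otimes>\<^bsub>free_group X\<^esub> reduce v = reduce (u @ v)"
  by (simp add: free_group_def reduce_append_reduce)

definition inv_word :: "'a word \<Rightarrow> 'a word"
  where "inv_word w = map inv_letter (rev w)"

lemma length_inv_word [simp]: "length (inv_word w) = length w"
  by (simp add: inv_word_def)

lemma inv_letter_in_letters [simp]: "inv_letter a \<in> letters X \<longleftrightarrow> a \<in> letters X"
  by (cases a) (auto simp: inv_letter_def letters_def)

lemma inv_word_in_lists [simp]: "inv_word w \<in> lists (letters X) \<longleftrightarrow> w \<in> lists (letters X)"
  by (auto simp: inv_word_def)

lemma inv_free_group: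
  assumes "w \<in> lists (letters X)"
  shows "inv\<^bsub>free_group X\<^esub> reduce w = reduce (inv_word w)"
proof -
  interpret group "free_group X" by (rule group_free_group)
  have "reduce (inv_word w) \<otimes>\<^bsub>free_group X\<^esub> reduce w = \<one>\<^bsub>free_group X\<^esub>"
    by (simp only: mult_free_group inv_word_def reduce_inverse) (simp add: free_group_def)
  moreover have "reduce (inv_word w) \<in> carrier (free_group X)"
    using assms by (intro reduce_in_free_group) (simp del: in_lists_conv_set)
  ultimately show ?thesis
    using inv_equality[of "reduce (inv_word w)" "reduce w"] reduce_in_free_group[OF assms] by simp
qed

text \<open>The function \<open>c\<close> sends a word to the vertex of a Cayley graph that it reaches from the identity, and
\<open>(q, x)\<close> is the edge with label \<open>x\<close> that leaves the vertex \<open>q\<close>.  An inverse letter runs backwards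
along the edge that leaves the vertex reached after it; this is why the two cases evaluate \<open>c\<close> at
different words.\<close>

definition letter_flow :: "('a word \<Rightarrow> 'q) \<Rightarrow> 'a word \<Rightarrow> 'a letter \<Rightarrow> 'q \<times> 'a \<Rightarrow> int"
  where "letter_flow c w a e =
    (if snd a then of_bool (e = (c w, fst a)) else - of_bool (e = (c (w @ [a]), fst a)))"

definition flow :: "('a word \<Rightarrow> 'q) \<Rightarrow> 'a word \<Rightarrow> 'q \<times> 'a \<Rightarrow> int"
  where "flow c w e = (\<Sum>p<length w. letter_flow c (take p w) (w ! p) e)"

lemma flow_Nil [simp]: "flow c [] e = 0"
  by (simp add: flow_def)

lemma flow_snoc [simp]: "flow c (w @ [a]) e = flow c w e + letter_flow c w a e"
  by (simp add: flow_def nth_append)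

lemma finite_flow_support: "finite {e. flow c w e \<noteq> 0}"
proof (induction w rule: rev_induct)
  case (snoc a w)
  have "finite {e. letter_flow c w a e \<noteq> 0}"
    by (rule finite_subset[of _ "{(c w, fst a), (c (w @ [a]), fst a)}"])
       (auto simp: letter_flow_def split: if_splits)
  with snoc have "finite ({e. flow c w e \<noteq> 0} \<union> {e. letter_flow c w a e \<noteq> 0})" by simp
  then show ?case by (rule rev_finite_subset) auto
qed simp

text \<open>Turns equality of cosets into membership, which is monotone in the subgroup: this is how equations
are carried from one term of the derived series to an earlier one.\<close>

lemma (in group) rcoset_eq_iff:
  assumes "subgroup H G" "a \<in> carrier G" "b \<in> carrier G"
  shows "H #> a = H #> b \<longleftrightarrow> a \<otimes> inv b \<in> H"
  using assms repr_independence[of a H b] subgroup.rcos_module[OF assms(1) group_axioms, of b a] rcos_self[of a H]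
  by auto

locale free_group_hom = group_hom "free_group X" Q h for X :: "'a set" and Q (structure) and h
begin

abbreviation words where "words \<equiv> lists (letters X)"

definition vertex where "vertex w = h (reduce w)"

lemma vertex_Nil [simp]: "vertex [] = \<one>"
  using hom_one by (simp add: vertex_def reduce_def free_group_def)

lemma vertex_closed [simp]: "w \<in> words \<Longrightarrow> vertex w \<in> carrier Q"
  unfolding vertex_def by (intro hom_closed reduce_in_free_group)

lemma vertex_append [simp]:
  "u \<in> words \<Longrightarrow> v \<in> words \<Longrightarrow> vertex (u @ v) = vertex u \<otimes> vertex v"
  unfolding vertex_def mult_free_group[of X u v, symmetric] by (intro hom_mult reduce_in_free_group)

lemma vertex_inv_word: "w \<in> words \<Longrightarrow> vertex (inv_word w) = inv vertex w"
  unfolding vertex_def inv_free_group[symmetric] by (intro hom_inv reduce_in_free_group)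

lemma flow_outside:
  "w \<in> words \<Longrightarrow> q \<notin> carrier Q \<Longrightarrow> flow vertex w (q, x) = 0"
proof (induction w rule: rev_induct)
  case (snoc a w)
  moreover have "vertex (w @ [a]) \<in> carrier Q" "vertex w \<in> carrier Q"
    by (rule vertex_closed; use snoc.prems in auto)+
  then have "q \<noteq> vertex (w @ [a])" "q \<noteq> vertex w"
    using snoc.prems(2) by blast+
  ultimately show ?case by (auto simp: letter_flow_def simp del: vertex_append)
qed simp

text \<open>The cocycle identity: behind \<open>u\<close>, the path of \<open>v\<close> is its path from the identity, translated by the
vertex that \<open>u\<close> reaches.\<close>

lemma flow_append:
  assumes "u \<in> words" "v \<in> words" "q \<in> carrier Q"
  shows "flow vertex (u @ v) (vertex u \<otimes> q, x) =
    flow vertex u (vertex u \<otimes> q, x) + flow vertex v (q, x)"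
  using assms(2)
proof (induction v rule: rev_induct)
  case (snoc a v)
  then have w: "v \<in> words" "[a] \<in> words" by auto
  have "letter_flow vertex (u @ v) a (vertex u \<otimes> q, x) = letter_flow vertex v a (q, x)"
    using assms(1,3) w by (auto simp: letter_flow_def H.m_assoc simp del: in_lists_conv_set)
  with snoc.IH[OF w(1)] show ?case
    using flow_snoc[of vertex "u @ v" a] by (simp del: in_lists_conv_set)
qed simp

lemma flow_eqI:
  assumes "u \<in> words" "v \<in> words"
    and "\<And>q x. q \<in> carrier Q \<Longrightarrow> flow vertex u (q, x) = flow vertex v (q, x)"
  shows "flow vertex u = flow vertex v"
proof
  fix e
  show "flow vertex u e = flow vertex v e"
    using assms flow_outside by (cases e) metis
qed

lemma flow_append_cong:
  assumes "u \<in> words" "v \<in> words" "w \<in> words" "flow vertex v = flow vertex w"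
  shows "flow vertex (u @ v) = flow vertex (u @ w)"
proof (rule flow_eqI)
  fix q x assume q: "q \<in> carrier Q"
  then have "q = vertex u \<otimes> (inv vertex u \<otimes> q)"
    using assms(1) by (simp add: H.m_assoc[symmetric] del: in_lists_conv_set)
  moreover have "inv vertex u \<otimes> q \<in> carrier Q"
    using assms(1) q by (simp del: in_lists_conv_set)
  ultimately show "flow vertex (u @ v) (q, x) = flow vertex (u @ w) (q, x)"
    using assms flow_append by metis
qed (use assms in auto)

lemma flow_cancel:
  assumes "a \<in> letters X" "w \<in> words"
  shows "flow vertex (a # inv_letter a # w) = flow vertex w"
proof (rule flow_eqI)
  fix q x assume q: "q \<in> carrier Q"
  have l: "[a, inv_letter a] \<in> words" "[a] \<in> words" using assms by auto
  have [simp]: "vertex [a, inv_letter a] = \<one>"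
    by (simp add: vertex_def reduce_def flip: vertex_Nil)
  have "flow vertex [a, inv_letter a] e = 0" for e
    using flow_snoc[of vertex "[a]" "inv_letter a" e] flow_snoc[of vertex "[]" a e]
    by (simp add: letter_flow_def) (simp add: inv_letter_def)
  then show "flow vertex (a # inv_letter a # w) (q, x) = flow vertex w (q, x)"
    using flow_append[OF l(1) assms(2) q, of x] q by simp
qed (use assms in auto)

lemma flow_cons_reduced:
  assumes "a \<in> letters X" "w \<in> words"
  shows "flow vertex (cons_reduced a w) = flow vertex (a # w)"
  using assms by (cases w) (auto simp: flow_cancel)

text \<open>Walking along an edge and straight back contributes nothing, so the flow depends only on the
element of the free group.\<close>

lemma flow_reduce:
  assumes "w \<in> words"
  shows "flow vertex (reduce w) = flow vertex w"
  using assms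
proof (induction w)
  case (Cons a w)
  then have w: "w \<in> words" "a \<in> letters X" "[a] \<in> words" "reduce w \<in> words"
    using reduce_in_lists[of w "letters X"] by auto
  have "flow vertex (reduce (a # w)) = flow vertex ([a] @ reduce w)"
    using flow_cons_reduced[OF w(2,4)] by (simp add: reduce_def)
  also have "\<dots> = flow vertex ([a] @ w)"
    by (rule flow_append_cong) (use Cons.IH w in auto)
  finally show ?case by simp
qed (simp add: reduce_def)

lemma carrier_words: "g \<in> carrier (free_group X) \<Longrightarrow> g \<in> words"
  and carrier_reduce: "g \<in> carrier (free_group X) \<Longrightarrow> reduce g = g"
  by (auto simp: free_group_def reduce_reduced)

lemma vertex_carrier: "g \<in> carrier (free_group X) \<Longrightarrow> vertex g = h g"
  by (simp add: vertex_def carrier_reduce)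

lemma flow_mult:
  assumes "g \<in> carrier (free_group X)" "g' \<in> carrier (free_group X)" "q \<in> carrier Q"
  shows "flow vertex (g \<otimes>\<^bsub>free_group X\<^esub> g') (h g \<otimes> q, x) =
    flow vertex g (h g \<otimes> q, x) + flow vertex g' (q, x)"
proof -
  have w: "g \<in> words" "g' \<in> words" "g @ g' \<in> words"
    using assms carrier_words by auto
  have "flow vertex (g \<otimes>\<^bsub>free_group X\<^esub> g') = flow vertex (g @ g')"
    using flow_reduce[OF w(3)] by (simp add: free_group_def)
  then show ?thesis
    using flow_append[OF w(1,2) assms(3), of x] by (simp add: vertex_carrier assms(1))
qed

abbreviation (input) K where "K \<equiv> kernel (free_group X) Q h"

text \<open>Elements of the kernel represent closed paths, for which the translation in the cocycle identity is
trivial.  The flow is therefore a homomorphism from the kernel to an abelian group, and it vanishes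
on commutators of elements of the kernel.\<close>

lemma flow_mult_kernel:
  assumes "g \<in> K" "g' \<in> carrier (free_group X)"
  shows "flow vertex (g \<otimes>\<^bsub>free_group X\<^esub> g') e = flow vertex g e + flow vertex g' e"
proof (cases "fst e \<in> carrier Q")
  case True
  then show ?thesis
    using flow_mult[of g g' "fst e" "snd e"] assms by (simp add: kernel_def)
next
  case False
  have "g \<in> words" "g' \<in> words" "g \<otimes>\<^bsub>free_group X\<^esub> g' \<in> words"
    using assms by (auto intro!: carrier_words G.m_closed simp: kernel_def simp del: in_lists_conv_set)
  then show ?thesis using False flow_outside by (cases e) simp
qed

lemma flow_one [simp]: "flow vertex \<one>\<^bsub>free_group X\<^esub> e = 0"
  by (simp add: free_group_def)

lemma flow_inv_kernel:
  assumes "g \<in> K"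
  shows "flow vertex (inv\<^bsub>free_group X\<^esub> g) e = - flow vertex g e"
  using flow_mult_kernel[OF assms, of "inv\<^bsub>free_group X\<^esub> g" e] assms
  by (simp add: kernel_def)

lemma flow_pow_kernel:
  assumes "g \<in> K"
  shows "flow vertex (g [^]\<^bsub>free_group X\<^esub> (k::int)) e = k * flow vertex g e"
proof -
  have g: "g \<in> carrier (free_group X)" and gk: "g [^]\<^bsub>free_group X\<^esub> n \<in> K" for n :: nat
    using assms by (auto simp: kernel_def hom_nat_pow)
  have nat: "flow vertex (g [^]\<^bsub>free_group X\<^esub> n) e = int n * flow vertex g e" for n :: nat
    by (induction n) (use flow_mult_kernel[OF gk g] in \<open>auto simp: algebra_simps\<close>)
  show ?thesis
    using nat flow_inv_kernel[OF gk] g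
    by (cases k rule: int_cases2) (simp_all add: int_pow_int G.int_pow_neg)
qed

lemma flow_derived_kernel:
  assumes "g \<in> derived (free_group X) K"
  shows "flow vertex g e = 0"
proof -
  have sub: "subgroup K (free_group X)" by (rule subgroup_kernel)
  have inK: "derived (free_group X) K \<subseteq> K" by (rule G.derived_incl[OF order.refl sub])
  have comm: "flow vertex g e = 0 \<and> g \<in> K" if "g \<in> derived_set (free_group X) K" for g
  proof -
    from that obtain a b where ab: "a \<in> K" "b \<in> K"
      and g: "g = a \<otimes>\<^bsub>free_group X\<^esub> b \<otimes>\<^bsub>free_group X\<^esub> inv\<^bsub>free_group X\<^esub> a \<otimes>\<^bsub>free_group X\<^esub> inv\<^bsub>free_group X\<^esub> b"
      by auto
    have car: "x \<in> K \<Longrightarrow> x \<in> carrier (free_group X)" for x by (simp add: kernel_def)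
    show ?thesis
      unfolding g using ab subgroup.m_closed[OF sub] subgroup.m_inv_closed[OF sub]
      by (simp add: flow_mult_kernel flow_inv_kernel car)
  qed
  have "flow vertex g e = 0 \<and> g \<in> K"
    using assms unfolding derived_def
  proof (induction g rule: generate.induct)
    case one
    then show ?case using subgroup.one_closed[OF sub] by simp
  next
    case (incl x)
    then show ?case by (rule comm)
  next
    case (inv x)
    then show ?case using comm[OF inv] subgroup.m_inv_closed[OF sub] by (simp add: flow_inv_kernel)
  next
    case (eng x y)
    then show ?case
      using subgroup.m_closed[OF sub, of x y] flow_mult_kernel[of x y e]
      by (auto simp: kernel_def)
  qed
  then show ?thesis ..
qed

text \<open>The boundary of a path is its end minus its start.  In particular the flow of a word determines the
vertex that the word reaches.\<close>

lemma flow_boundary: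
  assumes "finite X" "w \<in> words" "q \<in> carrier Q"
  shows "(\<Sum>x\<in>X. flow vertex w (q \<otimes> inv vertex [(x, True)], x) - flow vertex w (q, x)) =
    of_bool (q = vertex w) - of_bool (q = \<one>)"
  using assms(2)
proof (induction w rule: rev_induct)
  case (snoc a w)
  obtain y s where a: "a = (y, s)" by (cases a)
  have w: "w \<in> words" "[a] \<in> words" "y \<in> X"
    using snoc.prems by (auto simp: a letters_def)
  let ?g = "\<lambda>x. vertex [(x, True)]"
  have g: "?g x \<in> carrier Q" if "x \<in> X" for x
    using that by (intro vertex_closed) (simp add: letters_def)
  have neg: "vertex [a] = inv ?g y" if "\<not> s"
    using vertex_inv_word[of "[(y, True)]"] that w(3)
    by (simp add: inv_word_def inv_letter_def a letters_def)
  have pos: "vertex [a] = ?g y" if s using that a by simp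
  define \<delta> where "\<delta> = (of_bool (q = vertex w \<otimes> vertex [a]) - of_bool (q = vertex w) :: int)"
  have v: "vertex w \<in> carrier Q" using w(1) by (rule vertex_closed)
  have main: "letter_flow vertex w a (q \<otimes> inv ?g x, x) - letter_flow vertex w a (q, x) =
      (if x = y then \<delta> else 0)" if "x \<in> X" for x
  proof (cases "x = y")
    case True
    have eq: "(q \<otimes> inv ?g y = p) = (q = p \<otimes> ?g y)" if "p \<in> carrier Q" for p
      using assms(3) g[OF w(3)] that by (metis H.inv_closed H.inv_inv H.inv_solve_right)
    show ?thesis
    proof (cases s)
      case True
      then show ?thesis using \<open>x = y\<close> eq[OF v] pos
        by (simp add: letter_flow_def \<delta>_def a)
    next
      case False
      have "(q \<otimes> inv ?g y = vertex w \<otimes> inv ?g y) = (q = vertex w)"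
        using assms(3) g[OF w(3)] v by simp
      then show ?thesis using \<open>x = y\<close> False neg[OF False] vertex_append[OF w(1,2)] w
        by (simp add: letter_flow_def \<delta>_def a)
    qed
  next
    case False
    then show ?thesis by (simp add: letter_flow_def a)
  qed
  have "(\<Sum>x\<in>X. flow vertex (w @ [a]) (q \<otimes> inv ?g x, x) - flow vertex (w @ [a]) (q, x)) =
     (\<Sum>x\<in>X. flow vertex w (q \<otimes> inv ?g x, x) - flow vertex w (q, x)) +
     (\<Sum>x\<in>X. letter_flow vertex w a (q \<otimes> inv ?g x, x) - letter_flow vertex w a (q, x))"
    by (simp add: algebra_simps sum.distrib sum_subtractf)
  also have "(\<Sum>x\<in>X. letter_flow vertex w a (q \<otimes> inv ?g x, x) - letter_flow vertex w a (q, x)) = \<delta>"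
    using assms(1) w(3) by (simp add: main cong: sum.cong)
  finally show ?case
    using snoc.IH[OF w(1)] vertex_append[OF w(1,2)] by (simp add: \<delta>_def)
qed simp

lemma vertex_eq_of_flow_eq:
  assumes "finite X" "u \<in> words" "v \<in> words" "flow vertex u = flow vertex v"
  shows "vertex u = vertex v"
  using flow_boundary[OF assms(1,2), of "vertex u"] flow_boundary[OF assms(1,3), of "vertex u"]
    assms by (simp split: if_splits)

text \<open>Let \<open>\<sigma> q\<close> represent the vertex \<open>q\<close>, with \<open>\<sigma> \<one> = \<one>\<close>, and attach to the edge \<open>(q, x)\<close> the element
\<open>\<sigma> q \<otimes> x \<otimes> inv \<sigma> (q \<otimes> x)\<close> of the kernel \<open>K\<close>.  Along a word \<open>w\<close> these elements, inverted on the edges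
that are run through backwards, multiply to \<open>w \<otimes> inv \<sigma> (vertex w)\<close>, because the representatives
telescope.  In the abelian group \<open>K / [K, K]\<close> the order of the factors does not matter, so the
product is a function of the flow of \<open>w\<close>.\<close>

lemma coset_eq_of_flow_eq:
  assumes "finite X" "u \<in> words" "v \<in> words" "flow vertex u = flow vertex v"
  defines "D \<equiv> derived (free_group X) K"
  shows "D #>\<^bsub>free_group X\<^esub> reduce u = D #>\<^bsub>free_group X\<^esub> reduce v"
proof -
  let ?G = "free_group X"
  have sub: "subgroup K ?G" by (rule subgroup_kernel)
  define A where "A = (?G\<lparr>carrier := K\<rparr>) Mod D"
  interpret A: comm_group A
    unfolding A_def D_def by (rule G.derived_quot_of_subgroup_is_comm_group[OF sub])
  have Dn: "D \<lhd> ?G\<lparr>carrier := K\<rparr>"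
    using group.derived_self_is_normal[OF G.subgroup_imp_group[OF sub]]
      G.derived_consistent[OF _ sub, of K] by (simp add: D_def)
  define \<tau> where "\<tau> g = D #>\<^bsub>?G\<^esub> g" for g
  have \<tau>: "\<tau> \<in> hom (?G\<lparr>carrier := K\<rparr>) A"
    using normal.r_coset_hom_Mod[OF Dn] by (simp add: A_def \<tau>_def[abs_def] r_coset_def)
  have \<tau>_mult: "\<tau> (g \<otimes>\<^bsub>?G\<^esub> g') = \<tau> g \<otimes>\<^bsub>A\<^esub> \<tau> g'" if "g \<in> K" "g' \<in> K" for g g'
    using Group.hom_mult[OF \<tau>] that by simp
  have \<tau>_closed: "\<tau> g \<in> carrier A" if "g \<in> K" for g
    using Group.hom_in_carrier[OF \<tau>] that by simp
  have \<tau>_inv: "\<tau> (inv\<^bsub>?G\<^esub> g) = inv\<^bsub>A\<^esub> \<tau> g" if g: "g \<in> K" for g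
  proof -
    have "group_hom (?G\<lparr>carrier := K\<rparr>) A \<tau>"
      using \<tau> G.subgroup_imp_group[OF sub] A.group_axioms
      by (simp add: group_hom_def group_hom_axioms_def)
    from group_hom.hom_inv[OF this, of g] show ?thesis
      using g G.m_inv_consistent[OF sub g] by simp
  qed
  define \<sigma> where "\<sigma> q = (if q = \<one> then \<one>\<^bsub>?G\<^esub> else SOME g. g \<in> carrier ?G \<and> h g = q)" for q
  have \<sigma>: "\<sigma> (vertex w) \<in> carrier ?G" "h (\<sigma> (vertex w)) = vertex w" if "w \<in> words" for w
    using someI[of "\<lambda>g. g \<in> carrier ?G \<and> h g = vertex w" "reduce w"] reduce_in_free_group[OF that]
      vertex_def[of w] by (simp_all add: \<sigma>_def)
  define edge where "edge w a = (if snd a then (vertex w, fst a) else (vertex (w @ [a]), fst a))"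
    for w and a :: "'a letter"
  define s where "s = (\<lambda>(q, x). \<sigma> q \<otimes>\<^bsub>?G\<^esub> reduce [(x, True)] \<otimes>\<^bsub>?G\<^esub> inv\<^bsub>?G\<^esub> \<sigma> (q \<otimes> vertex [(x, True)]))"
  \<comment> \<open>a finite set that contains all edges of both paths, so that products over it make sense\<close>
  define E where "E = (\<Union>w\<in>{u, v}. (\<lambda>p. edge (take p w) (w ! p)) ` {..<length w})"
  have kerI: "a \<otimes>\<^bsub>?G\<^esub> inv\<^bsub>?G\<^esub> b \<in> K" if "a \<in> carrier ?G" "b \<in> carrier ?G" "h a = h b" for a b
    using that by (simp add: kernel_def)
  have finE: "finite E" by (auto simp: E_def)
  have inE: "edge w' a \<in> E" if "w \<in> {u, v}" "w = w' @ a # w''" for w w' w'' a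
    using that by (auto simp: E_def intro!: image_eqI[of _ _ "length w'"])
  have letters: "[(x, True)] \<in> words" if "x \<in> X" for x using that by (simp add: letters_def)
  have sE: "s (vertex w, x) \<in> K" if "w \<in> words" "x \<in> X" for w x
  proof -
    have l: "[(x, True)] \<in> words" using that(2) by (rule letters)
    have "vertex w \<otimes> vertex [(x, True)] = vertex (w @ [(x, True)])"
      using that(1) l by simp
    moreover have wl: "w @ [(x, True)] \<in> words" using that(1) l by simp
    ultimately show ?thesis
      unfolding s_def prod.case
      by (intro kerI) (simp_all only: G.m_closed hom_mult \<sigma>[OF that(1)] \<sigma>[OF wl] reduce_in_free_group[OF l] vertex_def[of "[(x, True)]", symmetric])
  qed
  have sK: "s e \<in> K" if "e \<in> E" for e
  proof -
    from that consider w p where "w \<in> {u, v}" "p < length w" "e = edge (take p w) (w ! p)"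
      unfolding E_def by (elim UN_E imageE) simp
    then show ?thesis
    proof cases
      case (1 w p)
      then have w: "w \<in> words" using assms(2,3) by blast
      have l: "w ! p \<in> letters X" using w 1(2) by (simp add: in_lists_conv_set)
      then have x: "fst (w ! p) \<in> X" by (auto simp: letters_def)
      have t: "take p w \<in> words"
        using w by (blast dest: in_set_takeD)
      then have t': "take p w @ [w ! p] \<in> words" using l by simp
      show ?thesis
        unfolding 1(3) edge_def using sE[OF t x] sE[OF t' x] by simp
    qed
  qed
  define \<Phi> where "\<Phi> f = (\<Otimes>\<^bsub>A\<^esub>e\<in>E. \<tau> (s e) [^]\<^bsub>A\<^esub> (f e :: int))" for f
  have pow_closed: "\<tau> (s e) [^]\<^bsub>A\<^esub> (k::int) \<in> carrier A" if "e \<in> E" for e k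
    using that sK \<tau>_closed by (simp add: A.int_pow_closed)
  have \<Phi>_add: "\<Phi> (\<lambda>e. f e + g e) = \<Phi> f \<otimes>\<^bsub>A\<^esub> \<Phi> g" for f g
  proof -
    have "\<Phi> (\<lambda>e. f e + g e) = (\<Otimes>\<^bsub>A\<^esub>e\<in>E. \<tau> (s e) [^]\<^bsub>A\<^esub> f e \<otimes>\<^bsub>A\<^esub> \<tau> (s e) [^]\<^bsub>A\<^esub> g e)"
      unfolding \<Phi>_def using sK \<tau>_closed
      by (intro A.finprod_cong') (simp_all add: A.int_pow_mult pow_closed)
    also have "\<dots> = \<Phi> f \<otimes>\<^bsub>A\<^esub> \<Phi> g"
      unfolding \<Phi>_def by (intro A.finprod_multf) (simp_all add: pow_closed)
    finally show ?thesis .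
  qed
  have \<Phi>_single: "\<Phi> (\<lambda>e'. if e' = e then k else 0) = \<tau> (s e) [^]\<^bsub>A\<^esub> k" if "e \<in> E" for e k
  proof -
    have "\<Phi> (\<lambda>e'. if e' = e then k else 0) = (\<Otimes>\<^bsub>A\<^esub>e'\<in>E. if e = e' then \<tau> (s e') [^]\<^bsub>A\<^esub> k else \<one>\<^bsub>A\<^esub>)"
      unfolding \<Phi>_def by (intro A.finprod_cong') (simp_all add: pow_closed)
    also have "\<dots> = \<tau> (s e) [^]\<^bsub>A\<^esub> k"
      using that finE by (intro A.finprod_singleton) (simp_all add: pow_closed)
    finally show ?thesis .
  qed
  define n where "n w = reduce w \<otimes>\<^bsub>?G\<^esub> inv\<^bsub>?G\<^esub> \<sigma> (vertex w)" for w
  have nK: "n w \<in> K" if "w \<in> words" for w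
    unfolding n_def by (rule kerI) (simp_all only: \<sigma>[OF that] reduce_in_free_group[OF that] vertex_def[of w, symmetric])
  have main: "\<tau> (n w) = \<Phi> (flow vertex w)" if "w0 \<in> {u, v}" "w0 = w @ w'" for w0 w w'
    using that
  proof (induction w arbitrary: w' rule: rev_induct)
    case Nil
    have "n [] = \<one>\<^bsub>?G\<^esub>"
      using G.inv_one by (simp add: n_def \<sigma>_def) (simp add: reduce_def free_group_def)
    moreover have "\<tau> \<one>\<^bsub>?G\<^esub> = \<one>\<^bsub>A\<^esub>"
      using subgroup.one_closed[OF sub] \<tau>_mult[of "\<one>\<^bsub>?G\<^esub>" "\<one>\<^bsub>?G\<^esub>"] \<tau>_closed[of "\<one>\<^bsub>?G\<^esub>"] by simp
    moreover have "flow vertex [] = (\<lambda>e. 0)" by auto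
    ultimately show ?case by (simp add: \<Phi>_def A.finprod_one_eqI)
  next
    case (snoc a w)
    let ?e = "edge w a"
    have IH: "\<tau> (n w) = \<Phi> (flow vertex w)" using snoc.IH[of "a # w'"] snoc.prems by simp
    have wa: "w \<in> words" "w @ [a] \<in> words" "[a] \<in> words"
      using snoc.prems assms(2,3) by auto
    have e: "?e \<in> E" using inE[of w0 w a w'] snoc.prems by simp
    obtain x b where a: "a = (x, b)" by (cases a)
    have x: "x \<in> X" using wa(3) by (simp add: a letters_def)
    have car: "reduce w \<in> carrier ?G" "reduce [a] \<in> carrier ?G" "reduce [(x, True)] \<in> carrier ?G"
      using wa x by (auto intro!: reduce_in_free_group letters simp del: in_lists_conv_set)
    note sg = \<sigma>[OF wa(1)] \<sigma>[OF wa(2)]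
    have vx: "vertex w \<otimes> vertex [a] = vertex (w @ [a])" using vertex_append[OF wa(1,3)] by simp
    have fl: "flow vertex (w @ [a]) = (\<lambda>e. flow vertex w e + (if e = ?e then (if b then 1 else -1) else 0))"
      by (auto simp: fun_eq_iff letter_flow_def edge_def a)
    have step: "n (w @ [a]) = n w \<otimes>\<^bsub>?G\<^esub> (\<sigma> (vertex w) \<otimes>\<^bsub>?G\<^esub> reduce [a] \<otimes>\<^bsub>?G\<^esub> inv\<^bsub>?G\<^esub> \<sigma> (vertex (w @ [a])))"
    proof -
      have c: "inv\<^bsub>?G\<^esub> \<sigma> (vertex w) \<otimes>\<^bsub>?G\<^esub> (\<sigma> (vertex w) \<otimes>\<^bsub>?G\<^esub> z) = z" if "z \<in> carrier ?G" for z
        using that sg(1) by (simp add: G.m_assoc[symmetric])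
      show ?thesis
        unfolding n_def mult_free_group[of X w "[a]", symmetric]
        using car sg by (simp add: G.m_assoc c)
    qed
    have incr: "\<sigma> (vertex w) \<otimes>\<^bsub>?G\<^esub> reduce [a] \<otimes>\<^bsub>?G\<^esub> inv\<^bsub>?G\<^esub> \<sigma> (vertex (w @ [a])) =
      (if b then s ?e else inv\<^bsub>?G\<^esub> s ?e)"
    proof (cases b)
      case True
      then show ?thesis using vx by (simp add: a s_def edge_def)
    next
      case False
      have inva: "reduce [a] = inv\<^bsub>?G\<^esub> reduce [(x, True)]"
        using inv_free_group[OF letters[OF x]] False by (simp add: a inv_word_def inv_letter_def)
      have "vertex (w @ [a]) \<otimes> vertex [(x, True)] = vertex w"
        using vx[symmetric] vertex_inv_word[OF letters[OF x]] vertex_closed[OF wa(1)]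
          vertex_closed[OF letters[OF x]] False
        by (simp add: a inv_word_def inv_letter_def H.m_assoc)
      then show ?thesis
        using inva False sg car by (simp add: a s_def edge_def G.inv_mult_group G.m_assoc)
    qed
    have "\<tau> (n (w @ [a])) = \<tau> (n w) \<otimes>\<^bsub>A\<^esub> \<tau> (if b then s ?e else inv\<^bsub>?G\<^esub> s ?e)"
      unfolding step incr using nK[OF wa(1)] sK[OF e] subgroup.m_inv_closed[OF sub]
      by (intro \<tau>_mult) auto
    also have "\<tau> (if b then s ?e else inv\<^bsub>?G\<^esub> s ?e) = \<tau> (s ?e) [^]\<^bsub>A\<^esub> (if b then 1 else -1 :: int)"
      using \<tau>_closed[OF sK[OF e]] \<tau>_inv[OF sK[OF e]] by (simp add: A.int_pow_neg)
    also have "\<dots> = \<Phi> (\<lambda>e. if e = ?e then (if b then 1 else -1) else 0)"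
      by (rule \<Phi>_single[OF e, symmetric])
    finally show ?case by (simp only: IH fl \<Phi>_add)
  qed
  have "\<tau> (n u) = \<tau> (n v)"
    using main[of u u "[]"] main[of v v "[]"] assms(4) by simp
  have D: "D \<subseteq> carrier ?G"
    unfolding D_def by (rule G.derived_in_carrier[OF subgroup.subset[OF sub]])
  let ?t = "\<sigma> (vertex u)"
  note t = \<sigma>(1)[OF assms(2)]
  have "D #>\<^bsub>?G\<^esub> (reduce u \<otimes>\<^bsub>?G\<^esub> inv\<^bsub>?G\<^esub> ?t) = D #>\<^bsub>?G\<^esub> (reduce v \<otimes>\<^bsub>?G\<^esub> inv\<^bsub>?G\<^esub> ?t)"
    using \<open>\<tau> (n u) = \<tau> (n v)\<close> vertex_eq_of_flow_eq[OF assms(1-4)] by (simp add: n_def \<tau>_def)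
  then have "D #>\<^bsub>?G\<^esub> reduce u #>\<^bsub>?G\<^esub> inv\<^bsub>?G\<^esub> ?t #>\<^bsub>?G\<^esub> ?t = D #>\<^bsub>?G\<^esub> reduce v #>\<^bsub>?G\<^esub> inv\<^bsub>?G\<^esub> ?t #>\<^bsub>?G\<^esub> ?t"
    using D t reduce_in_free_group[OF assms(2)] reduce_in_free_group[OF assms(3)]
    by (simp only: G.coset_mult_assoc G.inv_closed)
  then show ?thesis
    using D t reduce_in_free_group[OF assms(2)] reduce_in_free_group[OF assms(3)]
    by (simp add: G.coset_mult_assoc G.m_assoc)
qed

text \<open>
This is the form of the Magnus embedding that the algorithm uses: with the kernel \<open>K\<close> of a
homomorphism to \<open>Q\<close>, equality modulo \<open>[K, K]\<close> is decided by counting edges in the Cayley graph of \<open>Q\<close>.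
\<close>

theorem derived_coset_eq_iff_flow_eq:
  assumes "finite X" "u \<in> words" "v \<in> words"
  defines "D \<equiv> derived (free_group X) K"
  shows "D #>\<^bsub>free_group X\<^esub> reduce u = D #>\<^bsub>free_group X\<^esub> reduce v \<longleftrightarrow> flow vertex u = flow vertex v"
proof
  assume eq: "D #>\<^bsub>free_group X\<^esub> reduce u = D #>\<^bsub>free_group X\<^esub> reduce v"
  have sub: "subgroup K (free_group X)" by (rule subgroup_kernel)
  have D: "subgroup D (free_group X)"
    unfolding D_def by (rule G.derived_is_subgroup[OF subgroup.subset[OF sub]])
  have DK: "D \<subseteq> K" unfolding D_def by (rule G.derived_incl[OF order.refl sub])
  have "reduce u \<in> D #>\<^bsub>free_group X\<^esub> reduce v"
    using G.rcos_self[OF reduce_in_free_group[OF assms(2)] D] eq by simp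
  then obtain g where g: "g \<in> D" "reduce u = g \<otimes>\<^bsub>free_group X\<^esub> reduce v"
    by (auto simp: r_coset_def)
  have "flow vertex (reduce u) e = flow vertex (reduce v) e" for e
    using flow_mult_kernel[of g "reduce v" e] flow_derived_kernel[of g e] g DK
      reduce_in_free_group[OF assms(3)] by (auto simp: D_def)
  then show "flow vertex u = flow vertex v"
    using flow_reduce[OF assms(2)] flow_reduce[OF assms(3)] by auto
next
  assume "flow vertex u = flow vertex v"
  then show "D #>\<^bsub>free_group X\<^esub> reduce u = D #>\<^bsub>free_group X\<^esub> reduce v"
    unfolding D_def by (rule coset_eq_of_flow_eq[OF assms(1-3)])
qed

end

section \<open>The derived series of a free group\<close>

abbreviation "FG r \<equiv> free_group {1..r::nat}"

definition level_flow :: "nat \<Rightarrow> nat \<Rightarrow> nat word \<Rightarrow> nat word set \<times> nat \<Rightarrow> int"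
  where "level_flow r i = flow (word_class r i)"

lemma free_group_hom_level:
  "free_group_hom {1..r} (free_solvable_group r i) (\<lambda>g. derived_term (FG r) i #>\<^bsub>FG r\<^esub> g)"
  using normal.r_coset_hom_Mod[OF group.derived_term_normal[OF group_free_group]]
  by (simp add: free_group_hom_def group_hom_def group_hom_axioms_def group_free_group
      group_free_solvable_group) (simp add: free_solvable_group_def)

text \<open>There is no assumption: interpreting this locale provides the lemmas about flows for the quotient by
the term \<open>i\<close> of the derived series.\<close>

locale solvable_level = fixes r i :: nat

sublocale solvable_level \<subseteq> free_group_hom "{1..r}" "free_solvable_group r i"
    "\<lambda>g. derived_term (free_group {1..r}) i #>\<^bsub>free_group {1..r}\<^esub> g"
  by (rule free_group_hom_level)

context solvable_level
begin

lemma vertex_eq: "vertex = word_class r i"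
  by (rule ext) (simp only: vertex_def word_class_def)

lemma kernel_eq:
  "kernel (FG r) (free_solvable_group r i) (\<lambda>g. derived_term (FG r) i #>\<^bsub>FG r\<^esub> g) = derived_term (FG r) i"
proof -
  interpret N: normal "derived_term (FG r) i" "FG r"
    by (rule group.derived_term_normal[OF group_free_group])
  have "(derived_term (FG r) i #>\<^bsub>FG r\<^esub> g = derived_term (FG r) i) = (g \<in> derived_term (FG r) i)"
    if "g \<in> carrier (FG r)" for g
    using that N.rcos_const[OF G.group_axioms] G.rcos_self[OF _ N.subgroup_axioms] by metis
  then show ?thesis using N.subset
    by (auto simp: kernel_def free_solvable_group_def FactGroup_def)
qed

lemma word_class_Suc_iff:
  assumes "u \<in> words" "v \<in> words"
  shows "word_class r (Suc i) u = word_class r (Suc i) v \<longleftrightarrow> level_flow r i u = level_flow r i v"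
  using derived_coset_eq_iff_flow_eq[OF finite_atLeastAtMost assms]
  unfolding kernel_eq level_flow_def vertex_eq by (simp add: word_class_def derived_term_def)

lemma in_derived_term_Suc_iff:
  assumes "g \<in> carrier (FG r)" "g' \<in> carrier (FG r)"
  shows "g \<otimes>\<^bsub>FG r\<^esub> inv\<^bsub>FG r\<^esub> g' \<in> derived_term (FG r) (Suc i) \<longleftrightarrow> level_flow r i g = level_flow r i g'"
proof -
  have "subgroup (derived_term (FG r) (Suc i)) (FG r)"
    using G.derived_term_normal by (rule normal_imp_subgroup)
  from G.rcoset_eq_iff[OF this assms] word_class_Suc_iff[OF assms[THEN carrier_words]]
  show ?thesis
    by (simp only: word_class_def carrier_reduce[OF assms(1)] carrier_reduce[OF assms(2)])
qed

lemma in_derived_term_Suc_iff_zero: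
  assumes "g \<in> carrier (FG r)"
  shows "g \<in> derived_term (FG r) (Suc i) \<longleftrightarrow> (\<forall>e. level_flow r i g e = 0)"
  using in_derived_term_Suc_iff[OF assms G.one_closed] assms flow_one
  by (simp add: fun_eq_iff level_flow_def vertex_eq del: One_nat_def)

text \<open>If \<open>x\<close> commutes with \<open>v\<close> modulo the next term of the derived series, the cocycle identity, applied
to both products, says that the flow of \<open>x\<close> is invariant under translation by the vertex of \<open>v\<close>.
That vertex has infinite order, so every edge has infinitely many translates, while a flow has
finite support: the flow of \<open>x\<close> is zero.\<close>

lemma in_derived_term_Suc_if_commutes:
  assumes v: "v \<in> carrier (FG r)" and inf: "\<And>m::nat. 0 < m \<Longrightarrow> v [^]\<^bsub>FG r\<^esub> m \<notin> derived_term (FG r) i"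
    and x: "x \<in> derived_term (FG r) i"
    and comm: "level_flow r i (x \<otimes>\<^bsub>FG r\<^esub> v) = level_flow r i (v \<otimes>\<^bsub>FG r\<^esub> x)"
  shows "x \<in> derived_term (FG r) (Suc i)"
proof -
  let ?h = "\<lambda>g. derived_term (FG r) i #>\<^bsub>FG r\<^esub> g" and ?S = "free_solvable_group r i"
  have xK: "x \<in> kernel (FG r) ?S ?h" using x by (simp only: kernel_eq)
  then have xc: "x \<in> carrier (FG r)" by (simp add: kernel_def)
  have hv: "?h v \<in> carrier ?S" using v by (rule hom_closed)
  have shift: "flow vertex x (?h v \<otimes>\<^bsub>?S\<^esub> q, y) = flow vertex x (q, y)" if "q \<in> carrier ?S" for q y
    using flow_mult_kernel[OF xK v, of "(?h v \<otimes>\<^bsub>?S\<^esub> q, y)"] flow_mult[OF v xc that, of y] comm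
    by (simp add: level_flow_def vertex_eq del: One_nat_def)
  have "flow vertex x e = 0" for e
  proof (rule ccontr)
    assume nz: "flow vertex x e \<noteq> 0"
    obtain q y where e: "e = (q, y)" by (cases e)
    have q: "q \<in> carrier ?S" using nz flow_outside[OF carrier_words[OF xc]] e by blast
    let ?g = "\<lambda>m::nat. (?h v [^]\<^bsub>?S\<^esub> m \<otimes>\<^bsub>?S\<^esub> q, y)"
    have shifts: "flow vertex x (?g m) = flow vertex x e" for m
    proof (induction m)
      case (Suc m)
      have "?h v [^]\<^bsub>?S\<^esub> Suc m \<otimes>\<^bsub>?S\<^esub> q = ?h v \<otimes>\<^bsub>?S\<^esub> (?h v [^]\<^bsub>?S\<^esub> m \<otimes>\<^bsub>?S\<^esub> q)"
        using hv q H.nat_pow_Suc2[OF hv, of m] by (simp add: H.m_assoc)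
      then show ?case using Suc shift[of "?h v [^]\<^bsub>?S\<^esub> m \<otimes>\<^bsub>?S\<^esub> q" y] hv q by simp
    qed (use q e in simp)
    have "inj ?g"
    proof (rule linorder_injI)
      fix m n :: nat assume mn: "m < n"
      show "?g m \<noteq> ?g n"
      proof
        assume "?g m = ?g n"
        then have "?h v [^]\<^bsub>?S\<^esub> m = ?h v [^]\<^bsub>?S\<^esub> n" using hv q by simp
        also have "\<dots> = ?h v [^]\<^bsub>?S\<^esub> m \<otimes>\<^bsub>?S\<^esub> ?h v [^]\<^bsub>?S\<^esub> (n - m)"
          using mn H.nat_pow_mult[OF hv, of m "n - m"] by simp
        finally have "?h v [^]\<^bsub>?S\<^esub> (n - m) = \<one>\<^bsub>?S\<^esub>"
          using hv by simp
        then have "v [^]\<^bsub>FG r\<^esub> (n - m) \<in> kernel (FG r) ?S ?h"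
          using v hom_nat_pow[OF v, of "n - m"] G.nat_pow_closed[OF v] by (simp add: kernel_def)
        with inf[of "n - m"] mn show False by (simp add: kernel_eq del: One_nat_def)
      qed
    qed
    then have "infinite (range ?g)" using finite_imageD[of ?g UNIV] by auto
    moreover have "range ?g \<subseteq> {e. flow vertex x e \<noteq> 0}" using shifts nz by auto
    ultimately show False using finite_flow_support[of vertex x] finite_subset by blast
  qed
  then show ?thesis
    using in_derived_term_Suc_iff_zero[OF xc] by (simp only: level_flow_def vertex_eq) simp
qed

text \<open>The quotients of the derived series are torsion-free, since the flow of a power of \<open>v\<close> is a
multiple of the flow of \<open>v\<close>.\<close>

lemma pow_notin_derived_term_Suc:
  assumes "v \<in> derived_term (FG r) i" "v \<notin> derived_term (FG r) (Suc i)" "0 < (m::nat)"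
  shows "v [^]\<^bsub>FG r\<^esub> m \<notin> derived_term (FG r) (Suc i)"
proof
  assume *: "v [^]\<^bsub>FG r\<^esub> m \<in> derived_term (FG r) (Suc i)"
  have vK: "v \<in> kernel (FG r) (free_solvable_group r i) (\<lambda>g. derived_term (FG r) i #>\<^bsub>FG r\<^esub> g)"
    using assms(1) by (simp only: kernel_eq)
  then have v: "v \<in> carrier (FG r)" by (simp add: kernel_def)
  have "int m * level_flow r i v e = 0" for e
    using flow_pow_kernel[OF vK, of "int m" e] * in_derived_term_Suc_iff_zero[OF G.nat_pow_closed[OF v], of m]
    unfolding level_flow_def vertex_eq int_pow_int by metis
  then show False using assms(2,3) in_derived_term_Suc_iff_zero[OF v] by simp
qed

end

lemma derived_term_antimono: "i \<le> j \<Longrightarrow> derived_term (FG r) j \<subseteq> derived_term (FG r) i"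
proof (induction j rule: dec_induct)
  case (step n)
  interpret group "FG r" by (rule group_free_group)
  have "derived_term (FG r) (Suc n) \<subseteq> derived_term (FG r) n"
    using derived_incl[OF order.refl normal_imp_subgroup[OF derived_term_normal[of n]]]
    by (simp add: derived_term_def)
  with step show ?case by blast
qed simp

text \<open>Write \<open>x\<close> for \<open>u \<otimes> v [^] (- k)\<close>.  Proportional flows at level \<open>j\<close> mean that \<open>x\<close> lies in the next term
of the derived series.  Since \<open>x\<close> commutes with \<open>v\<close>, and \<open>v\<close> has infinite order modulo all later
terms, \<open>x\<close> descends from each term to the following one until it reaches the term \<open>d\<close>.\<close>

theorem power_iff_flow_multiple:
  fixes k :: int
  assumes u: "u \<in> lists (letters {1..r})" and v: "v \<in> lists (letters {1..r})" and "j < d"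
    and vj: "word_class r j v = word_class r j []"
    and last: "Suc j = d \<or> word_class r (Suc j) v \<noteq> word_class r (Suc j) []"
    and comm: "word_class r d (u @ v) = word_class r d (v @ u)"
  shows "word_class r d u = word_class r d v [^]\<^bsub>free_solvable_group r d\<^esub> k \<longleftrightarrow>
    (\<forall>e. level_flow r j u e = k * level_flow r j v e)"
proof -
  let ?G = "FG r" and ?D = "derived_term (FG r)"
  define f g where "f = reduce v" and "g = reduce u"
  interpret J: solvable_level r j .
  interpret D: solvable_level r d .
  have f: "f \<in> carrier ?G" and g: "g \<in> carrier ?G"
    using u v by (auto simp: f_def g_def simp del: in_lists_conv_set)
  have sub: "subgroup (?D i) ?G" for i
    using J.G.derived_term_normal by (rule normal_imp_subgroup)
  note coset_iff = J.G.rcoset_eq_iff[OF sub]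
  have fj: "f \<in> ?D j"
    using vj coset_iff[OF f J.G.one_closed] f
    by (simp add: word_class_def f_def[symmetric] del: One_nat_def)
       (simp add: free_group_def reduce_def)
  have flow_f: "level_flow r j f = level_flow r j v" and flow_g: "level_flow r j g = level_flow r j u"
    using J.flow_reduce u v by (simp_all only: f_def g_def level_flow_def J.vertex_eq)
  have fk: "f [^]\<^bsub>?G\<^esub> k \<in> carrier ?G" using f by (rule J.G.int_pow_closed)
  let ?x = "g \<otimes>\<^bsub>?G\<^esub> inv\<^bsub>?G\<^esub> (f [^]\<^bsub>?G\<^esub> k)"
  have "word_class r d v [^]\<^bsub>free_solvable_group r d\<^esub> k = ?D d #>\<^bsub>?G\<^esub> (f [^]\<^bsub>?G\<^esub> k)"
    using D.hom_int_pow[OF f, of k] by (simp only: word_class_def f_def)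
  then have lhs: "word_class r d u = word_class r d v [^]\<^bsub>free_solvable_group r d\<^esub> k \<longleftrightarrow> ?x \<in> ?D d"
    using coset_iff[OF g fk] by (simp only: word_class_def g_def)
  have "f \<in> kernel ?G (free_solvable_group r j) (\<lambda>g. ?D j #>\<^bsub>?G\<^esub> g)"
    using fj by (simp only: J.kernel_eq)
  then have "level_flow r j (f [^]\<^bsub>?G\<^esub> k) e = k * level_flow r j v e" for e
    using J.flow_pow_kernel unfolding flow_f[symmetric] by (simp only: level_flow_def J.vertex_eq)
  then have rhs: "(\<forall>e. level_flow r j u e = k * level_flow r j v e) \<longleftrightarrow> ?x \<in> ?D (Suc j)"
    using J.in_derived_term_Suc_iff[OF g fk] by (simp add: flow_g fun_eq_iff del: One_nat_def)
  have climb: "?x \<in> ?D d" if x: "?x \<in> ?D (Suc j)" and fS: "f \<notin> ?D (Suc j)"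
  proof -
    let ?h = "\<lambda>g. ?D d #>\<^bsub>?G\<^esub> g" and ?S = "free_solvable_group r d"
    have xc: "?x \<in> carrier ?G" by (rule J.G.m_closed[OF g J.G.inv_closed[OF fk]])
    have xfc: "?x \<otimes>\<^bsub>?G\<^esub> f \<in> carrier ?G" "f \<otimes>\<^bsub>?G\<^esub> ?x \<in> carrier ?G"
      by (rule J.G.m_closed[OF xc f] J.G.m_closed[OF f xc])+
    have c: "?h g \<in> carrier ?S" "?h f \<in> carrier ?S" using D.hom_closed f g by blast+
    have gf: "?h g \<otimes>\<^bsub>?S\<^esub> ?h f = ?h f \<otimes>\<^bsub>?S\<^esub> ?h g"
      using comm D.vertex_append[OF u v] D.vertex_append[OF v u]
      by (simp only: D.vertex_eq) (simp only: word_class_def f_def g_def)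
    have hx: "?h ?x = ?h g \<otimes>\<^bsub>?S\<^esub> ?h f [^]\<^bsub>?S\<^esub> (- k)"
      using g fk D.hom_int_pow[OF f, of k] D.H.int_pow_neg[OF c(2), of k]
        D.hom_mult[of g "inv\<^bsub>?G\<^esub> (f [^]\<^bsub>?G\<^esub> k)"] D.hom_inv[of "f [^]\<^bsub>?G\<^esub> k"]
      by (simp only: J.G.inv_closed)
    have "?h f [^]\<^bsub>?S\<^esub> (- k) \<otimes>\<^bsub>?S\<^esub> ?h f = ?h f \<otimes>\<^bsub>?S\<^esub> ?h f [^]\<^bsub>?S\<^esub> (- k)"
      using D.H.int_pow_mult[OF c(2), of "- k" 1] D.H.int_pow_mult[OF c(2), of 1 "- k"]
        D.H.int_pow_1[OF c(2)] by (simp only: add.commute[of "- k" 1])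
    then have "?h ?x \<otimes>\<^bsub>?S\<^esub> ?h f = ?h f \<otimes>\<^bsub>?S\<^esub> ?h ?x"
      unfolding hx using c gf D.H.int_pow_closed[OF c(2), of "- k"] D.H.m_assoc by metis
    then have xf: "(?x \<otimes>\<^bsub>?G\<^esub> f) \<otimes>\<^bsub>?G\<^esub> inv\<^bsub>?G\<^esub> (f \<otimes>\<^bsub>?G\<^esub> ?x) \<in> ?D d"
      using coset_iff[OF xfc, of d] D.hom_mult[OF xc f] D.hom_mult[OF f xc] by simp
    have "Suc j \<le> d" using \<open>j < d\<close> by simp
    then show ?thesis
    proof (induction rule: dec_induct)
      case (step i)
      interpret I: solvable_level r i .
      have "level_flow r i (?x \<otimes>\<^bsub>?G\<^esub> f) = level_flow r i (f \<otimes>\<^bsub>?G\<^esub> ?x)"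
        using I.in_derived_term_Suc_iff[OF xfc] xf
          derived_term_antimono[of "Suc i" d r] step.hyps by auto
      moreover have "f [^]\<^bsub>?G\<^esub> m \<notin> ?D i" if "0 < m" for m :: nat
        using J.pow_notin_derived_term_Suc[OF fj fS that] derived_term_antimono[OF step.hyps(1)] by blast
      ultimately show ?case using I.in_derived_term_Suc_if_commutes[OF f _ step.IH] by blast
    qed (rule x)
  qed
  have fS: "f \<notin> ?D (Suc j)" if "Suc j \<noteq> d"
    using last coset_iff[OF f J.G.one_closed, of "Suc j"] f that
    by (simp add: word_class_def f_def[symmetric] del: One_nat_def)
       (simp add: free_group_def reduce_def)
  show ?thesis
    unfolding lhs rhs using climb fS derived_term_antimono[of "Suc j" d r] \<open>j < d\<close> by auto
qed

section \<open>A structured language with arrays\<close>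

text \<open>Programs of this language work on integer variables, on arrays indexed by natural numbers, and on an
input string that is only read (\<open>In\<close>).\<close>

datatype aexp = N int | V nat | Arr nat aexp | In aexp | Plus aexp aexp | Minus aexp aexp

datatype cond = Less aexp aexp | Equal aexp aexp

datatype com =
    Skip
  | Assign nat aexp  (\<open>_ ::= _\<close> [62, 61] 61)
  | Update nat aexp aexp
  | Seq com com  (infixr \<open>;;\<close> 60)
  | If cond com com
  | While cond com

record state =
  var :: "nat \<Rightarrow> int"
  arr :: "nat \<Rightarrow> nat \<Rightarrow> int"

fun aval :: "int list \<Rightarrow> aexp \<Rightarrow> state \<Rightarrow> int"
  where
    "aval inp (N c) s = c"
  | "aval inp (V x) s = var s x"
  | "aval inp (Arr a e) s = arr s a (nat (aval inp e s))"
  | "aval inp (In e) s = inp ! nat (aval inp e s)"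
  | "aval inp (Plus e1 e2) s = aval inp e1 s + aval inp e2 s"
  | "aval inp (Minus e1 e2) s = aval inp e1 s - aval inp e2 s"

fun cval :: "int list \<Rightarrow> cond \<Rightarrow> state \<Rightarrow> bool"
  where
    "cval inp (Less e1 e2) s \<longleftrightarrow> aval inp e1 s < aval inp e2 s"
  | "cval inp (Equal e1 e2) s \<longleftrightarrow> aval inp e1 s = aval inp e2 s"

fun esize :: "aexp \<Rightarrow> nat"
  where
    "esize (N c) = 1"
  | "esize (V x) = 1"
  | "esize (Arr a e) = Suc (esize e)"
  | "esize (In e) = Suc (esize e)"
  | "esize (Plus e1 e2) = Suc (esize e1 + esize e2)"
  | "esize (Minus e1 e2) = Suc (esize e1 + esize e2)"

fun csize :: "cond \<Rightarrow> nat"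
  where
    "csize (Less e1 e2) = esize e1 + esize e2"
  | "csize (Equal e1 e2) = esize e1 + esize e2"

text \<open>The second operand of every addition must have absolute value at most \<open>K\<close>, and so must every
constant.  The largest absolute value in the state then grows by at most \<open>K\<close> for each node of an
evaluated expression: numbers stay linear in the running time, and no invariant of a program has to
speak about the length of its numbers.\<close>

fun safe :: "int list \<Rightarrow> nat \<Rightarrow> aexp \<Rightarrow> state \<Rightarrow> bool"
  where
    "safe inp K (N c) s \<longleftrightarrow> \<bar>c\<bar> \<le> int K"
  | "safe inp K (V x) s \<longleftrightarrow> True"
  | "safe inp K (Arr a e) s \<longleftrightarrow> safe inp K e s \<and> 0 \<le> aval inp e s"
  | "safe inp K (In e) s \<longleftrightarrow> safe inp K e s \<and> 0 \<le> aval inp e s \<and> aval inp e s < int (length inp)"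
  | "safe inp K (Plus e1 e2) s \<longleftrightarrow> safe inp K e1 s \<and> safe inp K e2 s \<and> \<bar>aval inp e2 s\<bar> \<le> int K"
  | "safe inp K (Minus e1 e2) s \<longleftrightarrow> safe inp K e1 s \<and> safe inp K e2 s \<and> \<bar>aval inp e2 s\<bar> \<le> int K"

fun csafe :: "int list \<Rightarrow> nat \<Rightarrow> cond \<Rightarrow> state \<Rightarrow> bool"
  where
    "csafe inp K (Less e1 e2) s \<longleftrightarrow> safe inp K e1 s \<and> safe inp K e2 s"
  | "csafe inp K (Equal e1 e2) s \<longleftrightarrow> safe inp K e1 s \<and> safe inp K e2 s"

definition set_var :: "nat \<Rightarrow> int \<Rightarrow> state \<Rightarrow> state"
  where "set_var x v s = s\<lparr>var := (var s)(x := v)\<rparr>"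

definition set_arr :: "nat \<Rightarrow> nat \<Rightarrow> int \<Rightarrow> state \<Rightarrow> state"
  where "set_arr a i v s = s\<lparr>arr := (arr s)(a := (arr s a)(i := v))\<rparr>"

text \<open>The time of a run is the number of nodes of the expressions that it evaluates.  Runs exist only for
programs all of whose evaluations are safe.\<close>

inductive big :: "int list \<Rightarrow> nat \<Rightarrow> com \<Rightarrow> state \<Rightarrow> nat \<Rightarrow> state \<Rightarrow> bool" for inp K
  where
    Skip: "big inp K Skip s 0 s"
  | Assign: "safe inp K e s \<Longrightarrow> big inp K (x ::= e) s (esize e) (set_var x (aval inp e s) s)"
  | Update: "safe inp K i s \<Longrightarrow> 0 \<le> aval inp i s \<Longrightarrow> safe inp K e s \<Longrightarrow>
      big inp K (Update a i e) s (esize i + esize e) (set_arr a (nat (aval inp i s)) (aval inp e s) s)"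
  | Seq: "big inp K c1 s t1 s1 \<Longrightarrow> big inp K c2 s1 t2 s2 \<Longrightarrow> big inp K (c1 ;; c2) s (t1 + t2) s2"
  | If: "csafe inp K b s \<Longrightarrow> big inp K (if cval inp b s then c1 else c2) s t s' \<Longrightarrow>
      big inp K (If b c1 c2) s (csize b + t) s'"
  | WhileF: "csafe inp K b s \<Longrightarrow> \<not> cval inp b s \<Longrightarrow> big inp K (While b c) s (csize b) s"
  | WhileT: "csafe inp K b s \<Longrightarrow> cval inp b s \<Longrightarrow> big inp K c s t1 s1 \<Longrightarrow>
      big inp K (While b c) s1 t2 s2 \<Longrightarrow> big inp K (While b c) s (csize b + t1 + t2) s2"

section \<open>Compilation\<close>

text \<open>The variables are the registers below \<open>n\<close>, register \<open>n\<close> holds the length of the input, and the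
registers above \<open>n\<close> are temporaries.  The arrays are interleaved behind the input: entry \<open>i\<close> of array
\<open>a < S\<close> has the address \<open>S * i + a\<close>, counted from the end of the input.  The value of the expression
ends up in register \<open>t\<close>.\<close>

fun ecomp :: "nat \<Rightarrow> nat \<Rightarrow> nat \<Rightarrow> aexp \<Rightarrow> instr list"
  where
    "ecomp n S t (N c) = [Const t c]"
  | "ecomp n S t (V x) = [Copy t x]"
  | "ecomp n S t (Arr a e) = ecomp n S t e @
      [Const (Suc t) (int S), Mult t t (Suc t), Const (Suc t) (int a), Add t t (Suc t), Add t t n, Load t t]"
  | "ecomp n S t (In e) = ecomp n S t e @ [Load t t]"
  | "ecomp n S t (Plus e1 e2) = ecomp n S t e1 @ ecomp n S (Suc t) e2 @ [Add t t (Suc t)]"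
  | "ecomp n S t (Minus e1 e2) = ecomp n S t e1 @ ecomp n S (Suc t) e2 @ [Sub t t (Suc t)]"

fun bcomp :: "nat \<Rightarrow> nat \<Rightarrow> cond \<Rightarrow> nat \<Rightarrow> instr list"
  where
    "bcomp n S (Less e1 e2) l = ecomp n S (Suc n) e1 @ ecomp n S (Suc (Suc n)) e2 @
      [Sub (Suc n) (Suc (Suc n)) (Suc n), JumpPos (Suc n) l]"
  | "bcomp n S (Equal e1 e2) l = ecomp n S (Suc n) e1 @ ecomp n S (Suc (Suc n)) e2 @
      [Sub (Suc n) (Suc (Suc n)) (Suc n), JumpZero (Suc n) l]"

text \<open>The parameter \<open>p\<close> is the address of the first instruction.  The length of the code of a condition
does not depend on its jump target, so the target \<open>0\<close> serves to compute the address of what follows.\<close>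

fun ccomp :: "nat \<Rightarrow> nat \<Rightarrow> nat \<Rightarrow> com \<Rightarrow> instr list"
  where
    "ccomp n S p Skip = []"
  | "ccomp n S p (x ::= e) = ecomp n S (Suc n) e @ [Copy x (Suc n)]"
  | "ccomp n S p (Update a i e) = ecomp n S (Suc n) i @
      [Const (Suc (Suc n)) (int S), Mult (Suc n) (Suc n) (Suc (Suc n)), Const (Suc (Suc n)) (int a),
        Add (Suc n) (Suc n) (Suc (Suc n)), Add (Suc n) (Suc n) n] @
      ecomp n S (Suc (Suc n)) e @ [Store (Suc n) (Suc (Suc n))]"
  | "ccomp n S p (c1 ;; c2) = (let is = ccomp n S p c1 in is @ ccomp n S (p + length is) c2)"
  | "ccomp n S p (If b c1 c2) =
      (let q = p + length (bcomp n S b 0); is2 = ccomp n S q c2; l = q + length is2 + 1;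
        is1 = ccomp n S l c1
       in bcomp n S b l @ is2 @ [Jump (l + length is1)] @ is1)"
  | "ccomp n S p (While b c) =
      (let l = p + length (bcomp n S b 0) + 1; is = ccomp n S l c
       in bcomp n S b l @ [Jump (l + length is + 1)] @ is @ [Jump p])"

lemma length_bcomp: "length (bcomp n S b l) = length (bcomp n S b 0)"
  by (cases b) auto

lemma length_ecomp: "length (ecomp n S t e) \<le> 6 * esize e"
proof (induction e arbitrary: t)
  case (Plus e1 e2)
  from Plus(1)[of t] Plus(2)[of "Suc t"] show ?case by simp
next
  case (Minus e1 e2)
  from Minus(1)[of t] Minus(2)[of "Suc t"] show ?case by simp
next
  case (Arr a e)
  from Arr[of t] show ?case by simp
next
  case (In e)
  from In[of t] show ?case by simp
qed simp_all

lemma esize_pos: "1 \<le> esize e"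
  by (cases e) simp_all

lemma csize_pos: "2 \<le> csize b"
proof (cases b)
  case (Less e1 e2)
  then show ?thesis using esize_pos[of e1] esize_pos[of e2] by simp
next
  case (Equal e1 e2)
  then show ?thesis using esize_pos[of e1] esize_pos[of e2] by simp
qed

lemma length_bcomp_le: "length (bcomp n S b l) \<le> 7 * csize b"
proof (cases b)
  case (Less e1 e2)
  then show ?thesis
    using csize_pos[of b] length_ecomp[of n S "Suc n" e1] length_ecomp[of n S "Suc (Suc n)" e2] by simp
next
  case (Equal e1 e2)
  then show ?thesis
    using csize_pos[of b] length_ecomp[of n S "Suc n" e1] length_ecomp[of n S "Suc (Suc n)" e2] by simp
qed

fun ewf :: "nat \<Rightarrow> nat \<Rightarrow> aexp \<Rightarrow> bool"
  where
    "ewf n S (N c) \<longleftrightarrow> True"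
  | "ewf n S (V x) \<longleftrightarrow> x < n"
  | "ewf n S (Arr a e) \<longleftrightarrow> a < S \<and> ewf n S e"
  | "ewf n S (In e) \<longleftrightarrow> ewf n S e"
  | "ewf n S (Plus e1 e2) \<longleftrightarrow> ewf n S e1 \<and> ewf n S e2"
  | "ewf n S (Minus e1 e2) \<longleftrightarrow> ewf n S e1 \<and> ewf n S e2"

fun bwf :: "nat \<Rightarrow> nat \<Rightarrow> cond \<Rightarrow> bool"
  where
    "bwf n S (Less e1 e2) \<longleftrightarrow> ewf n S e1 \<and> ewf n S e2"
  | "bwf n S (Equal e1 e2) \<longleftrightarrow> ewf n S e1 \<and> ewf n S e2"

fun cwf :: "nat \<Rightarrow> nat \<Rightarrow> com \<Rightarrow> bool"
  where
    "cwf n S Skip \<longleftrightarrow> True"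
  | "cwf n S (x ::= e) \<longleftrightarrow> x < n \<and> ewf n S e"
  | "cwf n S (Update a i e) \<longleftrightarrow> a < S \<and> ewf n S i \<and> ewf n S e"
  | "cwf n S (c1 ;; c2) \<longleftrightarrow> cwf n S c1 \<and> cwf n S c2"
  | "cwf n S (If b c1 c2) \<longleftrightarrow> bwf n S b \<and> cwf n S c1 \<and> cwf n S c2"
  | "cwf n S (While b c) \<longleftrightarrow> bwf n S b \<and> cwf n S c"

section \<open>Correctness of the compilation\<close>

definition code_at :: "program \<Rightarrow> nat \<Rightarrow> instr list \<Rightarrow> bool"
  where "code_at P i is \<longleftrightarrow> (\<exists>A B. P = A @ is @ B \<and> length A = i)"

lemma code_at_append: "code_at P i (xs @ ys) \<longleftrightarrow> code_at P i xs \<and> code_at P (i + length xs) ys"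
proof safe
  assume "code_at P i (xs @ ys)"
  then obtain A B where P: "P = A @ xs @ ys @ B" "length A = i" by (auto simp: code_at_def)
  show "code_at P i xs" using P by (auto simp: code_at_def)
  show "code_at P (i + length xs) ys"
    unfolding code_at_def by (rule exI[of _ "A @ xs"], rule exI[of _ B]) (use P in auto)
next
  assume 1: "code_at P i xs" and 2: "code_at P (i + length xs) ys"
  from 1 obtain A B where "P = A @ xs @ B" "length A = i" unfolding code_at_def by blast
  moreover from 2 obtain A' B' where "P = A' @ ys @ B'" "length A' = i + length xs"
    unfolding code_at_def by blast
  ultimately have P: "P = A @ xs @ B" "length A = i" "P = A' @ ys @ B'" "length A' = i + length xs"
    by blast+
  then have "A @ xs = A'" "B = ys @ B'"
    using append_eq_append_conv[of "A @ xs" A' B "ys @ B'"] by simp_all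
  with P have "P = A @ (xs @ ys) @ B' \<and> length A = i" by simp
  then show "code_at P i (xs @ ys)" unfolding code_at_def by blast
qed

lemma code_at_Cons: "code_at P i (x # ys) \<longleftrightarrow> code_at P i [x] \<and> code_at P (Suc i) ys"
  using code_at_append[of P i "[x]" ys] by simp

lemma code_at_nth: "code_at P i [x] \<Longrightarrow> i < length P \<and> P ! i = x"
  by (auto simp: code_at_def nth_append)

lemma run_trans: "run P c t c' \<Longrightarrow> run P c' t' c'' \<Longrightarrow> run P c (t + t') c''"
  by (induction rule: run.induct) (auto simp: add.assoc intro: run.step)

lemma run_one:
  assumes "code_at P (pc c) [x]" "exec x c = Some c'"
  shows "run P c (cost x c) c'"
  using run.step[of P c c' 0 c', OF _ _ run.refl] code_at_nth[OF assms(1)] assms(2)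
  by (simp add: halted_def)

lemma bits_mono: "\<bar>x\<bar> \<le> int v \<Longrightarrow> bits x \<le> bits (int v)"
  unfolding bits_def by (auto intro!: floorlog_mono)

lemma mult_cost_mono: "m \<le> n \<Longrightarrow> mult_cost m \<le> mult_cost n"
  unfolding mult_cost_def by (intro mult_mono floorlog_mono) auto

text \<open>Covers one instruction whose operands, and whose address if it accesses memory, are at most \<open>v\<close>.\<close>

definition word_cost :: "nat \<Rightarrow> nat"
  where "word_cost v = 2 * bits (int v) + mult_cost (bits (int v))"

lemma bits_le_word_cost: "\<bar>x\<bar> \<le> int v \<Longrightarrow> bits x \<le> word_cost v"
  using bits_mono by (fastforce simp: word_cost_def)

lemma bits2_le_word_cost: "\<bar>x\<bar> \<le> int v \<Longrightarrow> \<bar>y\<bar> \<le> int v \<Longrightarrow> bits x + bits y \<le> word_cost v"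
  using bits_mono[of x v] bits_mono[of y v] by (simp add: word_cost_def)

lemma mult_cost_le_word_cost:
  "\<bar>x\<bar> \<le> int v \<Longrightarrow> \<bar>y\<bar> \<le> int v \<Longrightarrow> mult_cost (max (bits x) (bits y)) \<le> word_cost v"
  using bits_mono[of x v] bits_mono[of y v] mult_cost_mono[of "max (bits x) (bits y)" "bits (int v)"]
  by (simp add: word_cost_def)

lemma one_le_word_cost: "1 \<le> word_cost v"
  by (simp add: word_cost_def bits_def)

text \<open>\<open>M\<close> bounds the input, and all numbers that the structured program handles; addresses are then at most
\<open>(S + 2) * M\<close>.\<close>

locale compiled =
  fixes inp :: "int list" and K n S :: nat and M :: nat
  assumes inp: "\<And>x. x \<in> set inp \<Longrightarrow> \<bar>x\<bar> \<le> int K"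
    and large: "length inp \<le> M" "S \<le> M"
begin

definition limit where "limit = (S + 2) * M"

definition w where "w = word_cost limit"

lemmas bits_le_w = bits_le_word_cost[of _ limit, folded w_def]
lemmas bits2_le_w = bits2_le_word_cost[of _ limit, folded w_def]
lemmas mult_cost_le_w = mult_cost_le_word_cost[of _ limit, folded w_def]

definition repr :: "state \<Rightarrow> config \<Rightarrow> bool"
  where "repr s c \<longleftrightarrow> (\<forall>x<n. reg c x = var s x) \<and> reg c n = int (length inp) \<and>
    (\<forall>i<length inp. mem c i = inp ! i) \<and>
    (\<forall>a<S. \<forall>i. mem c (length inp + S * i + a) = arr s a i)"

definition bounded :: "nat \<Rightarrow> state \<Rightarrow> bool"
  where "bounded m s \<longleftrightarrow> (\<forall>x. \<bar>var s x\<bar> \<le> int m) \<and> (\<forall>a i. \<bar>arr s a i\<bar> \<le> int m)"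

lemma bounded_mono: "bounded m s \<Longrightarrow> m \<le> m' \<Longrightarrow> bounded m' s"
  unfolding bounded_def by (meson of_nat_mono order_trans)

lemma aval_bound:
  assumes "safe inp K e s" "bounded m s"
  shows "\<bar>aval inp e s\<bar> \<le> int (m + K * esize e)"
  using assms
proof (induction e)
  case (In e)
  then have "\<bar>aval inp (In e) s\<bar> \<le> int K" by (auto intro!: inp nth_mem)
  moreover have "int (m + K * esize (In e)) = int m + int (K * esize e) + int K"
    by (simp add: algebra_simps)
  ultimately show ?case using of_nat_0_le_iff[of "K * esize e"] of_nat_0_le_iff[of m] by linarith
next
  case (Arr a e)
  then have "\<bar>aval inp (Arr a e) s\<bar> \<le> int m" by (simp add: bounded_def)
  moreover have "int (m + K * esize (Arr a e)) = int m + int (K * esize e) + int K"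
    by (simp add: algebra_simps)
  ultimately show ?case using of_nat_0_le_iff[of "K * esize e"] of_nat_0_le_iff[of K] by linarith
next
  case (V x)
  then have "\<bar>aval inp (V x) s\<bar> \<le> int m" by (simp add: bounded_def)
  then show ?case by (simp add: algebra_simps)
next
  case (Plus e1 e2)
  have "int (m + K * esize e1) + int K \<le> int (m + K * esize (Plus e1 e2))" by (simp add: algebra_simps)
  moreover have "\<bar>aval inp e1 s\<bar> \<le> int (m + K * esize e1)" "\<bar>aval inp e2 s\<bar> \<le> int K"
    using Plus by auto
  ultimately show ?case unfolding aval.simps by linarith
next
  case (Minus e1 e2)
  have "int (m + K * esize e1) + int K \<le> int (m + K * esize (Minus e1 e2))" by (simp add: algebra_simps)
  moreover have "\<bar>aval inp e1 s\<bar> \<le> int (m + K * esize e1)" "\<bar>aval inp e2 s\<bar> \<le> int K"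
    using Minus by auto
  ultimately show ?case unfolding aval.simps by linarith
qed simp

lemma aval_limit:
  assumes "safe inp K e s" "bounded m s" "m + K * esize e \<le> M"
  shows "\<bar>aval inp e s\<bar> \<le> int M"
proof -
  have "int (m + K * esize e) \<le> int M" using assms(3) by (simp only: of_nat_le_iff)
  then show ?thesis using aval_bound[OF assms(1,2)] by linarith
qed

lemma le_large: "\<bar>x\<bar> \<le> int M \<Longrightarrow> \<bar>x\<bar> \<le> int limit"
proof -
  assume "\<bar>x\<bar> \<le> int M"
  moreover have "int limit = int (M * S) + int M + int M" by (simp add: limit_def algebra_simps)
  ultimately show ?thesis using of_nat_0_le_iff[of "M * S"] by linarith
qed

lemma address_bound:
  assumes "0 \<le> x" "x \<le> int M" "a < S"
  shows "0 \<le> x * int S + int a + int (length inp)"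
    and "x * int S + int a + int (length inp) \<le> int limit"
    "\<bar>x * int S + int a\<bar> \<le> int limit" "\<bar>x * int S\<bar> \<le> int limit"
proof -
  have "x * int S \<le> int M * int S" using assms by (intro mult_right_mono) auto
  moreover have "0 \<le> x * int S" using assms by simp
  moreover have "int limit = int M * int S + int M + int M" by (simp add: limit_def algebra_simps)
  moreover have "int (length inp) \<le> int M" "int a \<le> int M" using assms large by simp_all
  ultimately show "0 \<le> x * int S + int a + int (length inp)"
    and "x * int S + int a + int (length inp) \<le> int limit"
    "\<bar>x * int S + int a\<bar> \<le> int limit" "\<bar>x * int S\<bar> \<le> int limit"
    by linarith+
qed

lemma run_address:
  assumes "code_at P (pc c) [Const (Suc t) (int S), Mult t t (Suc t), Const (Suc t) (int a), Add t t (Suc t), Add t t n]"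
    and "n < t" "reg c t = x" "reg c n = int (length inp)" "0 \<le> x" "x \<le> int M" "a < S"
  shows "\<exists>T c'. run P c T c' \<and> pc c' = pc c + 5 \<and> reg c' t = x * int S + int a + int (length inp) \<and>
    (\<forall>i<t. reg c' i = reg c i) \<and> mem c' = mem c \<and> T \<le> 5 * w"
proof -
  note b = address_bound[OF assms(5-7)]
  have c: "code_at P (pc c) [Const (Suc t) (int S)]" "code_at P (Suc (pc c)) [Mult t t (Suc t)]"
    "code_at P (Suc (Suc (pc c))) [Const (Suc t) (int a)]" "code_at P (Suc (Suc (Suc (pc c)))) [Add t t (Suc t)]"
    "code_at P (Suc (Suc (Suc (Suc (pc c))))) [Add t t n]"
    using assms(1) code_at_Cons by metis+
  define c1 where "c1 = set_reg (Suc t) (int S) c"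
  define c2 where "c2 = set_reg t (reg c1 t * reg c1 (Suc t)) c1"
  define c3 where "c3 = set_reg (Suc t) (int a) c2"
  define c4 where "c4 = set_reg t (reg c3 t + reg c3 (Suc t)) c3"
  define c5 where "c5 = set_reg t (reg c4 t + reg c4 n) c4"
  note d = c1_def c2_def c3_def c4_def c5_def set_reg_def
  have pcs: "pc c1 = Suc (pc c)" "pc c2 = Suc (Suc (pc c))" "pc c3 = Suc (Suc (Suc (pc c)))"
    "pc c4 = Suc (Suc (Suc (Suc (pc c))))" by (simp_all add: d)
  have r: "run P c (cost (Const (Suc t) (int S)) c) c1" "run P c1 (cost (Mult t t (Suc t)) c1) c2"
    "run P c2 (cost (Const (Suc t) (int a)) c2) c3" "run P c3 (cost (Add t t (Suc t)) c3) c4"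
    "run P c4 (cost (Add t t n) c4) c5"
    by (rule run_one; (simp only: pcs c; fail)?; simp only: exec.simps c1_def c2_def c3_def c4_def c5_def)+
  have S: "\<bar>int S\<bar> \<le> int limit" "\<bar>int a\<bar> \<le> int limit" "\<bar>int (length inp)\<bar> \<le> int limit"
    "\<bar>x\<bar> \<le> int limit"
    using assms(5-7) large by (intro le_large; simp)+
  have vals: "reg c1 t = x" "reg c1 (Suc t) = int S" "reg c3 t = x * int S" "reg c3 (Suc t) = int a"
    "reg c4 t = x * int S + int a" "reg c4 n = int (length inp)"
    using assms(2-4) by (simp_all add: d)
  have k: "cost (Const (Suc t) (int S)) c \<le> w" "cost (Mult t t (Suc t)) c1 \<le> w"
    "cost (Const (Suc t) (int a)) c2 \<le> w" "cost (Add t t (Suc t)) c3 \<le> w" "cost (Add t t n) c4 \<le> w"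
    using S b by (auto intro!: bits_le_w mult_cost_le_w simp: vals simp del: of_nat_mult)
  have "reg c5 t = x * int S + int a + int (length inp)" "pc c5 = pc c + 5" "mem c5 = mem c"
    "\<forall>i<t. reg c5 i = reg c i" using vals by (simp_all add: d)
  moreover note run_trans[OF run_trans[OF run_trans[OF run_trans[OF r(1) r(2)] r(3)] r(4)] r(5)]
  moreover have "cost (Const (Suc t) (int S)) c + cost (Mult t t (Suc t)) c1 + cost (Const (Suc t) (int a)) c2 +
      cost (Add t t (Suc t)) c3 + cost (Add t t n) c4 \<le> 5 * w" using k by linarith
  ultimately show ?thesis by blast
qed

text \<open>Common to addition and subtraction; the two runs of the operands are assumed.\<close>

lemma run_operation:
  assumes op: "(op, f) \<in> {(Add t t (Suc t), (+)), (Sub t t (Suc t), (-))}"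
    and code: "code_at P (pc c) (is1 @ is2 @ [op])"
    and run1: "code_at P (pc c) is1 \<Longrightarrow> \<exists>T c'. run P c T c' \<and> pc c' = pc c + length is1 \<and> reg c' t = x \<and>
      (\<forall>i<t. reg c' i = reg c i) \<and> mem c' = mem c \<and> T \<le> length is1 * w"
    and run2: "\<And>c1. code_at P (pc c1) is2 \<Longrightarrow> \<forall>i<t. reg c1 i = reg c i \<Longrightarrow> mem c1 = mem c \<Longrightarrow>
      \<exists>T c'. run P c1 T c' \<and> pc c' = pc c1 + length is2 \<and> reg c' (Suc t) = y \<and>
        (\<forall>i<Suc t. reg c' i = reg c1 i) \<and> mem c' = mem c1 \<and> T \<le> length is2 * w"
    and xy: "\<bar>x\<bar> \<le> int M" "\<bar>y\<bar> \<le> int M"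
  shows "\<exists>T c'. run P c T c' \<and> pc c' = pc c + length (is1 @ is2 @ [op]) \<and> reg c' t = f x y \<and>
    (\<forall>i<t. reg c' i = reg c i) \<and> mem c' = mem c \<and> T \<le> length (is1 @ is2 @ [op]) * w"
proof -
  have codes: "code_at P (pc c) is1" "code_at P (pc c + length is1) is2"
    "code_at P (pc c + length is1 + length is2) [op]"
    using code by (simp_all add: code_at_append add.assoc)
  from run1[OF codes(1)] obtain T1 c1 where 1: "run P c T1 c1" "pc c1 = pc c + length is1" "reg c1 t = x"
    "\<forall>i<t. reg c1 i = reg c i" "mem c1 = mem c" "T1 \<le> length is1 * w" by blast
  from run2[OF _ 1(4,5)] codes(2) 1(2) obtain T2 c2 where 2: "run P c1 T2 c2" "pc c2 = pc c1 + length is2"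
    "reg c2 (Suc t) = y" "\<forall>i<Suc t. reg c2 i = reg c1 i" "mem c2 = mem c1" "T2 \<le> length is2 * w" by auto
  define c3 where "c3 = set_reg t (f x y) c2"
  have k: "cost op c2 \<le> w"
    using op xy by (auto intro!: bits_le_w le_large simp: 1 2)
  have r3: "run P c2 (cost op c2) c3"
    by (rule run_one) (use op codes(3) in \<open>auto simp: 1 2 c3_def\<close>)
  have "T1 + T2 + cost op c2 \<le> length (is1 @ is2 @ [op]) * w"
    using 1(6) 2(6) k by (simp add: distrib_right del: cost.simps)
  moreover have "pc c3 = pc c + length (is1 @ is2 @ [op])" "reg c3 t = f x y"
    "\<forall>i<t. reg c3 i = reg c i" "mem c3 = mem c"
    using 1 2 by (simp_all add: c3_def set_reg_def)
  ultimately show ?thesis using run_trans[OF run_trans[OF 1(1) 2(1)] r3] by blast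
qed

lemma run_ecomp:
  assumes "code_at P (pc c) (ecomp n S t e)" "repr s c" "safe inp K e s" "bounded m s"
    "m + K * esize e \<le> M" "ewf n S e" "n < t"
  shows "\<exists>T c'. run P c T c' \<and> pc c' = pc c + length (ecomp n S t e) \<and> reg c' t = aval inp e s \<and>
    (\<forall>i<t. reg c' i = reg c i) \<and> mem c' = mem c \<and> T \<le> length (ecomp n S t e) * w"
  using assms
proof (induction e arbitrary: t c)
  case (N x)
  have "\<bar>x\<bar> \<le> int M" using aval_limit[OF N.prems(3,4,5)] by simp
  then have "cost (Const t x) c \<le> w" by (auto intro!: bits_le_w le_large)
  moreover have "run P c (cost (Const t x) c) (set_reg t x c)"
    using N.prems(1) by (intro run_one) auto
  ultimately show ?case by (intro exI[of _ "cost (Const t x) c"] exI[of _ "set_reg t x c"]) (simp add: set_reg_def)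
next
  case (V x)
  have x: "reg c x = var s x" using V.prems(2,6) by (simp add: repr_def)
  have "\<bar>var s x\<bar> \<le> int M" using aval_bound[OF V.prems(3,4)] V.prems(5) by simp
  then have "cost (Copy t x) c \<le> w" by (auto intro!: bits_le_w le_large simp: x)
  moreover have "run P c (cost (Copy t x) c) (set_reg t (reg c x) c)"
    using V.prems(1) by (intro run_one) auto
  ultimately show ?case
    by (intro exI[of _ "cost (Copy t x) c"] exI[of _ "set_reg t (reg c x) c"]) (simp add: set_reg_def x)
next
  case (Arr a e)
  let ?addr = "[Const (Suc t) (int S), Mult t t (Suc t), Const (Suc t) (int a), Add t t (Suc t), Add t t n]"
  have code: "code_at P (pc c) (ecomp n S t e)" "code_at P (pc c + length (ecomp n S t e)) ?addr"
    "code_at P (pc c + length (ecomp n S t e) + 5) [Load t t]"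
    using Arr.prems(1) code_at_append[of P "pc c + length (ecomp n S t e)" ?addr "[Load t t]"]
    by (simp_all add: code_at_append eval_nat_numeral)
  have sf: "safe inp K e s" "m + K * esize e \<le> M" "ewf n S e" "0 \<le> aval inp e s" "a < S"
    using Arr.prems by auto
  from Arr.IH[OF code(1) Arr.prems(2) sf(1) Arr.prems(4) sf(2,3) Arr.prems(7)]
  obtain T1 c1 where 1: "run P c T1 c1" "pc c1 = pc c + length (ecomp n S t e)" "reg c1 t = aval inp e s"
    "\<forall>i<t. reg c1 i = reg c i" "mem c1 = mem c" "T1 \<le> length (ecomp n S t e) * w" by auto
  have le: "aval inp e s \<le> int M" using aval_limit[OF sf(1) Arr.prems(4) sf(2)] by simp
  have "reg c1 n = int (length inp)" using Arr.prems(2,7) 1(4) by (simp add: repr_def)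
  from run_address[OF _ Arr.prems(7) 1(3) this sf(4) le sf(5), of P] code(2) 1(2)
  obtain T2 c2 where 2: "run P c1 T2 c2" "pc c2 = pc c1 + 5"
    "reg c2 t = aval inp e s * int S + int a + int (length inp)"
    "\<forall>i<t. reg c2 i = reg c1 i" "mem c2 = mem c1" "T2 \<le> 5 * w" by auto
  have "nat (aval inp e s * int S + int a + int (length inp)) = length inp + S * nat (aval inp e s) + a"
    using sf(4) by (simp add: nat_add_distrib nat_mult_distrib)
  then have cell: "mem c2 (nat (reg c2 t)) = arr s a (nat (aval inp e s))"
    using Arr.prems(2) sf(5) by (simp add: repr_def 2 1)
  define c3 where "c3 = set_reg t (arr s a (nat (aval inp e s))) c2"
  note b = address_bound[OF sf(4) le sf(5)]
  have "\<bar>arr s a (nat (aval inp e s))\<bar> \<le> int M"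
    using Arr.prems(4,5) by (simp add: bounded_def) (meson add_leD1 of_nat_mono order_trans)
  then have "bits (reg c2 t) + bits (arr s a (nat (aval inp e s))) \<le> w"
    by (intro bits2_le_w) (use b in \<open>simp_all only: 2(3) le_large abs_of_nonneg\<close>)
  then have "cost (Load t t) c2 \<le> w" by (simp add: cell)
  moreover have "run P c2 (cost (Load t t) c2) c3"
    using code(3) b cell by (intro run_one) (simp_all add: 1 2 c3_def)
  ultimately show ?case using run_trans[OF run_trans[OF 1(1) 2(1)]] 1 2
    by (intro exI[of _ "T1 + T2 + cost (Load t t) c2"] exI[of _ c3]) (simp add: c3_def set_reg_def)
next
  case (In e)
  have code: "code_at P (pc c) (ecomp n S t e)" "code_at P (pc c + length (ecomp n S t e)) [Load t t]"
    using In.prems(1) by (simp_all add: code_at_append)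
  have sf: "safe inp K e s" "m + K * esize e \<le> M" "ewf n S e" "0 \<le> aval inp e s" "aval inp e s < int (length inp)"
    using In.prems by auto
  from In.IH[OF code(1) In.prems(2) sf(1) In.prems(4) sf(2,3) In.prems(7)]
  obtain T1 c1 where 1: "run P c T1 c1" "pc c1 = pc c + length (ecomp n S t e)" "reg c1 t = aval inp e s"
    "\<forall>i<t. reg c1 i = reg c i" "mem c1 = mem c" "T1 \<le> length (ecomp n S t e) * w" by auto
  have cell: "mem c1 (nat (reg c1 t)) = inp ! nat (aval inp e s)"
    using In.prems(2) sf(4,5) by (simp add: repr_def 1)
  define c3 where "c3 = set_reg t (inp ! nat (aval inp e s)) c1"
  have "\<bar>aval inp (In e) s\<bar> \<le> int M"
    using aval_limit[OF In.prems(3,4,5)] .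
  moreover have "\<bar>aval inp e s\<bar> \<le> int M" using sf(4,5) large by simp
  ultimately have "cost (Load t t) c1 \<le> w"
    by (auto intro!: bits2_le_w le_large simp: cell) (simp_all add: 1)
  moreover have "run P c1 (cost (Load t t) c1) c3"
    using code(2) sf(4) cell by (intro run_one) (simp_all add: 1 c3_def)
  ultimately show ?case using run_trans[OF 1(1)] 1
    by (intro exI[of _ "T1 + cost (Load t t) c1"] exI[of _ c3]) (simp add: c3_def set_reg_def)
next
  case (Plus e1 e2)
  have sf: "safe inp K e1 s" "m + K * esize e1 \<le> M" "ewf n S e1" "safe inp K e2 s" "m + K * esize e2 \<le> M" "ewf n S e2"
    using Plus.prems by (auto simp: algebra_simps)
  note v = aval_limit[OF sf(1) Plus.prems(4) sf(2)] aval_limit[OF sf(4) Plus.prems(4) sf(5)]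
  have r: "repr s c1" if "\<forall>i<t. reg c1 i = reg c i" "mem c1 = mem c" for c1
    using Plus.prems(2,7) that by (simp add: repr_def)
  have t: "n < Suc t" using Plus.prems(7) by simp
  show ?case
    unfolding ecomp.simps aval.simps
    by (rule run_operation[OF _ Plus.prems(1)[unfolded ecomp.simps]
          Plus.IH(1)[OF _ Plus.prems(2) sf(1) Plus.prems(4) sf(2,3) Plus.prems(7)]
          Plus.IH(2)[OF _ r sf(4) Plus.prems(4) sf(5,6) t] v]) simp_all
next
  case (Minus e1 e2)
  have sf: "safe inp K e1 s" "m + K * esize e1 \<le> M" "ewf n S e1" "safe inp K e2 s" "m + K * esize e2 \<le> M" "ewf n S e2"
    using Minus.prems by (auto simp: algebra_simps)
  note v = aval_limit[OF sf(1) Minus.prems(4) sf(2)] aval_limit[OF sf(4) Minus.prems(4) sf(5)]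
  have r: "repr s c1" if "\<forall>i<t. reg c1 i = reg c i" "mem c1 = mem c" for c1
    using Minus.prems(2,7) that by (simp add: repr_def)
  have t: "n < Suc t" using Minus.prems(7) by simp
  show ?case
    unfolding ecomp.simps aval.simps
    by (rule run_operation[OF _ Minus.prems(1)[unfolded ecomp.simps]
          Minus.IH(1)[OF _ Minus.prems(2) sf(1) Minus.prems(4) sf(2,3) Minus.prems(7)]
          Minus.IH(2)[OF _ r sf(4) Minus.prems(4) sf(5,6) t] v]) simp_all
qed

lemma repr_temporaries:
  "repr s c \<Longrightarrow> \<forall>i<Suc n. reg c' i = reg c i \<Longrightarrow> mem c' = mem c \<Longrightarrow> repr s c'"
  by (simp add: repr_def)

lemma run_two_ecomp:
  assumes "code_at P (pc c) (ecomp n S (Suc n) e1 @ ecomp n S (Suc (Suc n)) e2)" "repr s c"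
    "safe inp K e1 s" "safe inp K e2 s" "bounded m s"
    "m + K * (esize e1 + esize e2) \<le> M" "ewf n S e1" "ewf n S e2"
  shows "\<exists>T c'. run P c T c' \<and> pc c' = pc c + length (ecomp n S (Suc n) e1 @ ecomp n S (Suc (Suc n)) e2) \<and>
    reg c' (Suc n) = aval inp e1 s \<and> reg c' (Suc (Suc n)) = aval inp e2 s \<and> repr s c' \<and>
    T \<le> length (ecomp n S (Suc n) e1 @ ecomp n S (Suc (Suc n)) e2) * w"
proof -
  let ?l1 = "length (ecomp n S (Suc n) e1)" and ?l2 = "length (ecomp n S (Suc (Suc n)) e2)"
  have code: "code_at P (pc c) (ecomp n S (Suc n) e1)" "code_at P (pc c + ?l1) (ecomp n S (Suc (Suc n)) e2)"
    using assms(1) by (simp_all add: code_at_append)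
  have sz: "m + K * esize e1 \<le> M" "m + K * esize e2 \<le> M" using assms(6) by (simp_all add: algebra_simps)
  from run_ecomp[OF code(1) assms(2,3,5) sz(1) assms(7)]
  obtain T1 c1 where 1: "run P c T1 c1" "pc c1 = pc c + ?l1" "reg c1 (Suc n) = aval inp e1 s"
    "\<forall>i<Suc n. reg c1 i = reg c i" "mem c1 = mem c" "T1 \<le> ?l1 * w" by auto
  have r1: "repr s c1" by (rule repr_temporaries[OF assms(2) 1(4,5)])
  from run_ecomp[OF _ r1 assms(4,5) sz(2) assms(8), of P "Suc (Suc n)"] code(2) 1(2)
  obtain T2 c2 where 2: "run P c1 T2 c2" "pc c2 = pc c1 + ?l2" "reg c2 (Suc (Suc n)) = aval inp e2 s"
    "\<forall>i<Suc (Suc n). reg c2 i = reg c1 i" "mem c2 = mem c1" "T2 \<le> ?l2 * w" by auto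
  have "repr s c2" using repr_temporaries[OF r1 _ 2(5)] 2(4) by simp
  with run_trans[OF 1(1) 2(1)] 1 2 show ?thesis
    by (intro exI[of _ "T1 + T2"] exI[of _ c2]) (simp add: algebra_simps)
qed

lemma run_bcomp:
  assumes "code_at P (pc c) (bcomp n S b l)" "repr s c" "csafe inp K b s" "bounded m s"
    "m + K * csize b \<le> M" "bwf n S b"
  shows "\<exists>T c'. run P c T c' \<and> pc c' = (if cval inp b s then l else pc c + length (bcomp n S b 0)) \<and>
    repr s c' \<and> T \<le> 7 * csize b * w"
proof -
  obtain e1 e2 jmp where jmp: "bcomp n S b l = (ecomp n S (Suc n) e1 @ ecomp n S (Suc (Suc n)) e2) @
      [Sub (Suc n) (Suc (Suc n)) (Suc n), jmp]" "csize b = esize e1 + esize e2"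
    "csafe inp K b s = (safe inp K e1 s \<and> safe inp K e2 s)" "bwf n S b = (ewf n S e1 \<and> ewf n S e2)"
    "\<And>c. exec jmp c = Some (c\<lparr>pc := if (if jmp = JumpZero (Suc n) l then reg c (Suc n) = 0 else reg c (Suc n) > 0) then l else Suc (pc c)\<rparr>)"
    "\<And>c. cost jmp c = bits (reg c (Suc n))"
    "cval inp b s = (if jmp = JumpZero (Suc n) l then aval inp e1 s = aval inp e2 s else aval inp e1 s < aval inp e2 s)"
  proof (cases b)
    case (Less e1 e2)
    then show ?thesis by (intro that[of e1 e2 "JumpPos (Suc n) l"]) auto
  next
    case (Equal e1 e2)
    then show ?thesis by (intro that[of e1 e2 "JumpZero (Suc n) l"]) auto
  qed
  let ?es = "ecomp n S (Suc n) e1 @ ecomp n S (Suc (Suc n)) e2"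
  have len: "length (bcomp n S b 0) = length ?es + 2"
    using length_bcomp[of n S b l] unfolding jmp(1) by simp
  have code: "code_at P (pc c) ?es" "code_at P (pc c + length ?es) [Sub (Suc n) (Suc (Suc n)) (Suc n)]"
    "code_at P (Suc (pc c + length ?es)) [jmp]"
    using assms(1) unfolding jmp(1) code_at_append[of P "pc c" ?es] code_at_Cons[of P "pc c + length ?es" _ "[jmp]"]
    by blast+
  have sf: "safe inp K e1 s" "safe inp K e2 s" "ewf n S e1" "ewf n S e2" "m + K * (esize e1 + esize e2) \<le> M"
    using assms jmp(2-4) by auto
  from run_two_ecomp[OF code(1) assms(2) sf(1,2) assms(4) sf(5,3,4)]
  obtain T1 c1 where 1: "run P c T1 c1" "pc c1 = pc c + length ?es" "reg c1 (Suc n) = aval inp e1 s"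
    "reg c1 (Suc (Suc n)) = aval inp e2 s" "repr s c1" "T1 \<le> length ?es * w" by auto
  have "m + K * esize e1 \<le> M" "m + K * esize e2 \<le> M" using sf(5) by (simp_all add: algebra_simps)
  then have v: "\<bar>aval inp e1 s\<bar> \<le> int M" "\<bar>aval inp e2 s\<bar> \<le> int M"
    using aval_limit sf(1,2) assms(4) by blast+
  moreover have "int limit = int M * int S + int M + int M" "0 \<le> int M * int S"
    by (simp_all add: limit_def algebra_simps)
  ultimately have d: "\<bar>aval inp e2 s - aval inp e1 s\<bar> \<le> int limit" by linarith
  define c2 where "c2 = set_reg (Suc n) (aval inp e2 s - aval inp e1 s) c1"
  have r2: "run P c1 (cost (Sub (Suc n) (Suc (Suc n)) (Suc n)) c1) c2"
    by (rule run_one) (use code(2) in \<open>simp_all add: 1 c2_def\<close>)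
  have k2: "cost (Sub (Suc n) (Suc (Suc n)) (Suc n)) c1 \<le> w"
    using v by (auto intro!: bits_le_w le_large simp: 1)
  define c3 where "c3 = c2\<lparr>pc := if cval inp b s then l else Suc (pc c2)\<rparr>"
  have r3: "run P c2 (cost jmp c2) c3"
    by (rule run_one) (use code(3) in \<open>auto simp: 1 c2_def c3_def set_reg_def jmp(5,7)\<close>)
  have k3: "cost jmp c2 \<le> w"
    using d by (auto intro!: bits_le_w simp: jmp(6) c2_def set_reg_def)
  have "repr s c3" using 1(5) by (simp add: repr_def c3_def c2_def set_reg_def)
  moreover have "pc c3 = (if cval inp b s then l else pc c + length (bcomp n S b 0))"
    unfolding len by (simp add: c3_def c2_def set_reg_def 1)
  moreover have "T1 + cost (Sub (Suc n) (Suc (Suc n)) (Suc n)) c1 + cost jmp c2 \<le> 7 * csize b * w"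
  proof -
    have "T1 + cost (Sub (Suc n) (Suc (Suc n)) (Suc n)) c1 + cost jmp c2 \<le> length (bcomp n S b 0) * w"
      unfolding len using 1(6) k2 k3 by (simp only: distrib_right)
    also have "\<dots> \<le> 7 * csize b * w" by (intro mult_right_mono length_bcomp_le) simp
    finally show ?thesis .
  qed
  ultimately show ?thesis using run_trans[OF run_trans[OF 1(1) r2] r3] by blast
qed

lemma bounded_set_var: "bounded m s \<Longrightarrow> \<bar>v\<bar> \<le> int m \<Longrightarrow> bounded m (set_var x v s)"
  by (simp add: bounded_def set_var_def)

lemma bounded_set_arr: "bounded m s \<Longrightarrow> \<bar>v\<bar> \<le> int m \<Longrightarrow> bounded m (set_arr a i v s)"
  by (simp add: bounded_def set_arr_def)

lemma repr_set_arr: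
  assumes "repr s c" "a < S"
  shows "repr (set_arr a i v s) (c\<lparr>pc := p, mem := (mem c)(length inp + S * i + a := v)\<rparr>)"
proof -
  have "S * i' + a' = S * i + a \<longleftrightarrow> i' = i \<and> a' = a" if "a' < S" for i' a'
  proof
    assume eq: "S * i' + a' = S * i + a"
    have "i' = (S * i' + a') div S" using that by simp
    also have "\<dots> = i" unfolding eq using assms(2) by simp
    finally show "i' = i \<and> a' = a" using eq by simp
  qed simp
  then show ?thesis using assms by (auto simp: repr_def set_arr_def add.assoc)
qed

lemma one_le_w: "1 \<le> w"
  unfolding w_def by (rule one_le_word_cost)

text \<open>One unit of time of the structured program is worth at most 14 instructions: expressions compile to
at most 6 instructions per node, array accesses and jumps account for the rest.\<close>

theorem run_ccomp:
  assumes "big inp K com s t s'" "code_at P (pc c) (ccomp n S (pc c) com)" "repr s c" "bounded m s"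
    "m + K * t \<le> M" "cwf n S com"
  shows "\<exists>T c'. run P c T c' \<and> pc c' = pc c + length (ccomp n S (pc c) com) \<and> repr s' c' \<and>
    bounded (m + K * t) s' \<and> T \<le> 14 * t * w"
  using assms
proof (induction arbitrary: c m rule: big.induct)
  case (Skip s)
  then show ?case by (intro exI[of _ 0] exI[of _ c]) (simp add: run.refl)
next
  case (Assign e s x)
  let ?l = "length (ecomp n S (Suc n) e)"
  have code: "code_at P (pc c) (ecomp n S (Suc n) e)" "code_at P (pc c + ?l) [Copy x (Suc n)]"
    using Assign.prems(1) by (simp_all add: code_at_append)
  from run_ecomp[OF code(1) Assign.prems(2) Assign.hyps Assign.prems(3,4)] Assign.prems(5)
  obtain T1 c1 where 1: "run P c T1 c1" "pc c1 = pc c + ?l" "reg c1 (Suc n) = aval inp e s"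
    "\<forall>i<Suc n. reg c1 i = reg c i" "mem c1 = mem c" "T1 \<le> ?l * w" by auto
  have r1: "repr s c1" by (rule repr_temporaries[OF Assign.prems(2) 1(4,5)])
  define c2 where "c2 = set_reg x (aval inp e s) c1"
  have r2: "run P c1 (cost (Copy x (Suc n)) c1) c2"
    by (rule run_one) (use code(2) in \<open>simp_all add: 1 c2_def\<close>)
  have k2: "cost (Copy x (Suc n)) c1 \<le> w"
    using aval_limit[OF Assign.hyps Assign.prems(3,4)] by (auto intro!: bits_le_w le_large simp: 1)
  have "repr (set_var x (aval inp e s) s) c2"
    using r1 Assign.prems(5) by (simp add: repr_def c2_def set_reg_def set_var_def)
  moreover have "bounded (m + K * esize e) (set_var x (aval inp e s) s)"
    using bounded_mono[OF Assign.prems(3)] aval_bound[OF Assign.hyps Assign.prems(3)]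
    by (intro bounded_set_var) auto
  moreover have "T1 + cost (Copy x (Suc n)) c1 \<le> 14 * esize e * w"
  proof -
    have "T1 + cost (Copy x (Suc n)) c1 \<le> (?l + 1) * w" using 1(6) k2 by simp
    also have "\<dots> \<le> 14 * esize e * w"
      using length_ecomp[of n S "Suc n" e] esize_pos[of e] by (intro mult_right_mono) linarith+
    finally show ?thesis .
  qed
  moreover have "pc c2 = pc c + length (ccomp n S (pc c) (x ::= e))"
    by (simp add: c2_def set_reg_def 1)
  ultimately show ?case using run_trans[OF 1(1) r2] by blast
next
  case (Update i s e a)
  let ?l1 = "length (ecomp n S (Suc n) i)" and ?l2 = "length (ecomp n S (Suc (Suc n)) e)"
  let ?addr = "[Const (Suc (Suc n)) (int S), Mult (Suc n) (Suc n) (Suc (Suc n)), Const (Suc (Suc n)) (int a),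
        Add (Suc n) (Suc n) (Suc (Suc n)), Add (Suc n) (Suc n) n]"
  let ?store = "[Store (Suc n) (Suc (Suc n))]"
  have "code_at P (pc c) (ecomp n S (Suc n) i @ ?addr @ ecomp n S (Suc (Suc n)) e @ ?store)"
    using Update.prems(1) by (simp only: ccomp.simps append_Cons append_Nil)
  then have code: "code_at P (pc c) (ecomp n S (Suc n) i)" "code_at P (pc c + ?l1) ?addr"
    "code_at P (pc c + ?l1 + 5) (ecomp n S (Suc (Suc n)) e)" "code_at P (pc c + ?l1 + 5 + ?l2) ?store"
    unfolding code_at_append by (simp_all add: eval_nat_numeral)
  have sz: "m + K * esize i \<le> M" "m + K * esize e \<le> M" and wf: "a < S" "ewf n S i" "ewf n S e"
    using Update.prems(4,5) by (simp_all add: algebra_simps)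
  from run_ecomp[OF code(1) Update.prems(2) Update.hyps(1) Update.prems(3) sz(1) wf(2)]
  obtain T1 c1 where 1: "run P c T1 c1" "pc c1 = pc c + ?l1" "reg c1 (Suc n) = aval inp i s"
    "\<forall>j<Suc n. reg c1 j = reg c j" "mem c1 = mem c" "T1 \<le> ?l1 * w" by auto
  have r1: "repr s c1" by (rule repr_temporaries[OF Update.prems(2) 1(4,5)])
  have vi: "aval inp i s \<le> int M" using aval_limit[OF Update.hyps(1) Update.prems(3) sz(1)] by simp
  have "reg c1 n = int (length inp)" using r1 by (simp add: repr_def)
  from run_address[OF _ _ 1(3) this Update.hyps(2) vi wf(1), of P] code(2) 1(2)
  obtain T2 c2 where 2: "run P c1 T2 c2" "pc c2 = pc c1 + 5"
    "reg c2 (Suc n) = aval inp i s * int S + int a + int (length inp)"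
    "\<forall>j<Suc n. reg c2 j = reg c1 j" "mem c2 = mem c1" "T2 \<le> 5 * w" by auto
  have r2: "repr s c2" by (rule repr_temporaries[OF r1 2(4,5)])
  from run_ecomp[OF _ r2 Update.hyps(3) Update.prems(3) sz(2) wf(3), of P "Suc (Suc n)"] code(3) 1(2) 2(2)
  obtain T3 c3 where 3: "run P c2 T3 c3" "pc c3 = pc c2 + ?l2" "reg c3 (Suc (Suc n)) = aval inp e s"
    "\<forall>j<Suc (Suc n). reg c3 j = reg c2 j" "mem c3 = mem c2" "T3 \<le> ?l2 * w" by auto
  have r3: "repr s c3" using repr_temporaries[OF r2 _ 3(5)] 3(4) by simp
  note b = address_bound[OF Update.hyps(2) vi wf(1)]
  have addr: "reg c3 (Suc n) = aval inp i s * int S + int a + int (length inp)"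
    using 3(4) 2(3) by simp
  have cell: "nat (reg c3 (Suc n)) = length inp + S * nat (aval inp i s) + a"
    unfolding addr using Update.hyps(2) by (simp add: nat_add_distrib nat_mult_distrib)
  define c4 where "c4 = c3\<lparr>pc := Suc (pc c3), mem := (mem c3)(length inp + S * nat (aval inp i s) + a := aval inp e s)\<rparr>"
  have run4: "run P c3 (cost (Store (Suc n) (Suc (Suc n))) c3) c4"
    by (rule run_one) (use code(4) b addr in \<open>simp_all add: 1(2) 2(2) 3(2,3) cell[unfolded addr] c4_def\<close>)
  have k4: "cost (Store (Suc n) (Suc (Suc n))) c3 \<le> w"
  proof -
    have "bits (reg c3 (Suc n)) + bits (reg c3 (Suc (Suc n))) \<le> w"
      by (rule bits2_le_w) (use b aval_limit[OF Update.hyps(3) Update.prems(3) sz(2)] in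
          \<open>simp_all only: addr 3(3) le_large abs_of_nonneg\<close>)
    then show ?thesis by simp
  qed
  have "repr (set_arr a (nat (aval inp i s)) (aval inp e s) s) c4"
    unfolding c4_def by (rule repr_set_arr[OF r3 wf(1)])
  moreover have "bounded (m + K * (esize i + esize e)) (set_arr a (nat (aval inp i s)) (aval inp e s) s)"
  proof (rule bounded_set_arr)
    show "bounded (m + K * (esize i + esize e)) s" by (rule bounded_mono[OF Update.prems(3)]) simp
    have "int (m + K * esize e) \<le> int (m + K * (esize i + esize e))" unfolding of_nat_le_iff by simp
    then show "\<bar>aval inp e s\<bar> \<le> int (m + K * (esize i + esize e))"
      using aval_bound[OF Update.hyps(3) Update.prems(3)] by linarith
  qed
  moreover have "T1 + T2 + T3 + cost (Store (Suc n) (Suc (Suc n))) c3 \<le> 14 * (esize i + esize e) * w"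
  proof -
    have "T1 + T2 + T3 + cost (Store (Suc n) (Suc (Suc n))) c3 \<le> (?l1 + 5 + ?l2 + 1) * w"
      using 1(6) 2(6) 3(6) k4 by (simp add: distrib_right)
    also have "\<dots> \<le> 14 * (esize i + esize e) * w"
      using length_ecomp[of n S "Suc n" i] esize_pos[of e] length_ecomp[of n S "Suc (Suc n)" e] esize_pos[of i]
      by (intro mult_right_mono) simp_all
    finally show ?thesis .
  qed
  moreover have "pc c4 = pc c + length (ccomp n S (pc c) (Update a i e))"
    by (simp add: c4_def 1(2) 2(2) 3(2))
  ultimately show ?case using run_trans[OF run_trans[OF run_trans[OF 1(1) 2(1)] 3(1)] run4] by blast
next
  case (Seq com1 s t1 s1 com2 t2 s2)
  let ?is1 = "ccomp n S (pc c) com1"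
  have code: "code_at P (pc c) ?is1" "code_at P (pc c + length ?is1) (ccomp n S (pc c + length ?is1) com2)"
    using Seq.prems(1) by (simp_all add: Let_def code_at_append)
  have sz: "m + K * t1 \<le> M" "(m + K * t1) + K * t2 \<le> M" using Seq.prems(4) by (simp_all add: algebra_simps)
  from Seq.IH(1)[OF code(1) Seq.prems(2,3) sz(1)] Seq.prems(5)
  obtain T1 c1 where 1: "run P c T1 c1" "pc c1 = pc c + length ?is1" "repr s1 c1" "bounded (m + K * t1) s1"
    "T1 \<le> 14 * t1 * w" by auto
  from Seq.IH(2)[OF _ 1(3,4) sz(2)] code(2) Seq.prems(5) 1(2)
  obtain T2 c2 where 2: "run P c1 T2 c2" "pc c2 = pc c1 + length (ccomp n S (pc c1) com2)" "repr s2 c2"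
    "bounded (m + K * t1 + K * t2) s2" "T2 \<le> 14 * t2 * w" by auto
  then show ?case using run_trans[OF 1(1) 2(1)] 1
    by (intro exI[of _ "T1 + T2"] exI[of _ c2]) (simp add: Let_def algebra_simps)
next
  case (If b s com1 com2 t s')
  define q where "q = pc c + length (bcomp n S b 0)"
  define is2 where "is2 = ccomp n S q com2"
  define l where "l = q + length is2 + 1"
  define is1 where "is1 = ccomp n S l com1"
  have cc: "ccomp n S (pc c) (If b com1 com2) = bcomp n S b l @ is2 @ [Jump (l + length is1)] @ is1"
    by (simp add: Let_def q_def is2_def l_def is1_def)
  have "code_at P (pc c) (bcomp n S b l @ is2 @ [Jump (l + length is1)] @ is1)"
    using If.prems(1) unfolding cc .
  then have code: "code_at P (pc c) (bcomp n S b l)" "code_at P q is2"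
    "code_at P (q + length is2) [Jump (l + length is1)]" "code_at P l is1"
    unfolding code_at_append length_bcomp[of n S b l] by (simp_all add: q_def l_def)
  have len: "pc c + length (ccomp n S (pc c) (If b com1 com2)) = l + length is1"
    unfolding cc length_append length_bcomp[of n S b l] by (simp add: q_def l_def)
  have sz: "m + K * csize b \<le> M" "m + K * t \<le> M" using If.prems(4) by (simp_all add: algebra_simps)
  from run_bcomp[OF code(1) If.prems(2) If.hyps(1) If.prems(3) sz(1)] If.prems(5)
  obtain T1 c1 where 1: "run P c T1 c1" "pc c1 = (if cval inp b s then l else q)" "repr s c1"
    "T1 \<le> 7 * csize b * w" unfolding q_def by auto
  have bd: "bounded (m + K * (csize b + t)) s'" if "bounded (m + K * t) s'"
    by (rule bounded_mono[OF that]) simp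
  show ?case
  proof (cases "cval inp b s")
    case True
    from If.IH[OF _ 1(3) If.prems(3) sz(2)] True If.prems(5) 1(2) code(4)
    obtain T2 c2 where 2: "run P c1 T2 c2" "pc c2 = l + length is1" "repr s' c2"
      "bounded (m + K * t) s'" "T2 \<le> 14 * t * w" by (auto simp: is1_def)
    have "T1 + T2 \<le> 14 * (csize b + t) * w" using 1(4) 2(5) by (simp add: algebra_simps)
    then show ?thesis using run_trans[OF 1(1) 2(1)] 2 bd unfolding len by blast
  next
    case False
    from If.IH[OF _ 1(3) If.prems(3) sz(2)] False If.prems(5) 1(2) code(2)
    obtain T2 c2 where 2: "run P c1 T2 c2" "pc c2 = q + length is2" "repr s' c2"
      "bounded (m + K * t) s'" "T2 \<le> 14 * t * w" by (auto simp: is2_def)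
    define c3 where "c3 = c2\<lparr>pc := l + length is1\<rparr>"
    have 3: "run P c2 (cost (Jump (l + length is1)) c2) c3"
      by (rule run_one) (use code(3) in \<open>simp_all add: 2 c3_def\<close>)
    have "repr s' c3" "pc c3 = l + length is1" using 2(3) by (simp_all add: repr_def c3_def)
    moreover have "T1 + T2 + cost (Jump (l + length is1)) c2 \<le> 14 * (csize b + t) * w"
    proof -
      have "2 * w \<le> csize b * w" using csize_pos by (rule mult_right_mono) simp
      then show ?thesis
        using 1(4) 2(5) one_le_w unfolding distrib_left distrib_right cost.simps by linarith
    qed
    ultimately show ?thesis using run_trans[OF run_trans[OF 1(1) 2(1)] 3] 2(4) bd unfolding len by blast
  qed
next
  case (WhileF b s com)
  define l where "l = pc c + length (bcomp n S b 0) + 1"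
  define body where "body = ccomp n S l com"
  have cc: "ccomp n S (pc c) (While b com) = bcomp n S b l @ [Jump (l + length body + 1)] @ body @ [Jump (pc c)]"
    by (simp add: Let_def l_def body_def)
  have "code_at P (pc c) (bcomp n S b l @ [Jump (l + length body + 1)] @ body @ [Jump (pc c)])"
    using WhileF.prems(1) unfolding cc .
  then have code: "code_at P (pc c) (bcomp n S b l)"
    "code_at P (pc c + length (bcomp n S b 0)) [Jump (l + length body + 1)]"
    unfolding code_at_append length_bcomp[of n S b l] by (simp_all add: l_def)
  have len: "pc c + length (ccomp n S (pc c) (While b com)) = l + length body + 1"
    unfolding cc length_append length_bcomp[of n S b l] by (simp add: l_def)
  from run_bcomp[OF code(1) WhileF.prems(2) WhileF.hyps(1) WhileF.prems(3,4)] WhileF.prems(5) WhileF.hyps(2)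
  obtain T1 c1 where 1: "run P c T1 c1" "pc c1 = pc c + length (bcomp n S b 0)" "repr s c1"
    "T1 \<le> 7 * csize b * w" by auto
  define c3 where "c3 = c1\<lparr>pc := l + length body + 1\<rparr>"
  have 3: "run P c1 (cost (Jump (l + length body + 1)) c1) c3"
    by (rule run_one) (use code(2) in \<open>simp_all add: 1 c3_def\<close>)
  have "repr s c3" "pc c3 = l + length body + 1" using 1(3) by (simp_all add: repr_def c3_def)
  moreover have "T1 + cost (Jump (l + length body + 1)) c1 \<le> 14 * csize b * w"
  proof -
    have "2 * w \<le> csize b * w" using csize_pos by (rule mult_right_mono) simp
    then show ?thesis using 1(4) one_le_w unfolding cost.simps by linarith
  qed
  moreover have "bounded (m + K * csize b) s" by (rule bounded_mono[OF WhileF.prems(3)]) simp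
  ultimately show ?case using run_trans[OF 1(1) 3] unfolding len by blast
next
  case (WhileT b s com t1 s1 t2 s2)
  define l where "l = pc c + length (bcomp n S b 0) + 1"
  define body where "body = ccomp n S l com"
  have cc: "ccomp n S (pc c) (While b com) = bcomp n S b l @ [Jump (l + length body + 1)] @ body @ [Jump (pc c)]"
    by (simp add: Let_def l_def body_def)
  have "code_at P (pc c) (bcomp n S b l @ [Jump (l + length body + 1)] @ body @ [Jump (pc c)])"
    using WhileT.prems(1) unfolding cc .
  then have code: "code_at P (pc c) (bcomp n S b l)" "code_at P l body" "code_at P (l + length body) [Jump (pc c)]"
    unfolding code_at_append length_bcomp[of n S b l] by (simp_all add: l_def)
  have sz: "m + K * csize b \<le> M" "m + K * t1 \<le> M" "(m + K * t1) + K * t2 \<le> M"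
    using WhileT.prems(4) by (simp_all add: algebra_simps)
  from run_bcomp[OF code(1) WhileT.prems(2) WhileT.hyps(1) WhileT.prems(3) sz(1)] WhileT.prems(5) WhileT.hyps(2)
  obtain T1 c1 where 1: "run P c T1 c1" "pc c1 = l" "repr s c1" "T1 \<le> 7 * csize b * w" by auto
  from WhileT.IH(1)[OF _ 1(3) WhileT.prems(3) sz(2)] WhileT.prems(5) 1(2) code(2)
  obtain T2 c2 where 2: "run P c1 T2 c2" "pc c2 = l + length body" "repr s1 c2"
    "bounded (m + K * t1) s1" "T2 \<le> 14 * t1 * w" by (auto simp: body_def)
  define c3 where "c3 = c2\<lparr>pc := pc c\<rparr>"
  have 3: "run P c2 (cost (Jump (pc c)) c2) c3"
    by (rule run_one) (use code(3) in \<open>simp_all add: 2 c3_def\<close>)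
  have r3: "repr s1 c3" and pc3: "pc c3 = pc c" using 2(3) by (simp_all add: repr_def c3_def)
  from WhileT.IH(2)[of c3, OF _ r3 2(4) sz(3) WhileT.prems(5)] WhileT.prems(1)
  obtain T4 c4 where 4: "run P c3 T4 c4" "pc c4 = pc c + length (ccomp n S (pc c) (While b com))" "repr s2 c4"
    "bounded (m + K * t1 + K * t2) s2" "T4 \<le> 14 * t2 * w" unfolding pc3 by blast
  have "bounded (m + K * (csize b + t1 + t2)) s2"
    by (rule bounded_mono[OF 4(4)]) (simp add: algebra_simps)
  moreover have "T1 + T2 + cost (Jump (pc c)) c2 + T4 \<le> 14 * (csize b + t1 + t2) * w"
  proof -
    have "2 * w \<le> csize b * w" using csize_pos by (rule mult_right_mono) simp
    then show ?thesis
      using 1(4) 2(5) 4(5) one_le_w unfolding distrib_left distrib_right cost.simps by linarith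
  qed
  ultimately show ?case using run_trans[OF run_trans[OF run_trans[OF 1(1) 2(1)] 3] 4(1)] 4(2,3) by blast
qed

end

definition initial_state :: "int list \<Rightarrow> state"
  where "initial_state inp = \<lparr>var = (\<lambda>_. 0)(0 := int (length inp)), arr = (\<lambda>_ _. 0)\<rparr>"

text \<open>Register 0 initially contains the length of the input, which is saved before the program may
overwrite it.\<close>

definition compile :: "nat \<Rightarrow> nat \<Rightarrow> com \<Rightarrow> program"
  where "compile n S com = Copy n 0 # ccomp n S 1 com"

theorem compile_correct:
  assumes big: "big inp K com (initial_state inp) t s'" and wf: "cwf n S com" "0 < n"
    and inp: "\<And>x. x \<in> set inp \<Longrightarrow> \<bar>x\<bar> \<le> int K"
    and M: "length inp + K * t \<le> M" "S \<le> M"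
  shows "\<exists>T c. run (compile n S com) (initial_config inp) T c \<and> halted (compile n S com) c \<and>
    (\<forall>x<n. reg c x = var s' x) \<and> T \<le> (14 * t + 1) * word_cost ((S + 2) * M)"
proof -
  interpret compiled inp K n S M by unfold_locales (use inp M in auto)
  let ?P = "compile n S com" and ?c = "initial_config inp"
  define c1 where "c1 = set_reg n (int (length inp)) ?c"
  have "code_at ?P 0 (Copy n 0 # ccomp n S 1 com)"
    unfolding compile_def code_at_def by auto
  then have code: "code_at ?P 0 [Copy n 0]" "code_at ?P 1 (ccomp n S 1 com)"
    using code_at_Cons[THEN iffD1] by fastforce+
  have 1: "run ?P ?c (cost (Copy n 0) ?c) c1"
    by (rule run_one) (use code(1) in \<open>simp_all add: initial_config_def c1_def\<close>)
  have k: "cost (Copy n 0) ?c \<le> w"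
    using large by (auto intro!: bits_le_w le_large simp: initial_config_def)
  have r1: "repr (initial_state inp) c1" and pc1: "pc c1 = 1"
    using wf(2) by (simp_all add: repr_def initial_state_def c1_def initial_config_def set_reg_def)
  have b1: "bounded (length inp) (initial_state inp)"
    by (simp add: bounded_def initial_state_def)
  from run_ccomp[OF big _ r1 b1 M(1) wf(1), of ?P] code(2) pc1
  obtain T c2 where 2: "run ?P c1 T c2" "pc c2 = 1 + length (ccomp n S 1 com)" "repr s' c2" "T \<le> 14 * t * w"
    by auto
  have "halted ?P c2" by (simp add: halted_def compile_def 2(2))
  moreover have "\<forall>x<n. reg c2 x = var s' x" using 2(3) by (simp add: repr_def)
  moreover have "cost (Copy n 0) ?c + T \<le> (14 * t + 1) * w" using k 2(4) by (simp add: distrib_right)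
  ultimately show ?thesis using run_trans[OF 1 2(1)] unfolding w_def limit_def by blast
qed

section \<open>Verification rules\<close>

fun wvars :: "com \<Rightarrow> nat set"
  where
    "wvars Skip = {}"
  | "wvars (x ::= e) = {x}"
  | "wvars (Update a i e) = {}"
  | "wvars (c1 ;; c2) = wvars c1 \<union> wvars c2"
  | "wvars (If b c1 c2) = wvars c1 \<union> wvars c2"
  | "wvars (While b c) = wvars c"

fun warrs :: "com \<Rightarrow> nat set"
  where
    "warrs Skip = {}"
  | "warrs (x ::= e) = {}"
  | "warrs (Update a i e) = {a}"
  | "warrs (c1 ;; c2) = warrs c1 \<union> warrs c2"
  | "warrs (If b c1 c2) = warrs c1 \<union> warrs c2"
  | "warrs (While b c) = warrs c"

definition same_outside :: "com \<Rightarrow> state \<Rightarrow> state \<Rightarrow> bool"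
  where "same_outside c s s' \<longleftrightarrow>
    (\<forall>x. x \<notin> wvars c \<longrightarrow> var s' x = var s x) \<and> (\<forall>a. a \<notin> warrs c \<longrightarrow> arr s' a = arr s a)"

lemma same_outside_refl: "same_outside c s s"
  by (simp add: same_outside_def)

lemma same_outside_trans: "same_outside c s s' \<Longrightarrow> same_outside c s' s'' \<Longrightarrow> same_outside c s s''"
  by (simp add: same_outside_def)

lemma var_set_var [simp]: "var (set_var x v s) y = (if y = x then v else var s y)"
  and arr_set_var [simp]: "arr (set_var x v s) = arr s"
  and var_set_arr [simp]: "var (set_arr a i v s) = var s"
  and arr_set_arr [simp]: "arr (set_arr a i v s) b j = (if b = a \<and> j = i then v else arr s b j)"
  by (simp_all add: set_var_def set_arr_def)

lemma big_same_outside: "big inp K c s t s' \<Longrightarrow> same_outside c s s'"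
proof (induction rule: big.induct)
  case (If b s c1 c2 t s')
  then show ?case by (auto simp: same_outside_def split: if_splits)
qed (auto simp: same_outside_def set_arr_def)

text \<open>Total correctness with a time bound.  The fact that only the variables and arrays that occur as
targets in the program change is part of every postcondition, so that invariants can be silent about
the rest of the state.\<close>

definition runs :: "int list \<Rightarrow> nat \<Rightarrow> com \<Rightarrow> state \<Rightarrow> nat \<Rightarrow> (state \<Rightarrow> bool) \<Rightarrow> bool"
  where "runs inp K c s t Q \<longleftrightarrow> (\<exists>t' s'. big inp K c s t' s' \<and> t' \<le> t \<and> same_outside c s s' \<and> Q s')"

lemma runs_mono:
  "runs inp K c s t Q \<Longrightarrow> t \<le> t' \<Longrightarrow> (\<And>s'. same_outside c s s' \<Longrightarrow> Q s' \<Longrightarrow> Q' s') \<Longrightarrow> runs inp K c s t' Q'"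
  unfolding runs_def by (meson order_trans)

lemma runs_Seq:
  assumes "runs inp K c1 s t1 Q'" "\<And>s1. same_outside c1 s s1 \<Longrightarrow> Q' s1 \<Longrightarrow> runs inp K c2 s1 t2 Q" "t1 + t2 \<le> t"
  shows "runs inp K (c1 ;; c2) s t Q"
proof -
  obtain t1' s1 where 1: "big inp K c1 s t1' s1" "t1' \<le> t1" "same_outside c1 s s1" "Q' s1"
    using assms(1) unfolding runs_def by blast
  obtain t2' s2 where 2: "big inp K c2 s1 t2' s2" "t2' \<le> t2" "Q s2"
    using assms(2)[OF 1(3,4)] unfolding runs_def by blast
  have "big inp K (c1 ;; c2) s (t1' + t2') s2" using 1(1) 2(1) by (rule big.Seq)
  then show ?thesis using 1(2) 2(2,3) assms(3) big_same_outside unfolding runs_def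
    by (meson add_mono order_trans)
qed

lemma runs_If:
  assumes "csafe inp K b s" "cval inp b s \<Longrightarrow> runs inp K c1 s t1 Q" "\<not> cval inp b s \<Longrightarrow> runs inp K c2 s t1 Q"
    "csize b + t1 \<le> t"
  shows "runs inp K (If b c1 c2) s t Q"
proof -
  obtain t' s' where 1: "big inp K (if cval inp b s then c1 else c2) s t' s'" "t' \<le> t1" "Q s'"
    using assms(2,3) unfolding runs_def by (cases "cval inp b s") auto
  from big.If[OF assms(1) this(1)] show ?thesis
    using 1(2,3) assms(4) big_same_outside unfolding runs_def by (meson add_mono order.refl order_trans)
qed

text \<open>The number \<open>k\<close> in the invariant \<open>I k\<close> counts the iterations that are still to come.\<close>

lemma runs_While:
  assumes "I m s0"
    and step: "\<And>k s. I (Suc k) s \<Longrightarrow> same_outside c s0 s \<Longrightarrow> csafe inp K b s \<and> cval inp b s \<and> runs inp K c s tb (I k)"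
    and exit: "\<And>s. I 0 s \<Longrightarrow> same_outside c s0 s \<Longrightarrow> csafe inp K b s \<and> \<not> cval inp b s \<and> Q s"
    and time: "m * (csize b + tb) + csize b \<le> t"
  shows "runs inp K (While b c) s0 t Q"
proof -
  have "\<exists>t' s'. big inp K (While b c) s t' s' \<and> t' \<le> m * (csize b + tb) + csize b \<and> Q s'"
    if "I m s" "same_outside c s0 s" for s
    using that
  proof (induction m arbitrary: s)
    case 0
    then show ?case using exit[OF 0] by (intro exI[of _ "csize b"] exI[of _ s]) (auto intro: big.WhileF)
  next
    case (Suc m)
    from step[OF Suc.prems] obtain t1 s1
      where 1: "csafe inp K b s" "cval inp b s" "big inp K c s t1 s1" "t1 \<le> tb" "same_outside c s s1" "I m s1"
      unfolding runs_def by blast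
    from Suc.IH[OF 1(6) same_outside_trans[OF Suc.prems(2) 1(5)]] obtain t2 s2
      where 2: "big inp K (While b c) s1 t2 s2" "t2 \<le> m * (csize b + tb) + csize b" "Q s2" by blast
    from big.WhileT[OF 1(1-3) 2(1)] show ?case using 1(4) 2(2,3) by (intro exI conjI) auto
  qed
  from this[OF assms(1) same_outside_refl] show ?thesis
    using time big_same_outside unfolding runs_def by (meson order_trans)
qed

text \<open>Loop-free programs are verified by symbolic execution.\<close>

fun loop_free :: "com \<Rightarrow> bool"
  where
    "loop_free (c1 ;; c2) \<longleftrightarrow> loop_free c1 \<and> loop_free c2"
  | "loop_free (If b c1 c2) \<longleftrightarrow> loop_free c1 \<and> loop_free c2"
  | "loop_free (While b c) \<longleftrightarrow> False"
  | "loop_free c \<longleftrightarrow> True"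

fun result :: "int list \<Rightarrow> com \<Rightarrow> state \<Rightarrow> state"
  where
    "result inp (x ::= e) s = set_var x (aval inp e s) s"
  | "result inp (Update a i e) s = set_arr a (nat (aval inp i s)) (aval inp e s) s"
  | "result inp (c1 ;; c2) s = result inp c2 (result inp c1 s)"
  | "result inp (If b c1 c2) s = (if cval inp b s then result inp c1 s else result inp c2 s)"
  | "result inp c s = s"

fun all_safe :: "int list \<Rightarrow> nat \<Rightarrow> com \<Rightarrow> state \<Rightarrow> bool"
  where
    "all_safe inp K (x ::= e) s \<longleftrightarrow> safe inp K e s"
  | "all_safe inp K (Update a i e) s \<longleftrightarrow> safe inp K i s \<and> 0 \<le> aval inp i s \<and> safe inp K e s"
  | "all_safe inp K (c1 ;; c2) s \<longleftrightarrow> all_safe inp K c1 s \<and> all_safe inp K c2 (result inp c1 s)"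
  | "all_safe inp K (If b c1 c2) s \<longleftrightarrow> csafe inp K b s \<and>
      (if cval inp b s then all_safe inp K c1 s else all_safe inp K c2 s)"
  | "all_safe inp K c s \<longleftrightarrow> True"

fun max_time :: "com \<Rightarrow> nat"
  where
    "max_time (x ::= e) = esize e"
  | "max_time (Update a i e) = esize i + esize e"
  | "max_time (c1 ;; c2) = max_time c1 + max_time c2"
  | "max_time (If b c1 c2) = csize b + max (max_time c1) (max_time c2)"
  | "max_time c = 0"

lemma big_loop_free:
  "loop_free c \<Longrightarrow> all_safe inp K c s \<Longrightarrow> \<exists>t. big inp K c s t (result inp c s) \<and> t \<le> max_time c"
proof (induction c arbitrary: s)
  case (Seq c1 c2)
  then obtain t1 t2 where "big inp K c1 s t1 (result inp c1 s)" "t1 \<le> max_time c1"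
    "big inp K c2 (result inp c1 s) t2 (result inp c2 (result inp c1 s))" "t2 \<le> max_time c2"
    by (metis loop_free.simps(1) all_safe.simps(3))
  then show ?case by (intro exI[of _ "t1 + t2"]) (auto intro: big.Seq)
next
  case (If b c1 c2)
  have "\<exists>t. big inp K (if cval inp b s then c1 else c2) s t (result inp (If b c1 c2) s) \<and> t \<le> max (max_time c1) (max_time c2)"
    using If by (cases "cval inp b s") (fastforce simp: le_max_iff_disj)+
  then obtain t where t: "big inp K (if cval inp b s then c1 else c2) s t (result inp (If b c1 c2) s)"
    "t \<le> max (max_time c1) (max_time c2)" by blast
  from big.If[OF _ t(1)] If.prems t(2) show ?case by (intro exI[of _ "csize b + t"]) simp
qed (auto intro: big.intros)

lemma result_same_outside: "loop_free c \<Longrightarrow> all_safe inp K c s \<Longrightarrow> same_outside c s (result inp c s)"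
  using big_loop_free big_same_outside by blast

lemma runs_block:
  assumes "loop_free c" "all_safe inp K c s" "Q (result inp c s)" "max_time c \<le> t"
  shows "runs inp K c s t Q"
  using big_loop_free[OF assms(1,2)] assms(3,4) big_same_outside unfolding runs_def by (meson order_trans)

lemma runs_block_Seq:
  assumes "loop_free c1" "all_safe inp K c1 s" "runs inp K c2 (result inp c1 s) t2 Q" "max_time c1 + t2 \<le> t"
  shows "runs inp K (c1 ;; c2) s t Q"
  by (rule runs_Seq[OF runs_block[of c1 inp K s "\<lambda>s1. s1 = result inp c1 s", OF assms(1,2) _ order.refl] _ assms(4)])
    (use assms(3) in auto)

section \<open>The program\<close>

text \<open>
The program builds the word \<open>u v u\<^sup>-\<^sup>1 v\<^sup>-\<^sup>1\<close> of length \<open>v_n\<close>, of which \<open>u\<close> are the first \<open>v_a\<close> letters, \<open>u v\<close>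
the first \<open>v_b\<close>, and \<open>u v u\<^sup>-\<^sup>1\<close> the first \<open>v_c\<close>.  While the input is read, \<open>v_found\<close> still holds its
length; later it becomes the flag that decides between \<open>Fail\<close> and the exponent in \<open>v_exp\<close>.
\<close>

abbreviation (input) "v_found \<equiv> 0 :: nat"
abbreviation (input) "v_exp \<equiv> 1 :: nat"
abbreviation (input) "v_pos \<equiv> 2 :: nat"
abbreviation (input) "v_n \<equiv> 3 :: nat"
abbreviation (input) "v_a \<equiv> 4 :: nat"
abbreviation (input) "v_b \<equiv> 5 :: nat"
abbreviation (input) "v_c \<equiv> 6 :: nat"
abbreviation (input) "v_gen \<equiv> 7 :: nat"
abbreviation (input) "v_sgn \<equiv> 8 :: nat"
abbreviation (input) "v_q \<equiv> 9 :: nat"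
abbreviation (input) "v_p \<equiv> 10 :: nat"
abbreviation (input) "v_nz \<equiv> 11 :: nat"
abbreviation (input) "v_i \<equiv> 12 :: nat"
abbreviation (input) "v_k \<equiv> 13 :: nat"
abbreviation (input) "v_x \<equiv> 14 :: nat"
abbreviation (input) "v_size \<equiv> 15 :: nat"
abbreviation (input) "v_lev \<equiv> 16 :: nat"
abbreviation (input) "v_t \<equiv> 17 :: nat"

text \<open>
Prefixes of the word are numbered by their lengths.  At every level, \<open>a_id\<close> names the class of each
prefix by \<open>Suc r\<close> times the number of the shortest prefix in that class; the factor leaves room to
add a generator, so that the name of an edge is a single number (\<open>a_edge\<close>) that can index the array
\<open>a_cnt\<close> of edge counters.  The multiples of \<open>Suc r\<close> are tabulated in \<open>a_mul\<close>.
\<close>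

abbreviation (input) "a_gen \<equiv> 0 :: nat"
abbreviation (input) "a_sgn \<equiv> 1 :: nat"
abbreviation (input) "a_mul \<equiv> 2 :: nat"
abbreviation (input) "a_id \<equiv> 3 :: nat"
abbreviation (input) "a_edge \<equiv> 4 :: nat"
abbreviation (input) "a_cnt \<equiv> 5 :: nat"

abbreviation (input) "incr x \<equiv> x ::= Plus (V x) (N 1)"
abbreviation (input) "decr x \<equiv> x ::= Minus (V x) (N 1)"

definition clear_counters :: com
  where "clear_counters =
    v_x ::= N 0 ;;
    While (Less (V v_x) (V v_size)) (Update a_cnt (V v_x) (N 0) ;; incr v_x) ;;
    v_nz ::= N 0"

text \<open>Adds or subtracts one letter of the path, depending on the constructor \<open>f\<close>.  Keeping the number of
nonzero counters in \<open>v_nz\<close> makes the test whether the whole flow vanishes a matter of one comparison.\<close>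

definition count_letter :: "(aexp \<Rightarrow> aexp \<Rightarrow> aexp) \<Rightarrow> com"
  where "count_letter f =
    If (Equal (Arr a_cnt (Arr a_edge (V v_p))) (N 0)) (incr v_nz) Skip ;;
    Update a_cnt (Arr a_edge (V v_p)) (f (Arr a_cnt (Arr a_edge (V v_p))) (Arr a_sgn (V v_p))) ;;
    If (Equal (Arr a_cnt (Arr a_edge (V v_p))) (N 0)) (decr v_nz) Skip ;;
    incr v_p"

definition count_segment :: "(aexp \<Rightarrow> aexp \<Rightarrow> aexp) \<Rightarrow> aexp \<Rightarrow> nat \<Rightarrow> com"
  where "count_segment f e x = v_p ::= e ;; While (Less (V v_p) (V x)) (count_letter f)"

definition compute_edges :: com
  where "compute_edges =
    v_p ::= N 0 ;;
    While (Less (V v_p) (V v_n))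
     (If (Less (N 0) (Arr a_sgn (V v_p)))
        (Update a_edge (V v_p) (Plus (Arr a_id (V v_p)) (Arr a_gen (V v_p))))
        (Update a_edge (V v_p) (Plus (Arr a_id (Plus (V v_p) (N 1))) (Arr a_gen (V v_p)))) ;;
      incr v_p)"

text \<open>Since \<open>v_i\<close> runs downwards, the last value that is written to \<open>a_id\<close> is the smallest number in the
class.\<close>

definition compare_prefixes :: com
  where "compare_prefixes =
    v_i ::= Plus (V v_n) (N 1) ;;
    While (Less (N 0) (V v_i))
     (decr v_i ;;
      clear_counters ;;
      Update a_id (V v_i) (Arr a_mul (V v_i)) ;;
      v_p ::= V v_i ;;
      While (Less (V v_p) (V v_n))
       (count_letter Plus ;;
        If (Equal (V v_nz) (N 0)) (Update a_id (V v_p) (Arr a_mul (V v_i))) Skip))"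

text \<open>The last piece of the word is \<open>v\<^sup>-\<^sup>1\<close>.  The counters start with the flow of \<open>u\<close>; adding the flow of
the last piece \<open>v_k\<close> times, for \<open>v_k\<close> up to the length of \<open>u\<close>, and then subtracting it again and again
visits all exponents whose absolute value is at most the length of \<open>u\<close>.\<close>

definition search_exponent :: com
  where "search_exponent =
    v_found ::= N 0 ;;
    clear_counters ;;
    count_segment Plus (N 0) v_a ;;
    v_k ::= N 0 ;;
    v_t ::= N 1 ;;
    While (Less (V v_k) (V v_a))
     (count_segment Plus (V v_c) v_n ;;
      incr v_k ;;
      v_t ::= Plus (V v_t) (N 2)) ;;
    While (Less (N 0) (V v_t))
     (If (Equal (V v_nz) (N 0)) (v_found ::= N 1 ;; v_exp ::= V v_k) Skip ;;
      count_segment Minus (V v_c) v_n ;;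
      decr v_k ;;
      decr v_t)"

text \<open>A search at a later level overwrites the outcome of an earlier one: the level that decides is the
last one at which \<open>v\<close> represents the identity.  The test at the end is whether \<open>u\<close> and \<open>v\<close> commute.\<close>

definition levels :: "nat \<Rightarrow> com"
  where "levels d =
    v_found ::= N 1 ;; 
    v_exp ::= N 0 ;;
    v_lev ::= N (int d) ;;
    While (Less (N 0) (V v_lev))
     (compute_edges ;;
      If (Equal (Arr a_id (V v_c)) (N 0)) search_exponent Skip ;;
      compare_prefixes ;;
      decr v_lev) ;;
    If (Equal (Arr a_id (V v_n)) (N 0)) Skip (v_found ::= N 0)"

definition append_letter :: "aexp \<Rightarrow> aexp \<Rightarrow> com"
  where "append_letter e e' =
    Update a_gen (V v_n) e ;; Update a_sgn (V v_n) e' ;; incr v_n"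

definition append_inverse :: "aexp \<Rightarrow> aexp \<Rightarrow> com"
  where "append_inverse e e' =
    v_q ::= e' ;;
    While (Less e (V v_q))
     (decr v_q ;; append_letter (Arr a_gen (V v_q)) (Minus (N 0) (Arr a_sgn (V v_q))))"

definition init_ids :: "nat \<Rightarrow> com"
  where "init_ids r =
    v_i ::= N 0 ;;
    v_x ::= N 0 ;;
    While (Less (V v_i) (Plus (V v_n) (N 1)))
     (Update a_mul (V v_i) (V v_x) ;; Update a_id (V v_i) (N 0) ;;
      incr v_i ;; v_x ::= Plus (V v_x) (N (int (Suc r)))) ;;
    v_size ::= V v_x"

text \<open>A decision tree on the bits of a letter; \<open>bs\<close> is the part of the code that has been read.\<close>

fun read_letter :: "(bool list \<Rightarrow> nat letter) \<Rightarrow> bool list \<Rightarrow> nat \<Rightarrow> com"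
  where
    "read_letter dec bs 0 = v_gen ::= N (int (fst (dec bs))) ;; v_sgn ::= N (if snd (dec bs) then 1 else -1)"
  | "read_letter dec bs (Suc l) =
      If (Equal (In (V v_pos)) (N 0))
        (incr v_pos ;; read_letter dec (bs @ [False]) l)
        (incr v_pos ;; read_letter dec (bs @ [True]) l)"

definition parse :: "(bool list \<Rightarrow> nat letter) \<Rightarrow> nat \<Rightarrow> com"
  where "parse dec l =
    While (Less (In (V v_pos)) (N 2))
      (read_letter dec [] l ;; append_letter (V v_gen) (V v_sgn)) ;;
    v_a ::= V v_n ;;
    incr v_pos ;;
    While (Less (V v_pos) (V v_found))
      (read_letter dec [] l ;; append_letter (V v_gen) (V v_sgn)) ;;
    v_b ::= V v_n"

definition power_program :: "nat \<Rightarrow> nat \<Rightarrow> (bool list \<Rightarrow> nat letter) \<Rightarrow> nat \<Rightarrow> com"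
  where "power_program r d dec l =
    parse dec l ;;
    append_inverse (N 0) (V v_a) ;;
    v_c ::= V v_n ;;
    append_inverse (V v_a) (V v_b) ;;
    init_ids r ;;
    levels d"

section \<open>Counting the edges of a path\<close>

lemma card_nonzero_update:
  fixes f :: "nat \<Rightarrow> int" and m x :: nat
  assumes "x < m"
  shows "int (card {e. e < m \<and> (f(x := v)) e \<noteq> 0}) =
    int (card {e. e < m \<and> f e \<noteq> 0}) + (if f x = 0 then 1 else 0) - (if v = 0 then 1 else 0)"
proof -
  define A where "A = {e. e < m \<and> f e \<noteq> 0 \<and> e \<noteq> x}"
  have A: "finite A" "x \<notin> A" by (simp_all add: A_def)
  have "{e. e < m \<and> (f(x := v)) e \<noteq> 0} = (if v = 0 then A else insert x A)"
    using assms by (simp add: A_def set_eq_iff)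
  moreover have "{e. e < m \<and> f e \<noteq> 0} = (if f x = 0 then A else insert x A)"
    using assms by (simp add: A_def set_eq_iff) metis
  ultimately show ?thesis using A by simp
qed

locale word_setup =
  fixes inp :: "int list" and K r :: nat and W :: "nat word"
  assumes W: "W \<in> lists (letters {1..r})" and K: "r + 2 \<le> K"
begin

abbreviation "n \<equiv> length W"

text \<open>Numbers of edges are less than \<open>m\<close>, the size of the array of counters.\<close>

definition m where "m = Suc r * Suc n"

definition sgn_at :: "nat \<Rightarrow> int"
  where "sgn_at p = (if snd (W ! p) then 1 else -1)"

text \<open>All counters that occur are sums over the positions of the word: \<open>E p\<close> is the edge at position \<open>p\<close>, and
\<open>h p\<close> the multiplicity with which this position counts.\<close>

definition total :: "(nat \<Rightarrow> 'e) \<Rightarrow> (nat \<Rightarrow> int) \<Rightarrow> 'e \<Rightarrow> int"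
  where "total E h e = (\<Sum>p<n. if E p = e then h p else 0)"

definition tables :: "state \<Rightarrow> bool"
  where "tables s \<longleftrightarrow> var s v_n = int n \<and> var s v_size = int m \<and>
    (\<forall>p<n. arr s a_gen p = int (fst (W ! p)) \<and> arr s a_sgn p = sgn_at p) \<and>
    (\<forall>p\<le>n. arr s a_mul p = int (Suc r * p))"

definition edges :: "(nat \<Rightarrow> nat) \<Rightarrow> state \<Rightarrow> bool"
  where "edges E s \<longleftrightarrow> (\<forall>p<n. E p < m \<and> arr s a_edge p = int (E p))"

definition counters :: "(nat \<Rightarrow> nat) \<Rightarrow> (nat \<Rightarrow> int) \<Rightarrow> state \<Rightarrow> bool"
  where "counters E h s \<longleftrightarrow> (\<forall>e<m. arr s a_cnt e = total E h e) \<and>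
    var s v_nz = int (card {e. e < m \<and> total E h e \<noteq> 0})"

lemma total_update:
  assumes "p < n"
  shows "total E (h(p := h p + x)) = (total E h)(E p := total E h (E p) + x)"
proof
  fix e
  have "total E (h(p := h p + x)) e = (\<Sum>q<n. (if E q = e then h q else 0) + (if q = p then if E p = e then x else 0 else 0))"
    unfolding total_def by (rule sum.cong) auto
  also have "\<dots> = total E h e + (if E p = e then x else 0)"
    using assms by (simp add: sum.distrib total_def)
  finally show "total E (h(p := h p + x)) e = ((total E h)(E p := total E h (E p) + x)) e" by auto
qed

lemma sgn_at_abs: "\<bar>sgn_at p\<bar> = 1"
  by (simp add: sgn_at_def)

definition "sign_of f = (if f = Plus then 1 else -1 :: int)"

lemma sign_of_Minus: "sign_of Minus = -1"
proof -
  have "Minus (N 0) (N 0) \<noteq> Plus (N 0) (N 0)" by simp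
  then have "Minus \<noteq> Plus" by metis
  then show ?thesis by (simp add: sign_of_def)
qed

lemma count_letter:
  assumes "tables s" "edges E s" "counters E h s" "f = Plus \<or> f = Minus" "var s v_p = int p" "p < n"
  defines "s' \<equiv> result inp (count_letter f) s"
  shows "all_safe inp K (count_letter f) s" "counters E (h(p := h p + sign_of f * sgn_at p)) s'"
    "var s' v_p = int (Suc p)"
proof -
  have e: "arr s a_edge p = int (E p)" "E p < m" and g: "arr s a_sgn p = sgn_at p"
    and c: "\<And>e. e < m \<Longrightarrow> arr s a_cnt e = total E h e"
    using assms by (simp_all add: edges_def tables_def counters_def)
  have "1 \<le> K" using K by simp
  then show "all_safe inp K (count_letter f) s"
    using assms(4) by (auto simp: count_letter_def assms(5) e(1) g[simplified] sgn_at_abs)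
  show "counters E (h(p := h p + sign_of f * sgn_at p)) s'"
    using assms(3,4) e(2) unfolding counters_def total_update[OF assms(6)] card_nonzero_update[OF e(2)]
    by (auto simp: s'_def count_letter_def assms(5) e(1) g[simplified] c sign_of_def)
  show "var s' v_p = int (Suc p)"
    by (auto simp: s'_def count_letter_def assms(5))
qed

lemma loop_free_count_letter: "f = Plus \<or> f = Minus \<Longrightarrow> loop_free (count_letter f)"
  and time_count_letter: "f = Plus \<or> f = Minus \<Longrightarrow> max_time (count_letter f) = 25"
  by (auto simp: count_letter_def)

lemma tables_same_outside:
  assumes "tables s" "same_outside c s s'" "v_n \<notin> wvars c" "v_size \<notin> wvars c"
    "a_gen \<notin> warrs c" "a_sgn \<notin> warrs c" "a_mul \<notin> warrs c"
  shows "tables s'"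
  using assms by (simp add: tables_def same_outside_def)

lemma edges_same_outside: "edges E s \<Longrightarrow> same_outside c s s' \<Longrightarrow> a_edge \<notin> warrs c \<Longrightarrow> edges E s'"
  by (simp add: edges_def same_outside_def)

lemma var_same_outside: "same_outside c s s' \<Longrightarrow> x \<notin> wvars c \<Longrightarrow> var s' x = var s x"
  and arr_same_outside: "same_outside c s s' \<Longrightarrow> a \<notin> warrs c \<Longrightarrow> arr s' a = arr s a"
  by (simp_all add: same_outside_def)

lemma wvars_count_letter: "wvars (count_letter f) = {v_nz, v_p}"
  and warrs_count_letter: "warrs (count_letter f) = {a_cnt}"
  by (auto simp: count_letter_def)

lemma wvars_clear: "wvars clear_counters = {v_x, v_nz}"
  and warrs_clear: "warrs clear_counters = {a_cnt}"
  by (auto simp: clear_counters_def)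

lemma K_ge: "int r \<le> int K" "(1::int) \<le> int K" "(2::int) \<le> int K"
  using K by simp_all

text \<open>The constants in this and the following time bounds count the nodes of the expressions that are
evaluated.\<close>

lemma runs_clear_counters:
  assumes "tables s"
  shows "runs inp K clear_counters s (7 * m + 4) (counters E (\<lambda>_. 0))"
proof -
  let ?c = "Update a_cnt (V v_x) (N 0) ;; incr v_x" and ?s = "set_var v_x 0 s"
  let ?I = "\<lambda>k s. \<exists>j. j + k = m \<and> var s v_x = int j \<and> (\<forall>e<j. arr s a_cnt e = 0)"
  have sz: "var s v_size = int m" using assms by (simp add: tables_def)
  have loop: "runs inp K (While (Less (V v_x) (V v_size)) ?c) ?s (7 * m + 2)
      (\<lambda>s'. \<forall>e<m. arr s' a_cnt e = 0)"
  proof (rule runs_While[where I = ?I and m = m and tb = 5])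
    show "?I m ?s" by simp
    fix k s1 assume "?I (Suc k) s1" and same: "same_outside ?c ?s s1"
    then obtain j where j: "j + Suc k = m" "var s1 v_x = int j" "\<forall>e<j. arr s1 a_cnt e = 0" by blast
    have sz1: "var s1 v_size = int m" using var_same_outside[OF same, of v_size] sz by simp
    have "runs inp K ?c s1 5 (?I k)"
      by (rule runs_block) (use j K_ge in \<open>auto intro!: exI[of _ "Suc j"] simp: less_Suc_eq\<close>)
    then show "csafe inp K (Less (V v_x) (V v_size)) s1 \<and> cval inp (Less (V v_x) (V v_size)) s1 \<and>
        runs inp K ?c s1 5 (?I k)"
      using j sz1 by simp
  next
    fix s1 assume "?I 0 s1" and same: "same_outside ?c ?s s1"
    then show "csafe inp K (Less (V v_x) (V v_size)) s1 \<and> \<not> cval inp (Less (V v_x) (V v_size)) s1 \<and>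
        (\<forall>e<m. arr s1 a_cnt e = 0)"
      using var_same_outside[OF same, of v_size] sz by auto
  qed simp
  show ?thesis
    unfolding clear_counters_def
  proof (rule runs_block_Seq[where ?t2.0 = "7 * m + 3"])
    show "runs inp K (While (Less (V v_x) (V v_size)) ?c ;; v_nz ::= N 0) (result inp (v_x ::= N 0) s) (7 * m + 3)
        (counters E (\<lambda>_. 0))"
    proof (rule runs_Seq[where ?t1.0 = "7 * m + 2" and ?t2.0 = 1])
      show "runs inp K (While (Less (V v_x) (V v_size)) ?c) (result inp (v_x ::= N 0) s) (7 * m + 2)
          (\<lambda>s'. \<forall>e<m. arr s' a_cnt e = 0)"
        using loop by simp
      fix s1 :: state assume "\<forall>e<m. arr s1 a_cnt e = 0"
      then show "runs inp K (v_nz ::= N 0) s1 1 (counters E (\<lambda>_. 0))"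
        by (intro runs_block) (simp_all add: counters_def total_def)
    qed simp
  qed simp_all
qed

lemma runs_count_segment:
  assumes s: "tables s" "edges E s" "counters E h s" and f: "f = Plus \<or> f = Minus"
    and e: "safe inp K e s" "aval inp e s = int p0" and x: "x \<noteq> v_p" "x \<noteq> v_nz" "var s x = int q0"
    and le: "p0 \<le> q0" "q0 \<le> n" and t: "27 * n + 2 + esize e \<le> t"
  shows "runs inp K (count_segment f e x) s t
    (counters E (\<lambda>i. h i + (if p0 \<le> i \<and> i < q0 then sign_of f * sgn_at i else 0)))"
proof -
  let ?h = "\<lambda>p i. h i + (if p0 \<le> i \<and> i < p then sign_of f * sgn_at i else 0)"
  let ?I = "\<lambda>k s. \<exists>p. p + k = q0 \<and> p0 \<le> p \<and> var s v_p = int p \<and> counters E (?h p) s"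
  let ?c = "count_letter f" and ?b = "Less (V v_p) (V x)" and ?s = "set_var v_p (int p0) s"
  have loop: "runs inp K (While ?b ?c) ?s (27 * n + 2) (counters E (?h q0))"
  proof (rule runs_While[where I = ?I and m = "q0 - p0" and tb = 25])
    have "counters E h ?s" using s(3) by (simp add: counters_def)
    moreover have "?h p0 = h" by (auto simp: fun_eq_iff)
    ultimately have "counters E (?h p0) ?s" by (simp only:)
    then show "?I (q0 - p0) ?s" using le by (intro exI[of _ p0] conjI) simp_all
    fix k s1 assume "?I (Suc k) s1" and same: "same_outside ?c ?s s1"
    then obtain p where p: "p + Suc k = q0" "p0 \<le> p" "var s1 v_p = int p" "counters E (?h p) s1" by blast
    have t1: "tables s1"
      by (rule tables_same_outside[OF _ same]) (use s(1) in \<open>simp_all add: tables_def wvars_count_letter warrs_count_letter\<close>)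
    have e1: "edges E s1"
      by (rule edges_same_outside[OF _ same]) (use s(2) in \<open>simp_all add: edges_def warrs_count_letter\<close>)
    have x1: "var s1 x = int q0"
      using var_same_outside[OF same, of x] x by (simp add: wvars_count_letter)
    have "p < n" using p(1) le by simp
    note cl = count_letter[OF t1 e1 p(4) f p(3) this]
    have "(?h p)(p := ?h p p + sign_of f * sgn_at p) = ?h (Suc p)"
      using p(2) by (auto simp: fun_eq_iff less_Suc_eq)
    with cl(2) have "counters E (?h (Suc p)) (result inp ?c s1)" by simp
    with cl(3) have "?I k (result inp ?c s1)" using p(1,2) by (intro exI[of _ "Suc p"]) simp
    then have "runs inp K ?c s1 25 (?I k)"
      by (intro runs_block loop_free_count_letter f cl(1)) (simp_all add: time_count_letter f)
    then show "csafe inp K ?b s1 \<and> cval inp ?b s1 \<and> runs inp K ?c s1 25 (?I k)"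
      using p x1 by simp
  next
    fix s1 assume "?I 0 s1" and same: "same_outside ?c ?s s1"
    then show "csafe inp K ?b s1 \<and> \<not> cval inp ?b s1 \<and> counters E (?h q0) s1"
      using var_same_outside[OF same, of x] x by (auto simp: wvars_count_letter)
  next
    have "(q0 - p0) * 27 \<le> n * 27" using le by (intro mult_right_mono) auto
    then show "(q0 - p0) * (csize ?b + 25) + csize ?b \<le> 27 * n + 2" by simp
  qed
  show ?thesis
    unfolding count_segment_def
    by (rule runs_block_Seq[where ?t2.0 = "27 * n + 2"]) (use e loop t in simp_all)
qed

definition ids :: "(nat \<Rightarrow> nat) \<Rightarrow> state \<Rightarrow> bool"
  where "ids idx s \<longleftrightarrow> (\<forall>p\<le>n. idx p \<le> p \<and> arr s a_id p = int (Suc r * idx p))"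

definition edge_code :: "(nat \<Rightarrow> nat) \<Rightarrow> nat \<Rightarrow> nat"
  where "edge_code idx p = Suc r * idx (if snd (W ! p) then p else Suc p) + fst (W ! p)"

lemma generator: "p < n \<Longrightarrow> 1 \<le> fst (W ! p) \<and> fst (W ! p) \<le> r"
proof -
  assume "p < n"
  then have "W ! p \<in> letters {1..r}" using W by (simp only: in_lists_conv_set nth_mem)
  then show ?thesis by (auto simp: letters_def)
qed

lemma edge_code_less:
  assumes "\<And>p. p \<le> n \<Longrightarrow> idx p \<le> p" "p < n"
  shows "edge_code idx p < m"
proof -
  have "idx (if snd (W ! p) then p else Suc p) \<le> n"
    using assms(1)[of p] assms(1)[of "Suc p"] assms(2) by auto
  then have "Suc r * idx (if snd (W ! p) then p else Suc p) \<le> Suc r * n" by (rule mult_left_mono) simp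
  then show ?thesis using generator[OF assms(2)] unfolding edge_code_def m_def by simp
qed

lemma runs_compute_edges:
  assumes s: "tables s" "ids idx s"
  shows "runs inp K compute_edges s (16 * n + 3) (edges (edge_code idx))"
proof -
  let ?E = "edge_code idx"
  let ?b = "Less (V v_p) (V v_n)"
  let ?c = "If (Less (N 0) (Arr a_sgn (V v_p)))
        (Update a_edge (V v_p) (Plus (Arr a_id (V v_p)) (Arr a_gen (V v_p))))
        (Update a_edge (V v_p) (Plus (Arr a_id (Plus (V v_p) (N 1))) (Arr a_gen (V v_p)))) ;;
      incr v_p"
  let ?I = "\<lambda>k s. \<exists>p. p + k = n \<and> var s v_p = int p \<and> (\<forall>q<p. arr s a_edge q = int (?E q))"
  have loop: "runs inp K (While ?b ?c) (set_var v_p 0 s) (16 * n + 2) (edges ?E)"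
  proof (rule runs_While[where I = ?I and m = n and tb = 14])
    show "?I n (set_var v_p 0 s)" by simp
    fix k s1 assume "?I (Suc k) s1" and same: "same_outside ?c (set_var v_p 0 s) s1"
    then obtain p where p: "p + Suc k = n" "var s1 v_p = int p" "\<forall>q<p. arr s1 a_edge q = int (?E q)" by blast
    have same': "var s1 v_n = var s v_n" "arr s1 a_gen = arr s a_gen" "arr s1 a_sgn = arr s a_sgn" "arr s1 a_id = arr s a_id"
      using var_same_outside[OF same, of v_n] arr_same_outside[OF same, of a_gen]
        arr_same_outside[OF same, of a_sgn] arr_same_outside[OF same, of a_id] by simp_all
    have pn: "p < n" using p(1) by simp
    have v: "arr s1 a_gen p = int (fst (W ! p))" "arr s1 a_sgn p = sgn_at p"
      "arr s1 a_id p = int (Suc r * idx p)" "arr s1 a_id (Suc p) = int (Suc r * idx (Suc p))" "var s1 v_n = int n"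
      using s pn by (simp_all only: same' tables_def ids_def)
    have g: "int (fst (W ! p)) \<le> int K" using generator[OF pn] K by simp
    have np: "nat (1 + int p) = Suc p" by simp
    have Eq: "arr (result inp ?c s1) a_edge p = int (?E p)" "\<And>q. q \<noteq> p \<Longrightarrow> arr (result inp ?c s1) a_edge q = arr s1 a_edge q"
      using p(2) v(1) v(2)[simplified] v(3,4)[simplified]
      by (auto simp: edge_code_def sgn_at_def np add.commute[of "int p" 1])
    have "runs inp K ?c s1 14 (?I k)"
    proof (rule runs_block)
      show "all_safe inp K ?c s1" using p(2) v(1) v(2)[simplified] g K_ge by simp
      show "?I k (result inp ?c s1)"
      proof (intro exI[of _ "Suc p"] conjI allI impI)
        show "var (result inp ?c s1) v_p = int (Suc p)" using p(2) by simp
        fix q assume "q < Suc p"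
        then show "arr (result inp ?c s1) a_edge q = int (?E q)"
          using Eq p(3) by (cases "q = p") auto
      qed (use p(1) in simp)
    qed simp_all
    then show "csafe inp K ?b s1 \<and> cval inp ?b s1 \<and> runs inp K ?c s1 14 (?I k)"
      using p v(5) by simp
  next
    fix s1 assume I: "?I 0 s1" and same: "same_outside ?c (set_var v_p 0 s) s1"
    have "var s1 v_n = int n" using var_same_outside[OF same, of v_n] s(1) by (simp add: tables_def)
    moreover have "edges ?E s1" using I edge_code_less s(2) by (auto simp: edges_def ids_def)
    ultimately show "csafe inp K ?b s1 \<and> \<not> cval inp ?b s1 \<and> edges ?E s1" using I by auto
  qed simp
  show ?thesis
    unfolding compute_edges_def by (rule runs_block_Seq[where ?t2.0 = "16 * n + 2"]) (use loop in simp_all)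
qed

text \<open>The multiplicities that give the flow of the path from prefix \<open>p\<close> to prefix \<open>q\<close>.\<close>

definition segment :: "nat \<Rightarrow> nat \<Rightarrow> nat \<Rightarrow> int"
  where "segment p q i = (if p \<le> i \<and> i < q then sgn_at i else 0)"

definition vanishes :: "(nat \<Rightarrow> 'e) \<Rightarrow> (nat \<Rightarrow> int) \<Rightarrow> bool"
  where "vanishes E h \<longleftrightarrow> (\<forall>e. total E h e = 0)"

text \<open>What \<open>a_id\<close> holds at \<open>p\<close> after the descending loop has treated \<open>i\<close>, up to the factor \<open>Suc r\<close>.  Only \<open>j \<le> p\<close>
is relevant, because the empty segment from \<open>p\<close> to \<open>p\<close> has no flow.\<close>

definition first :: "(nat \<Rightarrow> 'e) \<Rightarrow> nat \<Rightarrow> nat \<Rightarrow> nat"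
  where "first E i p = (LEAST j. i \<le> j \<and> vanishes E (segment j p))"

lemma vanishes_empty: "vanishes E (segment p p)"
  by (auto simp: vanishes_def segment_def total_def intro!: sum.neutral)

lemma first_props:
  assumes "i \<le> p"
  shows "i \<le> first E i p" "vanishes E (segment (first E i p) p)" "first E i p \<le> p"
  using LeastI[of "\<lambda>j. i \<le> j \<and> vanishes E (segment j p)" p] Least_le[of "\<lambda>j. i \<le> j \<and> vanishes E (segment j p)" p]
    assms vanishes_empty by (auto simp: first_def)

text \<open>The step of the descending loop in \<open>compare_prefixes\<close>.\<close>

lemma first_rec:
  "first E i p = (if vanishes E (segment i p) then i else first E (Suc i) p)"
proof (cases "vanishes E (segment i p)")
  case True
  then show ?thesis by (auto simp: first_def intro!: Least_equality)
next
  case False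
  then have "(i \<le> j \<and> vanishes E (segment j p)) = (Suc i \<le> j \<and> vanishes E (segment j p))" for j
    by (cases "i = j") auto
  with False show ?thesis by (simp add: first_def)
qed

lemma counters_zero:
  assumes "counters E h s" "edges E s"
  shows "var s v_nz = 0 \<longleftrightarrow> vanishes E h"
proof -
  have "total E h e = 0" if "\<not> e < m" for e
    using assms(2) that by (auto simp: total_def edges_def intro!: sum.neutral)
  then show ?thesis using assms(1) by (auto simp: counters_def vanishes_def)
qed

lemma runs_compare_prefixes:
  assumes s: "tables s" "edges E s"
  shows "runs inp K compare_prefixes s (Suc n * (7 * m + 32 * n + 15) + 5) (ids (first E 0))"
proof -
  let ?b2 = "Less (V v_p) (V v_n)"
  let ?check = "If (Equal (V v_nz) (N 0)) (Update a_id (V v_p) (Arr a_mul (V v_i))) Skip"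
  let ?c2 = "count_letter Plus ;; ?check"
  let ?b = "Less (N 0) (V v_i)"
  let ?c = "decr v_i ;; clear_counters ;; Update a_id (V v_i) (Arr a_mul (V v_i)) ;; v_p ::= V v_i ;; While ?b2 ?c2"
  let ?done = "\<lambda>i p s. arr s a_id p = int (Suc r * first E i p)"
  let ?I = "\<lambda>i s. i \<le> Suc n \<and> var s v_i = int i \<and> (\<forall>p. i \<le> p \<and> p \<le> n \<longrightarrow> ?done i p s)"
  have keep: "tables s1 \<and> edges E s1" if "same_outside ?c s s1" for s1
    using tables_same_outside[OF s(1) that] edges_same_outside[OF s(2) that]
    by (simp add: wvars_clear warrs_clear wvars_count_letter warrs_count_letter)
  have inner: "runs inp K (While ?b2 ?c2) s2 (32 * n + 2) (?I i)"
    if s2: "tables s2" "edges E s2" "counters E (segment i i) s2" "var s2 v_i = int i" "var s2 v_p = int i"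
      "i \<le> n" "?done i i s2" "\<forall>p. Suc i \<le> p \<and> p \<le> n \<longrightarrow> ?done (Suc i) p s2" for i s2
  proof -
    let ?J = "\<lambda>k s. \<exists>p. p + k = n \<and> i \<le> p \<and> var s v_p = int p \<and> counters E (segment i p) s \<and>
      (\<forall>q. i \<le> q \<and> q \<le> p \<longrightarrow> ?done i q s) \<and> (\<forall>q. p < q \<and> q \<le> n \<longrightarrow> ?done (Suc i) q s)"
    show ?thesis
    proof (rule runs_While[where I = ?J and m = "n - i" and tb = 30])
      have "?done i q s2" if "i \<le> q \<and> q \<le> i" for q
        using that s2(7) by (metis order_antisym)
      then show "?J (n - i) s2" using s2 by (intro exI[of _ i]) auto
      fix k s3 assume "?J (Suc k) s3" and same: "same_outside ?c2 s2 s3"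
      then obtain p where p: "p + Suc k = n" "i \<le> p" "var s3 v_p = int p" "counters E (segment i p) s3"
        "\<forall>q. i \<le> q \<and> q \<le> p \<longrightarrow> ?done i q s3" "\<forall>q. p < q \<and> q \<le> n \<longrightarrow> ?done (Suc i) q s3" by blast
      have k3: "tables s3" "edges E s3" "var s3 v_i = int i"
        using tables_same_outside[OF s2(1) same] edges_same_outside[OF s2(2) same] var_same_outside[OF same, of v_i] s2(4)
        by (simp_all add: wvars_count_letter warrs_count_letter)
      have pn: "p < n" using p(1) by simp
      define s4 where "s4 = result inp (count_letter Plus) s3"
      note cl = count_letter[OF k3(1,2) p(4) _ p(3) pn, of Plus, folded s4_def]
      have "(segment i p)(p := segment i p p + sign_of Plus * sgn_at p) = segment i (Suc p)"
        using p(2) by (auto simp: fun_eq_iff segment_def sign_of_def less_Suc_eq)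
      with cl(2) have cnt: "counters E (segment i (Suc p)) s4" by simp
      have "same_outside (count_letter Plus) s3 s4"
        unfolding s4_def by (rule result_same_outside[OF loop_free_count_letter cl(1)]) simp_all
      then have k4: "tables s4" "edges E s4" "var s4 v_i = int i" "arr s4 a_id = arr s3 a_id"
        using tables_same_outside[OF k3(1)] edges_same_outside[OF k3(2)] var_same_outside[of _ s3 s4 v_i] arr_same_outside[of _ s3 s4 a_id] k3(3)
        by (simp_all add: wvars_count_letter warrs_count_letter)
      have mul: "arr s4 a_mul i = int (Suc r * i)" using k4(1) s2(6) by (simp only: tables_def)
      have zero: "var s4 v_nz = 0 \<longleftrightarrow> vanishes E (segment i (Suc p))" by (rule counters_zero[OF cnt k4(2)])
      define s5 where "s5 = result inp ?check s4"
      have id5: "arr s5 a_id q = (if q = Suc p \<and> vanishes E (segment i (Suc p)) then int (Suc r * i) else arr s3 a_id q)" for q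
        using mul cl(3) by (auto simp: s5_def zero k4(3,4))
      have "counters E (segment i (Suc p)) s5" "var s5 v_p = int (Suc p)"
        using cnt cl(3) by (auto simp: s5_def counters_def)
      moreover have "?done i q s5" if q: "i \<le> q \<and> q \<le> Suc p" for q
      proof (cases "q = Suc p")
        case True
        have "?done (Suc i) (Suc p) s3" using p(6) pn by simp
        with True show ?thesis using first_rec[of E i "Suc p"] by (simp only: id5) simp
      next
        case False
        then have "?done i q s3" using p(5) q by (simp del: of_nat_mult mult_Suc)
        with False show ?thesis by (simp only: id5) simp
      qed
      moreover have "?done (Suc i) q s5" if q: "Suc p < q \<and> q \<le> n" for q
        using p(6) q by (simp add: id5 del: of_nat_mult mult_Suc)
      ultimately have J: "?J k s5" using p(1,2) by (intro exI[of _ "Suc p"]) (simp del: of_nat_mult mult_Suc)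
      have "runs inp K ?c2 s3 30 (?J k)"
      proof (rule runs_block)
        show "all_safe inp K ?c2 s3" using cl(1,3) k4(3) K_ge by (simp add: s4_def[symmetric])
        show "?J k (result inp ?c2 s3)" using J by (simp only: s5_def s4_def result.simps)
      qed (simp_all add: loop_free_count_letter time_count_letter)
      then show "csafe inp K ?b2 s3 \<and> cval inp ?b2 s3 \<and> runs inp K ?c2 s3 30 (?J k)"
        using p(3) pn k3(1) by (simp add: tables_def)
    next
      fix s3 assume "?J 0 s3" and same: "same_outside ?c2 s2 s3"
      moreover have "var s3 v_n = int n" "var s3 v_i = int i"
        using var_same_outside[OF same, of v_n] var_same_outside[OF same, of v_i] s2(1,4)
        by (simp_all add: wvars_count_letter tables_def)
      ultimately show "csafe inp K ?b2 s3 \<and> \<not> cval inp ?b2 s3 \<and> ?I i s3"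
        using s2(6) by (auto simp del: of_nat_mult mult_Suc)
    next
      have "(n - i) * 32 \<le> n * 32" by (intro mult_right_mono) simp_all
      then show "(n - i) * (csize ?b2 + 30) + csize ?b2 \<le> 32 * n + 2" by simp
    qed
  qed
  have loop: "runs inp K (While ?b ?c) (result inp (v_i ::= Plus (V v_n) (N 1)) s) (Suc n * (7 * m + 32 * n + 15) + 2) (ids (first E 0))"
  proof (rule runs_While[where I = ?I and m = "Suc n" and tb = "7 * m + 32 * n + 13"])
    show "?I (Suc n) (result inp (v_i ::= Plus (V v_n) (N 1)) s)" using s(1) by (simp add: tables_def)
    fix i s1 assume I: "?I (Suc i) s1" and same0: "same_outside ?c (result inp (v_i ::= Plus (V v_n) (N 1)) s) s1"
    have "same_outside ?c s s1" using same0 by (simp add: same_outside_def)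
    then have k1: "tables s1" "edges E s1" using keep by blast+
    have k1': "tables (set_var v_i (int i) s1)" "edges E (set_var v_i (int i) s1)"
      using k1 by (simp_all add: tables_def edges_def)
    have "runs inp K ?c s1 (7 * m + 32 * n + 13) (?I i)"
    proof (rule runs_block_Seq[where ?t2.0 = "7 * m + 32 * n + 10"])
      show "runs inp K (clear_counters ;; Update a_id (V v_i) (Arr a_mul (V v_i)) ;; v_p ::= V v_i ;; While ?b2 ?c2)
        (result inp (decr v_i) s1) (7 * m + 32 * n + 10) (?I i)"
      proof (rule runs_Seq[where ?t1.0 = "7 * m + 4" and ?t2.0 = "32 * n + 6"])
        show "runs inp K clear_counters (result inp (decr v_i) s1) (7 * m + 4) (counters E (\<lambda>_. 0))"
          using runs_clear_counters[OF k1'(1)] I by simp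
        fix s2 assume same2: "same_outside clear_counters (result inp (decr v_i) s1) s2" and c2: "counters E (\<lambda>_. 0) s2"
        have s2: "tables s2" "edges E s2" "var s2 v_i = int i" "arr s2 a_id = arr s1 a_id"
          using tables_same_outside[of _ _ s2, OF k1'(1)] edges_same_outside[of _ _ _ s2, OF k1'(2)] same2 I
            var_same_outside[OF same2, of v_i] arr_same_outside[OF same2, of a_id]
          by (simp_all add: wvars_clear warrs_clear)
        have i: "i \<le> n" using I by simp
        have "arr s2 a_mul i = int (Suc r * i)" using s2(1) i by (simp only: tables_def)
        then have res: "result inp (Update a_id (V v_i) (Arr a_mul (V v_i)) ;; v_p ::= V v_i) s2 =
            set_var v_p (int i) (set_arr a_id i (int (Suc r * i)) s2)" using s2(3) by simp
        have "first E i i = i" using first_props(1,3)[of i i E] by simp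
        moreover have "segment i i = (\<lambda>_. 0)" by (auto simp: segment_def)
        ultimately have "runs inp K (While ?b2 ?c2) (set_var v_p (int i) (set_arr a_id i (int (Suc r * i)) s2)) (32 * n + 2) (?I i)"
          using s2 c2 i I
          by (intro inner) (simp_all add: tables_def edges_def counters_def del: of_nat_mult mult_Suc)
        then have w: "runs inp K (While ?b2 ?c2) (result inp (v_p ::= V v_i) (result inp (Update a_id (V v_i) (Arr a_mul (V v_i))) s2)) (32 * n + 2) (?I i)"
          using res by (simp only: result.simps)
        show "runs inp K (Update a_id (V v_i) (Arr a_mul (V v_i)) ;; v_p ::= V v_i ;; While ?b2 ?c2) s2 (32 * n + 6) (?I i)"
          by (rule runs_block_Seq[OF _ _ runs_block_Seq[OF _ _ w order.refl]]) (use s2(3) in simp_all)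
      qed simp
    qed (use K_ge in simp_all)
    then show "csafe inp K ?b s1 \<and> cval inp ?b s1 \<and> runs inp K ?c s1 (7 * m + 32 * n + 13) (?I i)"
      using I by simp
  next
    fix s1 :: state assume "?I 0 s1"
    then show "csafe inp K ?b s1 \<and> \<not> cval inp ?b s1 \<and> ids (first E 0) s1"
      using first_props(3)[of 0 _ E] by (simp add: ids_def del: of_nat_mult mult_Suc)
  qed simp
  show ?thesis
    unfolding compare_prefixes_def
    by (rule runs_block_Seq[where ?t2.0 = "Suc n * (7 * m + 32 * n + 15) + 2"]) (use loop K_ge in simp_all)
qed

text \<open>The multiplicities that give the flow of the first \<open>a\<close> letters plus \<open>k\<close> times that of the letters from
position \<open>c\<close> on.\<close>

definition multiple :: "nat \<Rightarrow> nat \<Rightarrow> int \<Rightarrow> nat \<Rightarrow> int"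
  where "multiple a c k i = segment 0 a i + k * segment c n i"

text \<open>Invariant of the descending search: the exponents above \<open>l\<close> have been tried.\<close>

definition search_result :: "(nat \<Rightarrow> nat) \<Rightarrow> nat \<Rightarrow> nat \<Rightarrow> int \<Rightarrow> state \<Rightarrow> bool"
  where "search_result E a c l s \<longleftrightarrow>
    var s v_found = 0 \<and> (\<forall>k. l < k \<and> k \<le> int a \<longrightarrow> \<not> vanishes E (multiple a c k)) \<or>
    var s v_found = 1 \<and> vanishes E (multiple a c (var s v_exp))"

lemma wvars_count_segment: "wvars (count_segment f e x) = {v_p, v_nz}"
  and warrs_count_segment: "warrs (count_segment f e x) = {a_cnt}"
  by (auto simp: count_segment_def wvars_count_letter warrs_count_letter)

lemma runs_search_exponent:
  assumes s: "tables s" "edges E s" and ac: "var s v_a = int a" "a \<le> n" "var s v_c = int c" "c \<le> n"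
  shows "runs inp K search_exponent s (7 * m + 27 * n + 16 + n * (27 * n + 11) + (2 * n + 1) * (27 * n + 15))
    (search_result E a c (- int a - 1))"
proof -
  let ?seg = "\<lambda>f. count_segment f (V v_c) v_n"
  let ?c1 = "?seg Plus ;; incr v_k ;; v_t ::= Plus (V v_t) (N 2)" and ?b1 = "Less (V v_k) (V v_a)"
  let ?check = "If (Equal (V v_nz) (N 0)) (v_found ::= N 1 ;; v_exp ::= V v_k) Skip"
  let ?c2 = "?check ;; ?seg Minus ;; decr v_k ;; decr v_t" and ?b2 = "Less (N 0) (V v_t)"
  let ?pre = "\<lambda>s. tables s \<and> edges E s \<and> var s v_a = int a \<and> var s v_c = int c"
  note wv = wvars_clear warrs_clear wvars_count_letter warrs_count_letter wvars_count_segment warrs_count_segment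
  have pre: "?pre s2" if "same_outside com s1 s2" "?pre s1"
    "v_n \<notin> wvars com" "v_size \<notin> wvars com" "v_a \<notin> wvars com" "v_c \<notin> wvars com"
    "a_gen \<notin> warrs com" "a_sgn \<notin> warrs com" "a_mul \<notin> warrs com" "a_edge \<notin> warrs com" for com s1 s2
    using tables_same_outside[of s1 com s2] edges_same_outside[of E s1 com s2] that
    by (simp add: same_outside_def)
  have seg: "runs inp K (?seg f) s1 (27 * n + 3) (counters E (multiple a c (k + sign_of f)))"
    if "?pre s1" "counters E (multiple a c k) s1" "f = Plus \<or> f = Minus" for f k s1
  proof -
    have "(\<lambda>i. multiple a c k i + (if c \<le> i \<and> i < n then sign_of f * sgn_at i else 0)) = multiple a c (k + sign_of f)"
      by (auto simp: fun_eq_iff multiple_def segment_def algebra_simps)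
    with runs_count_segment[of s1 E "multiple a c k" f "V v_c" c v_n n "27 * n + 3"] that ac(4)
    show ?thesis by (simp add: tables_def)
  qed
  let ?I1 = "\<lambda>k s. \<exists>j. j + k = a \<and> var s v_k = int j \<and> var s v_t = 1 + 2 * int j \<and>
    counters E (multiple a c (int j)) s \<and> var s v_found = 0"
  let ?Q1 = "\<lambda>s. var s v_k = int a \<and> var s v_t = 1 + 2 * int a \<and> counters E (multiple a c (int a)) s \<and> var s v_found = 0"
  have loop1: "runs inp K (While ?b1 ?c1) s1 (n * (27 * n + 11) + 2) ?Q1"
    if s1: "?pre s1" "counters E (multiple a c 0) s1" "var s1 v_k = 0" "var s1 v_t = 1" "var s1 v_found = 0" for s1
  proof (rule runs_While[where I = ?I1 and m = a and tb = "27 * n + 9"])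
    show "?I1 a s1" using s1 by simp
    fix k s2 assume "?I1 (Suc k) s2" and same: "same_outside ?c1 s1 s2"
    then obtain j where j: "j + Suc k = a" "var s2 v_k = int j" "var s2 v_t = 1 + 2 * int j"
      "counters E (multiple a c (int j)) s2" "var s2 v_found = 0" by blast
    have p2: "?pre s2" by (rule pre[OF same s1(1)]) (simp_all add: wv)
    have "runs inp K ?c1 s2 (27 * n + 9) (?I1 k)"
    proof (rule runs_Seq[OF seg[OF p2 j(4)]])
      fix s3 assume "same_outside (?seg Plus) s2 s3" and c3: "counters E (multiple a c (int j + sign_of Plus)) s3"
      then have "var s3 v_k = int j" "var s3 v_t = 1 + 2 * int j" "var s3 v_found = 0"
        using j by (simp_all add: same_outside_def wv)
      then show "runs inp K (incr v_k ;; v_t ::= Plus (V v_t) (N 2)) s3 6 (?I1 k)"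
        using j(1) c3 K_ge
        by (intro runs_block) (auto intro!: exI[of _ "Suc j"] simp: sign_of_def counters_def add.commute)
    qed simp_all
    then show "csafe inp K ?b1 s2 \<and> cval inp ?b1 s2 \<and> runs inp K ?c1 s2 (27 * n + 9) (?I1 k)"
      using j p2 by simp
  next
    fix s2 assume "?I1 0 s2" and same: "same_outside ?c1 s1 s2"
    moreover have "?pre s2" by (rule pre[OF same s1(1)]) (simp_all add: wv)
    ultimately show "csafe inp K ?b1 s2 \<and> \<not> cval inp ?b1 s2 \<and> ?Q1 s2" by auto
  next
    have "a * (11 + 27 * n) \<le> n * (11 + 27 * n)" using ac(2) by (rule mult_right_mono) simp
    then show "a * (csize ?b1 + (27 * n + 9)) + csize ?b1 \<le> n * (27 * n + 11) + 2" by (simp add: add.commute)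
  qed
  let ?I2 = "\<lambda>k s. var s v_t = int k \<and> var s v_k = int k - int a - 1 \<and>
    counters E (multiple a c (int k - int a - 1)) s \<and> search_result E a c (int k - int a - 1) s"
  have loop2: "runs inp K (While ?b2 ?c2) s1 ((2 * n + 1) * (27 * n + 15) + 2) (search_result E a c (- int a - 1))"
    if s1: "?pre s1" "?Q1 s1" for s1
  proof (rule runs_While[where I = ?I2 and m = "2 * a + 1" and tb = "27 * n + 13"])
    show "?I2 (2 * a + 1) s1" using s1(2) by (auto simp: search_result_def)
    fix k s2 assume I: "?I2 (Suc k) s2" and same: "same_outside ?c2 s1 s2"
    let ?z = "int k - int a"
    have p2: "?pre s2" by (rule pre[OF same s1(1)]) (simp_all add: wv)
    have I': "var s2 v_t = int k + 1" "var s2 v_k = ?z" "counters E (multiple a c ?z) s2" "search_result E a c ?z s2"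
      using I by (simp_all add: algebra_simps)
    define s3 where "s3 = result inp ?check s2"
    have zero: "var s2 v_nz = 0 \<longleftrightarrow> vanishes E (multiple a c ?z)"
      using counters_zero[OF I'(3)] p2 by blast
    have p3: "?pre s3" "counters E (multiple a c ?z) s3" "var s3 v_t = int k + 1" "var s3 v_k = ?z"
      using p2 I' by (simp_all add: s3_def tables_def edges_def counters_def)
    have "search_result E a c (?z - 1) s3"
    proof (cases "vanishes E (multiple a c ?z)")
      case True
      then show ?thesis using I'(2) zero by (simp add: s3_def search_result_def)
    next
      case False
      then have "s3 = s2" using zero by (simp add: s3_def)
      moreover have "k' = ?z \<or> ?z < k'" if "?z - 1 < k'" for k' :: int using that by linarith
      ultimately show ?thesis using I'(4) False unfolding search_result_def by blast
    qed
    then have r3: "search_result E a c (?z - 1) s3" .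
    have rest: "runs inp K (?seg Minus ;; decr v_k ;; decr v_t) s3 (27 * n + 9) (?I2 k)"
    proof (rule runs_Seq[OF seg[OF p3(1,2)]])
      fix s4 assume same4: "same_outside (?seg Minus) s3 s4" and c4: "counters E (multiple a c (?z + sign_of Minus)) s4"
      then have "var s4 v_k = ?z" "var s4 v_t = int k + 1" "var s4 v_found = var s3 v_found" "var s4 v_exp = var s3 v_exp"
        using p3 by (simp_all add: same_outside_def wv)
      then show "runs inp K (decr v_k ;; decr v_t) s4 6 (?I2 k)"
        using c4 r3 K_ge
        by (intro runs_block) (auto simp: sign_of_Minus counters_def search_result_def)
    qed simp_all
    have "runs inp K ?c2 s2 (27 * n + 13) (?I2 k)"
      by (rule runs_block_Seq[OF _ _ rest[unfolded s3_def]]) (use K_ge in simp_all)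
    then show "csafe inp K ?b2 s2 \<and> cval inp ?b2 s2 \<and> runs inp K ?c2 s2 (27 * n + 13) (?I2 k)"
      using I'(1) by simp
  next
    fix s2 :: state assume "?I2 0 s2"
    then show "csafe inp K ?b2 s2 \<and> \<not> cval inp ?b2 s2 \<and> search_result E a c (- int a - 1) s2" by simp
  next
    have "(2 * a + 1) * (27 * n + 15) \<le> (2 * n + 1) * (27 * n + 15)" using ac(2) by (intro mult_right_mono) simp_all
    moreover have "csize ?b2 + (27 * n + 13) = 27 * n + 15" "csize ?b2 = 2" by simp_all
    ultimately show "(2 * a + 1) * (csize ?b2 + (27 * n + 13)) + csize ?b2 \<le> (2 * n + 1) * (27 * n + 15) + 2"
      by (simp only:)
  qed
  show ?thesis
    unfolding search_exponent_def
  proof (rule runs_block_Seq)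
    let ?s1 = "result inp (v_found ::= N 0) s"
    let ?t2 = "(2 * n + 1) * (27 * n + 15) + 2"
    let ?t1 = "n * (27 * n + 11) + 2 + ?t2"
    have p1: "?pre ?s1" "var ?s1 v_found = 0" using s ac by (simp_all add: tables_def edges_def)
    show "runs inp K (clear_counters ;; count_segment Plus (N 0) v_a ;; v_k ::= N 0 ;; v_t ::= N 1 ;;
        While ?b1 ?c1 ;; While ?b2 ?c2) ?s1 (7 * m + 4 + (27 * n + 3 + (1 + (1 + ?t1)))) (search_result E a c (- int a - 1))"
    proof (rule runs_Seq[OF runs_clear_counters])
      show "tables ?s1" using p1 by simp
      fix s2 assume same2: "same_outside clear_counters ?s1 s2" and c2: "counters E (\<lambda>_. 0) s2"
      have p2: "?pre s2" by (rule pre[OF same2 p1(1)]) (simp_all add: wv)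
      have f2: "var s2 v_found = 0" using same2 p1(2) by (simp add: same_outside_def wv)
      show "runs inp K (count_segment Plus (N 0) v_a ;; v_k ::= N 0 ;; v_t ::= N 1 ;; While ?b1 ?c1 ;; While ?b2 ?c2)
          s2 (27 * n + 3 + (1 + (1 + ?t1))) (search_result E a c (- int a - 1))"
      proof (rule runs_Seq[OF runs_count_segment[where ?h = "\<lambda>_. 0" and ?p0.0 = 0 and ?q0.0 = a and t = "27 * n + 3"]])
        fix s3 assume same3: "same_outside (count_segment Plus (N 0) v_a) s2 s3"
          and c3: "counters E (\<lambda>i. 0 + (if 0 \<le> i \<and> i < a then sign_of Plus * sgn_at i else 0)) s3"
        have p3: "?pre s3" by (rule pre[OF same3 p2]) (simp_all add: wv)
        have f3: "var s3 v_found = 0" using same3 f2 by (simp add: same_outside_def wv)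
        have "(\<lambda>i. 0 + (if 0 \<le> i \<and> i < a then sign_of Plus * sgn_at i else 0)) = multiple a c 0"
          by (auto simp: fun_eq_iff multiple_def segment_def sign_of_def)
        with c3 have c3: "counters E (multiple a c 0) s3" by simp
        let ?s4 = "result inp (v_t ::= N 1) (result inp (v_k ::= N 0) s3)"
        have s4: "?pre ?s4" "counters E (multiple a c 0) ?s4" "var ?s4 v_k = 0" "var ?s4 v_t = 1" "var ?s4 v_found = 0"
          using p3 f3 c3 by (simp_all add: tables_def edges_def counters_def)
        have run4: "runs inp K (While ?b1 ?c1 ;; While ?b2 ?c2) ?s4 ?t1 (search_result E a c (- int a - 1))"
        proof (rule runs_Seq[OF loop1[OF s4] loop2])
          fix s5 assume same5: "same_outside (While ?b1 ?c1) ?s4 s5" and "?Q1 s5"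
          then show "?Q1 s5" by blast
          show "?pre s5" by (rule pre[OF same5 s4(1)]) (simp_all add: wv)
        qed simp
        show "runs inp K (v_k ::= N 0 ;; v_t ::= N 1 ;; While ?b1 ?c1 ;; While ?b2 ?c2) s3 (1 + (1 + ?t1))
            (search_result E a c (- int a - 1))"
          by (rule runs_block_Seq[OF _ _ runs_block_Seq[OF _ _ run4 order.refl]]) (use K_ge in simp_all)
      qed (use p2 c2 ac in simp_all)
    qed simp
  qed (simp_all add: algebra_simps)
qed

end

section \<open>The classes of the prefixes\<close>

lemma word_class_eq_iff:
  assumes "u \<in> lists (letters {1..r})" "v \<in> lists (letters {1..r})"
  shows "word_class r d u = word_class r d v \<longleftrightarrow>
    reduce u \<otimes>\<^bsub>FG r\<^esub> inv\<^bsub>FG r\<^esub> reduce v \<in> derived_term (FG r) d"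
proof -
  interpret group "FG r" by (rule group_free_group)
  show ?thesis
    unfolding word_class_def
    by (rule rcoset_eq_iff[OF normal_imp_subgroup[OF derived_term_normal]
          reduce_in_free_group[OF assms(1)] reduce_in_free_group[OF assms(2)]])
qed

lemma word_class_antimono:
  assumes "u \<in> lists (letters {1..r})" "v \<in> lists (letters {1..r})"
    and "word_class r d u = word_class r d v" "i \<le> d"
  shows "word_class r i u = word_class r i v"
  using assms(3) derived_term_antimono[OF assms(4)]
  unfolding word_class_eq_iff[OF assms(1,2)] by (rule rev_subsetD)

lemma word_class_0:
  assumes "u \<in> lists (letters {1..r})" "v \<in> lists (letters {1..r})"
  shows "word_class r 0 u = word_class r 0 v"
proof -
  interpret group "FG r" by (rule group_free_group)
  have "reduce u \<otimes>\<^bsub>FG r\<^esub> inv\<^bsub>FG r\<^esub> reduce v \<in> carrier (FG r)"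
    by (rule m_closed[OF reduce_in_free_group[OF assms(1)] inv_closed[OF reduce_in_free_group[OF assms(2)]]])
  then show ?thesis
    unfolding word_class_eq_iff[OF assms] by (simp only: derived_term_def funpow_0)
qed

lemma flow_abs_le: "\<bar>flow c w e\<bar> \<le> int (length w)"
proof (induction w rule: rev_induct)
  case (snoc a w)
  have "\<bar>letter_flow c w a e\<bar> \<le> 1" by (simp add: letter_flow_def)
  with snoc show ?case by simp
qed simp

context word_setup
begin

definition cls :: "nat \<Rightarrow> nat \<Rightarrow> nat word set"
  where "cls j p = word_class r j (take p W)"

text \<open>The edge at position \<open>p\<close> in the Cayley graph at level \<open>j\<close>; \<open>edge_code\<close> numbers these edges.\<close>

definition edge :: "nat \<Rightarrow> nat \<Rightarrow> nat word set \<times> nat"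
  where "edge j p = (cls j (if snd (W ! p) then p else Suc p), fst (W ! p))"

lemma take_words: "take p W \<in> lists (letters {1..r})"
  using W by (auto dest: in_set_takeD)

lemma flow_take:
  assumes "q \<le> n"
  shows "level_flow r j (take q W) e = total (edge j) (segment 0 q) e"
proof -
  have "level_flow r j (take q W) e =
      (\<Sum>p<q. letter_flow (word_class r j) (take p W) (W ! p) e)"
    using assms by (simp add: level_flow_def flow_def min_def)
  also have "\<dots> = (\<Sum>p<q. if edge j p = e then sgn_at p else 0)"
  proof (rule sum.cong)
    fix p assume "p \<in> {..<q}"
    then have "take (Suc p) W = take p W @ [W ! p]" using assms by (simp add: take_Suc_conv_app_nth)
    then show "letter_flow (word_class r j) (take p W) (W ! p) e = (if edge j p = e then sgn_at p else 0)"
      by (auto simp: letter_flow_def edge_def cls_def sgn_at_def)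
  qed simp
  also have "\<dots> = total (edge j) (segment 0 q) e"
    unfolding total_def using assms
    by (intro sum.mono_neutral_cong_left) (auto simp: segment_def)
  finally show ?thesis .
qed

lemma total_segment:
  assumes "p \<le> q" "q \<le> n"
  shows "total (edge j) (segment p q) e = level_flow r j (take q W) e - level_flow r j (take p W) e"
proof -
  have "total (edge j) (segment 0 q) e = total (edge j) (segment 0 p) e + total (edge j) (segment p q) e"
    unfolding total_def sum.distrib[symmetric]
    by (rule sum.cong) (use assms in \<open>auto simp: segment_def\<close>)
  then show ?thesis using assms by (simp add: flow_take)
qed

text \<open>The induction on the level: edges are named by classes at level \<open>j\<close>, and the resulting flows decide
equality at level \<open>Suc j\<close>.\<close>

lemma vanishes_segment:
  assumes "p \<le> q" "q \<le> n"
  shows "vanishes (edge j) (segment p q) \<longleftrightarrow> cls (Suc j) p = cls (Suc j) q"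
proof -
  interpret L: solvable_level r j .
  have "vanishes (edge j) (segment p q) \<longleftrightarrow> level_flow r j (take p W) = level_flow r j (take q W)"
    using total_segment[OF assms] by (auto simp: vanishes_def fun_eq_iff)
  then show ?thesis using L.word_class_Suc_iff[OF take_words take_words] by (simp add: cls_def)
qed

lemma vanishes_iff: "vanishes E h \<longleftrightarrow> (\<forall>p<n. total E h (E p) = 0)"
proof
  assume *: "\<forall>p<n. total E h (E p) = 0"
  show "vanishes E h"
    unfolding vanishes_def
  proof
    fix e
    show "total E h e = 0"
    proof (cases "\<exists>p<n. E p = e")
      case False
      then show ?thesis unfolding total_def by (intro sum.neutral) auto
    qed (use * in auto)
  qed
qed (simp add: vanishes_def)

text \<open>Only the coincidences between the edges of the path matter, not what an edge is; the numbers in the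
machine may replace the edges of the Cayley graph.\<close>

lemma vanishes_cong:
  assumes "\<And>p q. p < n \<Longrightarrow> q < n \<Longrightarrow> E p = E q \<longleftrightarrow> E' p = E' q"
  shows "vanishes E h \<longleftrightarrow> vanishes E' h"
proof -
  have "total E h (E p) = total E' h (E' p)" if "p < n" for p
    unfolding total_def
  proof (rule sum.cong)
    fix q assume "q \<in> {..<n}"
    then show "(if E q = E p then h q else 0) = (if E' q = E' p then h q else 0)"
      using assms[of q p] that by simp
  qed simp
  then show ?thesis unfolding vanishes_iff by simp
qed

definition represents :: "nat \<Rightarrow> (nat \<Rightarrow> nat) \<Rightarrow> bool"
  where "represents j idx \<longleftrightarrow> (\<forall>p\<le>n. idx p \<le> p) \<and> (\<forall>p\<le>n. \<forall>q\<le>n. idx p = idx q \<longleftrightarrow> cls j p = cls j q)"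

lemma edge_code_eq_iff:
  assumes "represents j idx" "p < n" "q < n"
  shows "edge_code idx p = edge_code idx q \<longleftrightarrow> edge j p = edge j q"
proof -
  have split: "Suc r * i + x = Suc r * i' + x' \<longleftrightarrow> i = i' \<and> x = x'" if "x \<le> r" "x' \<le> r" for i x i' x'
  proof
    assume eq: "Suc r * i + x = Suc r * i' + x'"
    have "i = (Suc r * i + x) div Suc r" using that by (simp del: mult_Suc)
    also have "\<dots> = i'" unfolding eq using that by (simp del: mult_Suc)
    finally show "i = i' \<and> x = x'" using eq by simp
  qed simp
  have "(if snd (W ! x) then x else Suc x) \<le> n" if "x < n" for x using that by simp
  with assms generator[OF assms(2)] generator[OF assms(3)] show ?thesis
    unfolding edge_code_def edge_def represents_def by (simp only: split prod.inject)
qed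

lemma vanishes_edge_code:
  assumes "represents j idx"
  shows "vanishes (edge_code idx) h \<longleftrightarrow> vanishes (edge j) h"
  by (rule vanishes_cong) (rule edge_code_eq_iff[OF assms])

lemma represents_first:
  assumes "represents j idx"
  shows "represents (Suc j) (first (edge_code idx) 0)"
proof -
  let ?f = "first (edge_code idx) 0"
  have v: "vanishes (edge_code idx) (segment i p) \<longleftrightarrow> cls (Suc j) i = cls (Suc j) p" if "i \<le> p" "p \<le> n" for i p
    unfolding vanishes_edge_code[OF assms] by (rule vanishes_segment[OF that])
  have f: "?f p \<le> p" "cls (Suc j) (?f p) = cls (Suc j) p" if "p \<le> n" for p
  proof -
    show le: "?f p \<le> p" by (rule first_props(3)) simp
    have "vanishes (edge_code idx) (segment (?f p) p)" by (rule first_props(2)) simp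
    then show "cls (Suc j) (?f p) = cls (Suc j) p" unfolding v[OF le that] .
  qed
  have least: "?f p \<le> i" if "i \<le> p" "p \<le> n" "cls (Suc j) i = cls (Suc j) p" for i p
    unfolding first_def
  proof (rule Least_le)
    show "0 \<le> i \<and> vanishes (edge_code idx) (segment i p)" unfolding v[OF that(1,2)] using that(3) by simp
  qed
  have eqI: "?f p = ?f q" if "p \<le> q" "q \<le> n" "cls (Suc j) p = cls (Suc j) q" for p q
  proof (rule order.antisym)
    have p: "p \<le> n" using that(1,2) by simp
    have "cls (Suc j) (?f p) = cls (Suc j) q" unfolding f(2)[OF p] by (rule that(3))
    then show qp: "?f q \<le> ?f p" by (rule least[OF order.trans[OF f(1)[OF p] that(1)] that(2)])
    have "cls (Suc j) (?f q) = cls (Suc j) p" unfolding f(2)[OF that(2)] by (rule that(3)[symmetric])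
    then show "?f p \<le> ?f q" by (rule least[OF order.trans[OF qp f(1)[OF p]] p])
  qed
  show ?thesis
    unfolding represents_def
  proof (intro conjI allI impI iffI)
    fix p q assume pq: "p \<le> n" "q \<le> n" and c: "cls (Suc j) p = cls (Suc j) q"
    show "?f p = ?f q"
    proof (cases "p \<le> q")
      case True
      then show ?thesis using eqI pq(2) c by blast
    next
      case False
      then have "?f q = ?f p" using eqI[of q p] pq(1) c by simp
      then show ?thesis ..
    qed
  next
    fix p q assume pq: "p \<le> n" "q \<le> n" and eq: "?f p = ?f q"
    show "cls (Suc j) p = cls (Suc j) q" using f(2)[OF pq(1)] f(2)[OF pq(2)] unfolding eq by simp
  next
    fix p assume "p \<le> n"
    then show "?f p \<le> p" by (rule f(1))
  qed
qed

lemma represents_0: "represents 0 (\<lambda>_. 0)"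
  using word_class_0[OF take_words take_words] by (simp add: represents_def cls_def)

text \<open>The prefix \<open>c\<close> will be \<open>u v u\<^sup>-\<^sup>1\<close>, which represents \<open>v\<close> if \<open>u\<close> and \<open>v\<close> commute.\<close>

definition last_trivial :: "nat \<Rightarrow> nat \<Rightarrow> nat \<Rightarrow> bool"
  where "last_trivial c j i \<longleftrightarrow> i < j \<and> cls i c = cls i 0 \<and> (\<forall>i'. i < i' \<and> i' < j \<longrightarrow> cls i' c \<noteq> cls i' 0)"

text \<open>What the search at level \<open>i\<close> leaves behind, expressed by edges of the Cayley graph instead of their
numbers.\<close>

definition exponent_found :: "nat \<Rightarrow> nat \<Rightarrow> nat \<Rightarrow> state \<Rightarrow> bool"
  where "exponent_found a c i s \<longleftrightarrow>
    var s v_found = 0 \<and> (\<forall>k. - int a \<le> k \<and> k \<le> int a \<longrightarrow> \<not> vanishes (edge i) (multiple a c k)) \<or>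
    var s v_found = 1 \<and> vanishes (edge i) (multiple a c (var s v_exp))"

definition level_state :: "nat \<Rightarrow> nat \<Rightarrow> nat \<Rightarrow> state \<Rightarrow> bool"
  where "level_state a c j s \<longleftrightarrow> tables s \<and> var s v_a = int a \<and> var s v_c = int c \<and>
    (\<exists>idx. represents j idx \<and> ids idx s) \<and>
    (\<forall>i. last_trivial c j i \<longrightarrow> exponent_found a c i s) \<and>
    (j = 0 \<longrightarrow> var s v_found = 1 \<and> var s v_exp = 0)"

lemma ids_zero_iff:
  assumes "represents j idx" "ids idx s" "p \<le> n"
  shows "arr s a_id p = 0 \<longleftrightarrow> cls j p = cls j 0"
proof -
  have "arr s a_id p = 0 \<longleftrightarrow> idx p = 0" using assms(2,3) by (simp add: ids_def del: of_nat_mult mult_Suc)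
  also have "\<dots> \<longleftrightarrow> idx p = idx 0"
  proof -
    have "idx 0 \<le> 0" using assms(1) unfolding represents_def by blast
    then show ?thesis by simp
  qed
  also have "\<dots> \<longleftrightarrow> cls j p = cls j 0" using assms(1,3) unfolding represents_def by blast
  finally show ?thesis .
qed

definition level_time :: nat
  where "level_time = (16 * n + 3) + (3 + (7 * m + 27 * n + 16 + n * (27 * n + 11) + (2 * n + 1) * (27 * n + 15))) +
    (Suc n * (7 * m + 32 * n + 15) + 5) + 3"

lemma warrs_compare: "warrs compare_prefixes = {a_cnt, a_id}"
  and wvars_compare: "wvars compare_prefixes = {v_i, v_x, v_nz, v_p}"
  by (auto simp: compare_prefixes_def wvars_clear warrs_clear wvars_count_letter warrs_count_letter)

lemma warrs_search: "warrs search_exponent = {a_cnt}"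
  and wvars_search: "wvars search_exponent = {v_found, v_exp, v_k, v_t, v_x, v_nz, v_p}"
  by (auto simp: search_exponent_def wvars_clear warrs_clear wvars_count_segment warrs_count_segment)

lemma warrs_compute_edges: "warrs compute_edges = {a_edge}"
  and wvars_compute_edges: "wvars compute_edges = {v_p}"
  by (auto simp: compute_edges_def)

lemma runs_level:
  assumes s: "level_state a c j s" and ac: "a \<le> n" "c \<le> n"
  shows "runs inp K (compute_edges ;; If (Equal (Arr a_id (V v_c)) (N 0)) search_exponent Skip ;;
      compare_prefixes ;; decr v_lev) s level_time
    (\<lambda>s'. level_state a c (Suc j) s' \<and> var s' v_lev = var s v_lev - 1)"
proof -
  obtain idx where idx: "represents j idx" "ids idx s" and t: "tables s" "var s v_a = int a" "var s v_c = int c"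
    and old: "\<And>i. last_trivial c j i \<Longrightarrow> exponent_found a c i s"
    using s unfolding level_state_def by blast
  let ?E = "edge_code idx"
  let ?t3 = "3 + (7 * m + 27 * n + 16 + n * (27 * n + 11) + (2 * n + 1) * (27 * n + 15))"
  let ?t4 = "Suc n * (7 * m + 32 * n + 15) + 5"
  let ?if = "If (Equal (Arr a_id (V v_c)) (N 0)) search_exponent Skip"
  let ?pre = "\<lambda>s1. tables s1 \<and> edges ?E s1 \<and> var s1 v_a = int a \<and> var s1 v_c = int c \<and> var s1 v_lev = var s v_lev"
  let ?new = "\<lambda>s1. \<forall>i. last_trivial c (Suc j) i \<longrightarrow> exponent_found a c i s1"
  show ?thesis
  proof (rule runs_Seq[OF runs_compute_edges[OF t(1) idx(2)], where ?t2.0 = "?t3 + (?t4 + 3)"])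
    fix s1 assume same1: "same_outside compute_edges s s1" and e1: "edges ?E s1"
    have p1: "?pre s1" and keep1: "arr s1 a_id = arr s a_id" "var s1 v_found = var s v_found" "var s1 v_exp = var s v_exp"
      using tables_same_outside[OF t(1) same1] same1 t e1
      by (simp_all add: same_outside_def wvars_compute_edges warrs_compute_edges)
    have ids1: "ids idx s1" using idx(2) keep1 by (simp add: ids_def)
    show "runs inp K (?if ;; compare_prefixes ;; decr v_lev) s1 (?t3 + (?t4 + 3))
        (\<lambda>s'. level_state a c (Suc j) s' \<and> var s' v_lev = var s v_lev - 1)"
    proof (rule runs_Seq[where ?t1.0 = ?t3 and ?t2.0 = "?t4 + 3" and Q' = "\<lambda>s2. ?pre s2 \<and> ?new s2"])
      have ltj: "i \<le> j" if "last_trivial c (Suc j) i" for i using that by (simp add: last_trivial_def)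
      have c0: "aval inp (Arr a_id (V v_c)) s1 = 0 \<longleftrightarrow> cls j c = cls j 0"
        using ids_zero_iff[OF idx(1) ids1 ac(2)] p1 by simp
      show "runs inp K ?if s1 ?t3 (\<lambda>s2. ?pre s2 \<and> ?new s2)"
      proof (rule runs_If)
        assume "cval inp (Equal (Arr a_id (V v_c)) (N 0)) s1"
        then have triv: "cls j c = cls j 0" using c0 by simp
        have only: "i = j" if "last_trivial c (Suc j) i" for i
          using that triv ltj[OF that] by (auto simp: last_trivial_def less_Suc_eq)
        have "runs inp K search_exponent s1 (7 * m + 27 * n + 16 + n * (27 * n + 11) + (2 * n + 1) * (27 * n + 15))
            (search_result ?E a c (- int a - 1))"
          by (rule runs_search_exponent) (use p1 ac in simp_all)
        then show "runs inp K search_exponent s1 (7 * m + 27 * n + 16 + n * (27 * n + 11) + (2 * n + 1) * (27 * n + 15))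
            (\<lambda>s2. ?pre s2 \<and> ?new s2)"
        proof (rule runs_mono[OF _ order.refl])
          fix s2 assume same2: "same_outside search_exponent s1 s2" and res: "search_result ?E a c (- int a - 1) s2"
          have "?pre s2"
            using tables_same_outside[of s1 _ s2] edges_same_outside[of ?E s1 _ s2] p1 same2 same2[unfolded same_outside_def]
            by (simp add: wvars_search warrs_search)
          moreover have "exponent_found a c j s2"
          proof -
            have "- int a - 1 < k \<longleftrightarrow> - int a \<le> k" for k by linarith
            then show ?thesis
              using res unfolding search_result_def exponent_found_def vanishes_edge_code[OF idx(1)] by blast
          qed
          ultimately show "?pre s2 \<and> ?new s2" using only by blast
        qed
      next
        assume "\<not> cval inp (Equal (Arr a_id (V v_c)) (N 0)) s1"
        then have "cls j c \<noteq> cls j 0" using c0 by simp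
        then have "last_trivial c j i" if "last_trivial c (Suc j) i" for i
          using that by (auto simp: last_trivial_def less_Suc_eq)
        then have "?new s1" using old keep1 by (simp add: exponent_found_def)
        then show "runs inp K Skip s1 (7 * m + 27 * n + 16 + n * (27 * n + 11) + (2 * n + 1) * (27 * n + 15))
            (\<lambda>s2. ?pre s2 \<and> ?new s2)"
          using p1 by (intro runs_block) simp_all
      qed (use p1 in simp_all)
      fix s2 assume p2: "?pre s2 \<and> ?new s2"
      show "runs inp K (compare_prefixes ;; decr v_lev) s2 (?t4 + 3)
          (\<lambda>s'. level_state a c (Suc j) s' \<and> var s' v_lev = var s v_lev - 1)"
      proof (rule runs_Seq[OF runs_compare_prefixes[of s2 ?E]])
        fix s3 assume same3: "same_outside compare_prefixes s2 s3" and i3: "ids (first ?E 0) s3"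
        have k3: "tables s3" "var s3 v_a = int a" "var s3 v_c = int c" "var s3 v_lev = var s v_lev"
          "var s3 v_found = var s2 v_found" "var s3 v_exp = var s2 v_exp"
          using tables_same_outside[of s2 _ s3] p2 same3 same3[unfolded same_outside_def]
          by (simp_all add: wvars_compare warrs_compare)
        let ?s4 = "result inp (decr v_lev) s3"
        have "ids (first ?E 0) ?s4" "tables ?s4" using i3 k3(1) by (simp_all add: ids_def tables_def)
        moreover have "?new ?s4" using p2 k3 by (simp add: exponent_found_def)
        ultimately have "level_state a c (Suc j) ?s4"
          using represents_first[OF idx(1)] k3(2,3) unfolding level_state_def by auto
        then show "runs inp K (decr v_lev) s3 3 (\<lambda>s'. level_state a c (Suc j) s' \<and> var s' v_lev = var s v_lev - 1)"
          using k3(4) K_ge by (intro runs_block) simp_all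
      qed (use p2 in simp_all)
    qed simp
  qed (simp add: level_time_def)
qed

lemma runs_levels:
  assumes s: "tables s" "var s v_a = int a" "var s v_c = int c" "ids (\<lambda>_. 0) s" and ac: "a \<le> n" "c \<le> n"
    and d: "d \<le> K"
  shows "runs inp K (levels d) s (d * (level_time + 2) + 11)
    (\<lambda>s'. if cls d n = cls d 0
      then (\<forall>i. last_trivial c d i \<longrightarrow> exponent_found a c i s') \<and> (d = 0 \<longrightarrow> var s' v_found = 1 \<and> var s' v_exp = 0)
      else var s' v_found = 0)"
    (is "runs _ _ _ _ _ ?Q")
proof -
  let ?c = "compute_edges ;; If (Equal (Arr a_id (V v_c)) (N 0)) search_exponent Skip ;; compare_prefixes ;; decr v_lev"
  let ?b = "Less (N 0) (V v_lev)"
  let ?I = "\<lambda>k s. \<exists>j. j + k = d \<and> level_state a c j s \<and> var s v_lev = int k"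
  let ?s1 = "result inp (v_lev ::= N (int d)) (result inp (v_exp ::= N 0) (result inp (v_found ::= N 1) s))"
  let ?if = "If (Equal (Arr a_id (V v_n)) (N 0)) Skip (v_found ::= N 0)"
  have "level_state a c 0 ?s1"
    using s represents_0 unfolding level_state_def
    by (auto simp: tables_def ids_def last_trivial_def intro!: exI[of _ "\<lambda>_. 0"])
  then have I: "?I d ?s1" by simp
  have loop: "runs inp K (While ?b ?c) ?s1 (d * (level_time + 2) + 2) (level_state a c d)"
  proof (rule runs_While[where I = ?I and m = d and tb = level_time])
    show "?I d ?s1" by (rule I)
    fix k s2 assume "?I (Suc k) s2"
    then obtain j where j: "j + Suc k = d" "level_state a c j s2" "var s2 v_lev = int (Suc k)" by blast
    have "runs inp K ?c s2 level_time (?I k)"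
      by (rule runs_mono[OF runs_level[OF j(2) ac] order.refl]) (use j in \<open>auto intro!: exI[of _ "Suc j"]\<close>)
    then show "csafe inp K ?b s2 \<and> cval inp ?b s2 \<and> runs inp K ?c s2 level_time (?I k)" using j by simp
  qed auto
  have fin: "runs inp K ?if s2 5 ?Q" if s2: "level_state a c d s2" for s2
  proof -
    obtain idx where idx: "represents d idx" "ids idx s2" and t: "tables s2"
      and res: "\<forall>i. last_trivial c d i \<longrightarrow> exponent_found a c i s2" "d = 0 \<longrightarrow> var s2 v_found = 1 \<and> var s2 v_exp = 0"
      using s2 unfolding level_state_def by blast
    have "var s2 v_n = int n" using t by (simp add: tables_def)
    moreover have "arr s2 a_id n = 0 \<longleftrightarrow> cls d n = cls d 0" by (rule ids_zero_iff[OF idx order.refl])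
    ultimately show ?thesis using res by (intro runs_block) (auto simp: exponent_found_def)
  qed
  have l2: "runs inp K (While ?b ?c ;; ?if) ?s1 (d * (level_time + 2) + 7) ?Q"
    by (rule runs_Seq[OF loop fin]) simp_all
  show ?thesis
    unfolding levels_def
    by (rule runs_block_Seq[OF _ _ runs_block_Seq[OF _ _ runs_block_Seq[OF _ _ l2 order.refl] order.refl]])
      (use d K_ge in simp_all)
qed

end

section \<open>Correctness of the answer\<close>

lemma commutator_facts:
  fixes u v :: "nat word"
  assumes u: "u \<in> lists (letters {1..r})" and v: "v \<in> lists (letters {1..r})"
  defines "W \<equiv> u @ v @ inv_word u @ inv_word v"
  shows "word_class r d W = word_class r d [] \<longleftrightarrow> word_class r d (u @ v) = word_class r d (v @ u)"
    and "word_class r d (u @ v) = word_class r d (v @ u) \<Longrightarrow> word_class r d (u @ v @ inv_word u) = word_class r d v"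
proof -
  interpret L: solvable_level r d .
  let ?S = "free_solvable_group r d"
  let ?x = "L.vertex u" and ?y = "L.vertex v"
  have c: "?x \<in> carrier ?S" "?y \<in> carrier ?S" using u v L.vertex_closed by blast+
  have iu: "inv_word u \<in> L.words" and iv: "inv_word v \<in> L.words" using u v inv_word_in_lists by blast+
  have app: "xs \<in> L.words \<Longrightarrow> ys \<in> L.words \<Longrightarrow> xs @ ys \<in> L.words" for xs ys :: "nat word" by simp
  note cl = c L.H.inv_closed[OF c(1)] L.H.inv_closed[OF c(2)] L.H.m_closed[OF c] L.H.m_closed[OF c(2,1)]
  have W: "L.vertex W = ?x \<otimes>\<^bsub>?S\<^esub> (?y \<otimes>\<^bsub>?S\<^esub> (inv\<^bsub>?S\<^esub> ?x \<otimes>\<^bsub>?S\<^esub> inv\<^bsub>?S\<^esub> ?y))"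
    unfolding W_def
    by (simp only: L.vertex_append[OF u app[OF v app[OF iu iv]]] L.vertex_append[OF v app[OF iu iv]]
        L.vertex_append[OF iu iv] L.vertex_inv_word[OF u] L.vertex_inv_word[OF v])
  have U: "L.vertex (u @ v @ inv_word u) = ?x \<otimes>\<^bsub>?S\<^esub> (?y \<otimes>\<^bsub>?S\<^esub> inv\<^bsub>?S\<^esub> ?x)"
    by (simp only: L.vertex_append[OF u app[OF v iu]] L.vertex_append[OF v iu] L.vertex_inv_word[OF u])
  note uv = L.vertex_append[OF u v] L.vertex_append[OF v u]
  have "L.vertex W = (?x \<otimes>\<^bsub>?S\<^esub> ?y) \<otimes>\<^bsub>?S\<^esub> inv\<^bsub>?S\<^esub> (?y \<otimes>\<^bsub>?S\<^esub> ?x)"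
    unfolding W L.H.inv_mult_group[OF c(2,1)]
    by (simp only: L.H.m_assoc cl L.H.m_closed)
  moreover have "\<one>\<^bsub>?S\<^esub> = (?x \<otimes>\<^bsub>?S\<^esub> ?y) \<otimes>\<^bsub>?S\<^esub> inv\<^bsub>?S\<^esub> (?y \<otimes>\<^bsub>?S\<^esub> ?x) \<longleftrightarrow>
      ?x \<otimes>\<^bsub>?S\<^esub> ?y = \<one>\<^bsub>?S\<^esub> \<otimes>\<^bsub>?S\<^esub> (?y \<otimes>\<^bsub>?S\<^esub> ?x)"
    by (rule L.H.inv_solve_right[OF L.H.one_closed cl(5,6)])
  ultimately have "L.vertex W = \<one>\<^bsub>?S\<^esub> \<longleftrightarrow> L.vertex (u @ v) = L.vertex (v @ u)"
    unfolding uv L.H.l_one[OF cl(6)] by auto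
  then show "word_class r d W = word_class r d [] \<longleftrightarrow> word_class r d (u @ v) = word_class r d (v @ u)"
    using L.vertex_Nil by (simp only: L.vertex_eq)
  assume "word_class r d (u @ v) = word_class r d (v @ u)"
  then have comm: "?x \<otimes>\<^bsub>?S\<^esub> ?y = ?y \<otimes>\<^bsub>?S\<^esub> ?x" using uv by (simp only: L.vertex_eq)
  have "?x \<otimes>\<^bsub>?S\<^esub> (?y \<otimes>\<^bsub>?S\<^esub> inv\<^bsub>?S\<^esub> ?x) = ?x \<otimes>\<^bsub>?S\<^esub> ?y \<otimes>\<^bsub>?S\<^esub> inv\<^bsub>?S\<^esub> ?x"
    by (rule L.H.m_assoc[OF cl(1,2,3), symmetric])
  also have "\<dots> = ?y"
    unfolding comm L.H.m_assoc[OF cl(2,1,3)] L.H.r_inv[OF cl(1)] by (rule L.H.r_one[OF cl(2)])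
  finally show "word_class r d (u @ v @ inv_word u) = word_class r d v"
    using U by (simp only: L.vertex_eq)
qed

lemma power_commutes:
  assumes u: "u \<in> lists (letters {1..r})" and v: "v \<in> lists (letters {1..r})"
    and eq: "word_class r d u = word_class r d v [^]\<^bsub>free_solvable_group r d\<^esub> (k::int)"
  shows "word_class r d (u @ v) = word_class r d (v @ u)"
proof -
  interpret L: solvable_level r d .
  have c: "L.vertex v \<in> carrier (free_solvable_group r d)" using v by (rule L.vertex_closed)
  show ?thesis
    using L.vertex_append[OF u v] L.vertex_append[OF v u] eq
      L.H.int_pow_mult[OF c, of k 1] L.H.int_pow_mult[OF c, of 1 k] L.H.int_pow_1[OF c]
    by (simp only: L.vertex_eq add.commute[of k 1])
qed

locale power_instance =
  fixes inp :: "int list" and K r :: nat and u v :: "nat word"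
  assumes u: "u \<in> lists (letters {1..r})" and v: "v \<in> lists (letters {1..r})" and K2: "r + 2 \<le> K"

sublocale power_instance \<subseteq> word_setup inp K r "u @ v @ inv_word u @ inv_word v"
proof
  have app: "xs \<in> lists (letters {1..r}) \<Longrightarrow> ys \<in> lists (letters {1..r}) \<Longrightarrow> xs @ ys \<in> lists (letters {1..r})"
    for xs ys :: "nat word" by simp
  show "u @ v @ inv_word u @ inv_word v \<in> lists (letters {1..r})"
    using u v by (intro app) (simp_all only: inv_word_in_lists)
qed (rule K2)

context power_instance
begin

abbreviation "a \<equiv> length u"
abbreviation "c \<equiv> 2 * length u + length v"

lemma cls_positions:
  "cls j 0 = word_class r j []" "cls j c = word_class r j (u @ v @ inv_word u)"
  "cls j n = word_class r j (u @ v @ inv_word u @ inv_word v)"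
  by (simp_all add: cls_def)

text \<open>If \<open>u\<close> and \<open>v\<close> commute, the prefix \<open>u v u\<^sup>-\<^sup>1\<close> ends at the vertex of \<open>v\<close>, and the final \<open>v\<^sup>-\<^sup>1\<close> retraces
the path of \<open>v\<close> from there to the identity.  The flow of this last piece is thus minus the flow of \<open>v\<close>
at the identity, which turns the sum of the counters into a difference.\<close>

lemma vanishes_multiple:
  assumes "word_class r d (u @ v) = word_class r d (v @ u)" "i < d"
  shows "vanishes (edge i) (multiple a c k) \<longleftrightarrow> (\<forall>e. level_flow r i u e = k * level_flow r i v e)"
proof -
  interpret L: solvable_level r i .
  let ?W = "u @ v @ inv_word u @ inv_word v"
  have nil: "[] \<in> lists (letters {1..r})" by simp
  have W: "?W \<in> lists (letters {1..r})" by (rule W)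
  have iu: "inv_word u \<in> lists (letters {1..r})" using u by (simp only: inv_word_in_lists)
  have uvu: "u @ v @ inv_word u \<in> lists (letters {1..r})" using u v iu by simp
  have uv: "u @ v \<in> lists (letters {1..r})" "v @ u \<in> lists (letters {1..r})" using u v by simp_all
  have comm: "word_class r (Suc i) (u @ v) = word_class r (Suc i) (v @ u)"
    by (rule word_class_antimono[OF uv assms(1)]) (use assms(2) in simp)
  have "word_class r (Suc i) ?W = word_class r (Suc i) []"
    using commutator_facts(1)[OF u v] comm by blast
  then have fW: "level_flow r i ?W = level_flow r i []"
    using L.word_class_Suc_iff[OF W nil] by blast
  have "word_class r (Suc i) (u @ v @ inv_word u) = word_class r (Suc i) v"
    by (rule commutator_facts(2)[OF u v comm])
  then have fv: "level_flow r i (u @ v @ inv_word u) = level_flow r i v"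
    using L.word_class_Suc_iff[OF uvu v] by blast
  have "total (edge i) (multiple a c k) e = total (edge i) (segment 0 a) e + k * total (edge i) (segment c n) e" for e
    unfolding total_def sum_distrib_left sum.distrib[symmetric]
    by (rule sum.cong) (simp_all add: multiple_def)
  moreover have "total (edge i) (segment 0 a) e = level_flow r i u e" for e
    using flow_take[of a i e] by simp
  moreover have "total (edge i) (segment c n) e = - level_flow r i v e" for e
    using total_segment[of c n i e] fW fv by (simp add: level_flow_def)
  ultimately show ?thesis by (simp add: vanishes_def)
qed

text \<open>Elements that do not commute are not powers of each other.  Otherwise the search at the last level
with trivial \<open>v\<close> decides.  Its range suffices: if the flow of \<open>v\<close> is not zero, then \<open>\<bar>k\<bar>\<close> is at most the
absolute value of some entry of the flow of \<open>u\<close>, hence at most the length of \<open>u\<close>; and if the flow of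
\<open>v\<close> is zero, then \<open>0\<close> is an exponent as soon as there is any.\<close>

theorem answer_correct:
  assumes final: "if cls d n = cls d 0
    then (\<forall>i. last_trivial c d i \<longrightarrow> exponent_found a c i s) \<and> (d = 0 \<longrightarrow> var s v_found = 1 \<and> var s v_exp = 0)
    else var s v_found = 0"
  shows "correct_answer r d u v (if var s v_found = 0 then Fail else Exponent (var s v_exp))"
proof (cases "word_class r d (u @ v) = word_class r d (v @ u)")
  case False
  then have "cls d n \<noteq> cls d 0" using commutator_facts(1)[OF u v, of d] by (simp only: cls_positions simp_thms)
  with final False power_commutes[OF u v] show ?thesis by auto
next
  case comm: True
  then have yes: "cls d n = cls d 0" using commutator_facts(1)[OF u v, of d] by (simp only: cls_positions simp_thms)
  show ?thesis
  proof (cases "d = 0")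
    case True
    interpret L: solvable_level r 0 .
    have nil: "[] \<in> lists (letters {1..r})" by simp
    have "word_class r 0 u = word_class r 0 v [^]\<^bsub>free_solvable_group r 0\<^esub> (0::int)"
      using word_class_0[OF u nil] L.vertex_Nil by (simp only: L.vertex_eq int_pow_0)
    then show ?thesis using final yes True by simp
  next
    case False
    have nil: "[] \<in> lists (letters {1..r})" by simp
    have uv: "u @ v \<in> lists (letters {1..r})" "v @ u \<in> lists (letters {1..r})" using u v by simp_all
    have triv: "cls i c = cls i 0 \<longleftrightarrow> word_class r i v = word_class r i []" if "i \<le> d" for i
      using commutator_facts(2)[OF u v word_class_antimono[OF uv comm that]] by (simp only: cls_positions)
    let ?P = "\<lambda>i. i < d \<and> word_class r i v = word_class r i []"
    define i where "i = (GREATEST i. ?P i)"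
    have "?P 0" using False word_class_0[OF v nil] by blast
    then have Pi: "?P i" and max: "\<And>i'. ?P i' \<Longrightarrow> i' \<le> i"
      unfolding i_def using GreatestI_nat[of ?P 0 d] Greatest_le_nat[of ?P _ d] by auto
    have last: "last_trivial c d i"
      unfolding last_trivial_def using Pi max triv by (meson leD less_imp_le)
    have step: "Suc i = d \<or> word_class r (Suc i) v \<noteq> word_class r (Suc i) []"
      using max[of "Suc i"] Pi by auto
    have power: "word_class r d u = word_class r d v [^]\<^bsub>free_solvable_group r d\<^esub> k \<longleftrightarrow>
        vanishes (edge i) (multiple a c k)" for k :: int
      using power_iff_flow_multiple[OF u v _ _ step comm] vanishes_multiple[OF comm] Pi by blast
    have "exponent_found a c i s" using final yes last by simp
    then consider "var s v_found = 0" "\<And>k. - int a \<le> k \<Longrightarrow> k \<le> int a \<Longrightarrow> \<not> vanishes (edge i) (multiple a c k)"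
      | "var s v_found = 1" "vanishes (edge i) (multiple a c (var s v_exp))"
      unfolding exponent_found_def by blast
    then show ?thesis
    proof cases
      case 1
      have "\<not> vanishes (edge i) (multiple a c k)" for k
      proof
        assume k: "vanishes (edge i) (multiple a c k)"
        then have eq: "level_flow r i u e = k * level_flow r i v e" for e
          using vanishes_multiple[OF comm] Pi by blast
        show False
        proof (cases "\<forall>e. level_flow r i v e = 0")
          case True
          then have "vanishes (edge i) (multiple a c 0)"
            using vanishes_multiple[OF comm] Pi eq by simp
          then show False using 1(2)[of 0] by simp
        next
          case False
          then obtain e where "level_flow r i v e \<noteq> 0" by blast
          then have "\<bar>k\<bar> * 1 \<le> \<bar>k\<bar> * \<bar>level_flow r i v e\<bar>" by (intro mult_left_mono) auto
          also have "\<dots> = \<bar>level_flow r i u e\<bar>" using eq[of e] by (simp add: abs_mult)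
          also have "\<dots> \<le> int a" unfolding level_flow_def by (rule flow_abs_le)
          finally show False using 1(2)[of k] k by linarith
        qed
      qed
      then show ?thesis using 1(1) power by simp
    next
      case 2
      then show ?thesis using power by simp
    qed
  qed
qed

end

section \<open>Reading the input and building the commutator\<close>

definition letter_sign :: "nat letter \<Rightarrow> int"
  where "letter_sign x = (if snd x then 1 else -1)"

definition stored :: "nat word \<Rightarrow> state \<Rightarrow> bool"
  where "stored xs s \<longleftrightarrow> var s v_n = int (length xs) \<and>
    (\<forall>p<length xs. arr s a_gen p = int (fst (xs ! p)) \<and> arr s a_sgn p = letter_sign (xs ! p))"

lemma set_var_same: "var s x = y \<Longrightarrow> set_var x y s = s"
  by (auto simp: set_var_def)

lemma set_var_twice: "set_var x y (set_var x z s) = set_var x y s"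
  by (simp add: set_var_def)

lemma loop_free_read_letter: "loop_free (read_letter dec bs l)"
  by (induction l arbitrary: bs) simp_all

lemma max_time_read_letter: "max_time (read_letter dec bs l) = 6 * l + 2"
  by (induction l arbitrary: bs) simp_all

lemma wvars_read_letter: "wvars (read_letter dec bs l) \<subseteq> {v_pos, v_gen, v_sgn}"
  by (induction l arbitrary: bs) auto

lemma cwf_read_letter: "cwf 18 6 (read_letter dec bs l)"
  by (induction l arbitrary: bs) auto

lemma read_letter:
  assumes "var s v_pos = int pos" "pos + length bs' \<le> length inp"
    and "\<And>i. i < length bs' \<Longrightarrow> inp ! (pos + i) = of_bool (bs' ! i)"
    and "int (fst (dec (bs @ bs'))) \<le> int K" "1 \<le> K"
  shows "all_safe inp K (read_letter dec bs (length bs')) s \<and>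
    result inp (read_letter dec bs (length bs')) s =
      set_var v_sgn (letter_sign (dec (bs @ bs')))
        (set_var v_gen (int (fst (dec (bs @ bs')))) (set_var v_pos (int (pos + length bs')) s))"
  using assms
proof (induction bs' arbitrary: bs pos s)
  case Nil
  then show ?case by (simp add: letter_sign_def set_var_same)
next
  case (Cons b bs')
  let ?s = "set_var v_pos (int (Suc pos)) s"
  have b: "inp ! pos = of_bool b" using Cons.prems(3)[of 0] by simp
  have tl: "inp ! (Suc pos + i) = of_bool (bs' ! i)" if "i < length bs'" for i
    using Cons.prems(3)[of "Suc i"] that by simp
  have eq: "(bs @ [b]) @ bs' = bs @ b # bs'" by simp
  have IH: "all_safe inp K (read_letter dec (bs @ [b]) (length bs')) ?s \<and>
    result inp (read_letter dec (bs @ [b]) (length bs')) ?s =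
      set_var v_sgn (letter_sign (dec (bs @ b # bs')))
        (set_var v_gen (int (fst (dec (bs @ b # bs')))) (set_var v_pos (int (Suc pos + length bs')) ?s))"
  proof (rule Cons.IH[of ?s "Suc pos" "bs @ [b]", unfolded eq])
    show "Suc pos + length bs' \<le> length inp" using Cons.prems(2) by simp
  qed (use tl Cons.prems(4,5) in simp_all)
  have step: "set_var v_pos (var s v_pos + 1) s = ?s" using Cons.prems(1) by (simp add: add.commute)
  have "all_safe inp K (read_letter dec bs (length (b # bs'))) s \<and>
    result inp (read_letter dec bs (length (b # bs'))) s = result inp (read_letter dec (bs @ [b]) (length bs')) ?s"
    using IH b step Cons.prems(1,2,5) by (cases b) simp_all
  moreover have "int (Suc pos + length bs') = int (pos + length (b # bs'))" by simp
  ultimately show ?case using IH by (simp only: set_var_twice simp_thms)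
qed

context word_setup
begin

lemma runs_read_and_append:
  assumes s: "stored xs s" "var s v_pos = int pos"
    and code: "pos + length bs \<le> length inp" "\<And>i. i < length bs \<Longrightarrow> inp ! (pos + i) = of_bool (bs ! i)"
    and x: "dec bs = x" "fst x \<le> r"
  shows "runs inp K (read_letter dec [] (length bs) ;; append_letter (V v_gen) (V v_sgn)) s (6 * length bs + 9)
    (\<lambda>s'. stored (xs @ [x]) s' \<and> var s' v_pos = int (pos + length bs))"
proof -
  let ?s1 = "set_var v_sgn (letter_sign x) (set_var v_gen (int (fst x)) (set_var v_pos (int (pos + length bs)) s))"
  have r: "all_safe inp K (read_letter dec [] (length bs)) s" "result inp (read_letter dec [] (length bs)) s = ?s1"
    using read_letter[of s pos bs inp dec "[]" K] assms K by simp_all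
  show ?thesis
  proof (rule runs_block)
    show "loop_free (read_letter dec [] (length bs) ;; append_letter (V v_gen) (V v_sgn))"
      by (simp add: loop_free_read_letter append_letter_def)
    show "all_safe inp K (read_letter dec [] (length bs) ;; append_letter (V v_gen) (V v_sgn)) s"
      using r s K_ge by (simp add: append_letter_def stored_def)
    show "stored (xs @ [x]) (result inp (read_letter dec [] (length bs) ;; append_letter (V v_gen) (V v_sgn)) s) \<and>
        var (result inp (read_letter dec [] (length bs) ;; append_letter (V v_gen) (V v_sgn)) s) v_pos = int (pos + length bs)"
      using s by (simp add: r(2) append_letter_def stored_def nth_append less_Suc_eq)
  qed (simp add: max_time_read_letter append_letter_def)
qed

lemma runs_append_inverse:
  assumes s: "stored xs s" and e': "aval inp e' s = int hi" "safe inp K e' s" "esize e' = 1"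
    and e: "\<And>s'. var s' v_a = var s v_a \<Longrightarrow> aval inp e s' = int lo \<and> safe inp K e s'" "esize e = 1"
    and le: "lo \<le> hi" "hi \<le> length xs"
  shows "runs inp K (append_inverse e e') s (16 * (hi - lo) + 3)
    (stored (xs @ inv_word (drop lo (take hi xs))))"
proof -
  let ?b = "Less e (V v_q)"
  let ?c = "decr v_q ;; append_letter (Arr a_gen (V v_q)) (Minus (N 0) (Arr a_sgn (V v_q)))"
  let ?I = "\<lambda>k s. var s v_q = int (lo + k) \<and> lo + k \<le> hi \<and> stored (xs @ inv_word (drop (lo + k) (take hi xs))) s"
  have loop: "runs inp K (While ?b ?c) (set_var v_q (int hi) s) (16 * (hi - lo) + 2)
      (stored (xs @ inv_word (drop lo (take hi xs))))"
  proof (rule runs_While[where I = ?I and m = "hi - lo" and tb = 14])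
    show "?I (hi - lo) (set_var v_q (int hi) s)"
      using s le by (simp add: stored_def inv_word_def)
    fix k s1 assume I: "?I (Suc k) s1" and same: "same_outside ?c (set_var v_q (int hi) s) s1"
    have a1: "var s1 v_a = var s v_a" using same by (simp add: same_outside_def append_letter_def)
    let ?q = "lo + k"
    define ys where "ys = xs @ inv_word (drop (lo + Suc k) (take hi xs))"
    have q: "?q < hi" "?q < length xs" using I le by auto
    have "drop ?q (take hi xs) = xs ! ?q # drop (Suc ?q) (take hi xs)"
      using q Cons_nth_drop_Suc[of ?q "take hi xs"] by simp
    then have ys: "xs @ inv_word (drop ?q (take hi xs)) = ys @ [inv_letter (xs ! ?q)]"
      by (simp add: inv_word_def ys_def)
    have st: "stored ys s1" using I unfolding ys_def by blast
    have "?q < length ys" "ys ! ?q = xs ! ?q" using q(2) by (simp_all add: nth_append ys_def)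
    then have arrs: "arr s1 a_gen ?q = int (fst (xs ! ?q))" "arr s1 a_sgn ?q = letter_sign (xs ! ?q)"
      using st unfolding stored_def by metis+
    have sg: "\<bar>letter_sign (xs ! ?q)\<bar> \<le> int K" "- letter_sign (xs ! ?q) = letter_sign (inv_letter (xs ! ?q))"
      "fst (inv_letter (xs ! ?q)) = fst (xs ! ?q)"
      using K_ge by (simp_all add: letter_sign_def inv_letter_def)
    have vq: "var s1 v_q = int ?q + 1" using I by simp
    have nq: "nat (int lo + int k) = ?q" by simp
    have "runs inp K ?c s1 14 (?I k)"
    proof (rule runs_block)
      show "all_safe inp K ?c s1"
        using vq arrs[simplified] sg(1) K_ge st by (simp add: append_letter_def stored_def nq)
      have "stored (ys @ [inv_letter (xs ! ?q)]) (result inp ?c s1)"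
        using vq arrs[simplified] sg(2,3) st
        by (simp add: append_letter_def stored_def nq nth_append less_Suc_eq)
      then show "?I k (result inp ?c s1)" using vq q(1) unfolding ys by (simp add: append_letter_def)
    qed (simp_all add: append_letter_def)
    then show "csafe inp K ?b s1 \<and> cval inp ?b s1 \<and> runs inp K ?c s1 14 (?I k)"
      using e(1)[OF a1] vq by simp
  next
    fix s1 assume I: "?I 0 s1" and same: "same_outside ?c (set_var v_q (int hi) s) s1"
    have a1: "var s1 v_a = var s v_a" using same by (simp add: same_outside_def append_letter_def)
    show "csafe inp K ?b s1 \<and> \<not> cval inp ?b s1 \<and> stored (xs @ inv_word (drop lo (take hi xs))) s1"
      using e(1)[OF a1] I by simp
  qed (use e(2) in simp)
  show ?thesis
    unfolding append_inverse_def by (rule runs_block_Seq[OF _ _ _ , where ?t2.0 = "16 * (hi - lo) + 2"]) (use e' loop in simp_all)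
qed

lemma runs_init_ids:
  assumes s: "stored W s"
  shows "runs inp K (init_ids r) s (14 * n + 21) (\<lambda>s'. tables s' \<and> ids (\<lambda>_. 0) s')"
proof -
  let ?b = "Less (V v_i) (Plus (V v_n) (N 1))"
  let ?c = "Update a_mul (V v_i) (V v_x) ;; Update a_id (V v_i) (N 0) ;; incr v_i ;; v_x ::= Plus (V v_x) (N (int (Suc r)))"
  let ?I = "\<lambda>k s. \<exists>i. i + k = Suc n \<and> var s v_i = int i \<and> var s v_x = int (Suc r * i) \<and>
    (\<forall>p<i. arr s a_mul p = int (Suc r * p) \<and> arr s a_id p = 0)"
  let ?s1 = "result inp (v_x ::= N 0) (result inp (v_i ::= N 0) s)"
  let ?Q = "\<lambda>s'. stored W s' \<and> var s' v_x = int m \<and> (\<forall>p\<le>n. arr s' a_mul p = int (Suc r * p) \<and> arr s' a_id p = 0)"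
  have loop: "runs inp K (While ?b ?c) ?s1 (14 * Suc n + 4) ?Q"
  proof (rule runs_While[where I = ?I and m = "Suc n" and tb = 10])
    show "?I (Suc n) ?s1" by simp
    fix k s1 assume "?I (Suc k) s1" and same: "same_outside ?c ?s1 s1"
    then obtain i where i: "i + Suc k = Suc n" "var s1 v_i = int i" "var s1 v_x = int (Suc r * i)"
      "\<forall>p<i. arr s1 a_mul p = int (Suc r * p) \<and> arr s1 a_id p = 0" by blast
    have vn: "var s1 v_n = int n" using same s by (simp add: same_outside_def stored_def)
    have "runs inp K ?c s1 10 (?I k)"
    proof (rule runs_block)
      show "all_safe inp K ?c s1" using i(2) K by simp
      show "?I k (result inp ?c s1)"
        by (rule exI[of _ "Suc i"]) (use i in \<open>auto simp: less_Suc_eq algebra_simps\<close>)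
    qed simp_all
    then show "csafe inp K ?b s1 \<and> cval inp ?b s1 \<and> runs inp K ?c s1 10 (?I k)"
      using i vn K_ge by simp
  next
    fix s1 assume I: "?I 0 s1" and same: "same_outside ?c ?s1 s1"
    have "var s1 v_n = int n" "stored W s1" using same s by (simp_all add: same_outside_def stored_def)
    then show "csafe inp K ?b s1 \<and> \<not> cval inp ?b s1 \<and> ?Q s1"
      using I K_ge by (simp add: m_def less_Suc_eq_le del: mult_Suc of_nat_mult) 
  qed simp
  have fin: "runs inp K (v_size ::= V v_x) s2 1 (\<lambda>s'. tables s' \<and> ids (\<lambda>_. 0) s')" if "?Q s2" for s2
    by (rule runs_block) (use that in \<open>auto simp: tables_def ids_def stored_def letter_sign_def sgn_at_def\<close>)
  have l2: "runs inp K (While ?b ?c ;; v_size ::= V v_x) ?s1 (14 * n + 19) (\<lambda>s'. tables s' \<and> ids (\<lambda>_. 0) s')"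
    by (rule runs_Seq[OF loop fin]) simp_all
  show ?thesis
    unfolding init_ids_def
    by (rule runs_block_Seq[OF _ _ runs_block_Seq[OF _ _ l2 order.refl]]) simp_all
qed

end

definition code_length :: "nat \<Rightarrow> nat"
  where "code_length r = nat \<lceil>log 2 (real r)\<rceil> + 1"

text \<open>On bit strings that are not codes the value is arbitrary; the corresponding leaves of the decision
tree are never reached.\<close>

definition decode :: "nat \<Rightarrow> (nat letter \<Rightarrow> bool list) \<Rightarrow> bool list \<Rightarrow> nat letter"
  where "decode r code = the_inv_into (letters {1..r}) code"

lemma decode_code: "letter_code r code \<Longrightarrow> x \<in> letters {1..r} \<Longrightarrow> decode r code (code x) = x"
  by (simp only: decode_def letter_code_def the_inv_into_f_f)

lemma length_code: "letter_code r code \<Longrightarrow> x \<in> letters {1..r} \<Longrightarrow> length (code x) = code_length r"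
  by (simp only: code_length_def letter_code_def)

lemma length_encode_word:
  assumes "letter_code r code" "w \<in> lists (letters {1..r})"
  shows "length (encode_word code w) = code_length r * length w"
  using assms(2)
proof (induction w)
  case (Cons x w)
  then have "x \<in> letters {1..r}" "w \<in> lists (letters {1..r})" by (simp_all only: Cons_in_lists_iff)
  with Cons.IH length_code[OF assms(1)] show ?case by (simp add: encode_word_def)
qed (simp add: encode_word_def)

lemma nth_encoded:
  assumes code: "letter_code r code" and w: "xs @ x # ys \<in> lists (letters {1..r})"
    and inp: "inp = A @ encode_word code (xs @ x # ys) @ B"
  shows "length A + code_length r * length xs + code_length r \<le> length inp"
    and "i < code_length r \<Longrightarrow> inp ! (length A + code_length r * length xs + i) = of_bool (code x ! i)"
proof -
  have xs: "xs \<in> lists (letters {1..r})" "x \<in> letters {1..r}"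
    using w by (simp_all only: append_in_lists_conv Cons_in_lists_iff)
  note len = length_encode_word[OF code xs(1)] length_code[OF code xs(2)]
  have inp': "inp = (A @ encode_word code xs) @ map of_bool (code x) @ encode_word code ys @ B"
    unfolding inp by (simp add: encode_word_def)
  then show "length A + code_length r * length xs + code_length r \<le> length inp"
    using len by simp
  assume "i < code_length r"
  then show "inp ! (length A + code_length r * length xs + i) = of_bool (code x ! i)"
    unfolding inp' using len nth_append_length_plus[of "A @ encode_word code xs" _ i]
    by (simp add: nth_append)
qed

locale encoded_instance = power_instance "encode_pair code u v" K r u v
  for code :: "nat letter \<Rightarrow> bool list" and K r u v +
  assumes code: "letter_code r code"
begin

abbreviation "inp \<equiv> encode_pair code u v"
abbreviation "l \<equiv> code_length r"
abbreviation "dec \<equiv> decode r code"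

lemma inp_u: "inp = [] @ encode_word code u @ ([2] @ encode_word code v)"
  and inp_v: "inp = (encode_word code u @ [2]) @ encode_word code v @ []"
  by (simp_all add: encode_pair_def)

lemma length_inp: "length inp = l * length u + 1 + l * length v"
  using length_encode_word[OF code u] length_encode_word[OF code v] by (simp add: encode_pair_def)

lemma l_pos: "1 \<le> l"
  by (simp add: code_length_def)

lemma runs_parse:
  assumes s: "s = initial_state inp"
  shows "runs inp K (parse dec l) s ((length u + length v) * (6 * l + 12) + 10)
    (\<lambda>s'. stored (u @ v) s' \<and> var s' v_a = int (length u) \<and> var s' v_b = int (length u + length v))"
proof -
  let ?c = "read_letter dec [] l ;; append_letter (V v_gen) (V v_sgn)"
  let ?b1 = "Less (In (V v_pos)) (N 2)" and ?b2 = "Less (V v_pos) (V v_found)"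
  have wv: "v_a \<notin> wvars ?c" "v_found \<notin> wvars ?c"
    using wvars_read_letter[of dec "[]" l] by (auto simp: append_letter_def)
  have letter: "length (code x) = l" "dec (code x) = x" "fst x \<le> r" if "x \<in> letters {1..r}" for x
    using length_code[OF code that] decode_code[OF code that] that by (auto simp: letters_def)
  let ?I1 = "\<lambda>k s. \<exists>xs ys. u = xs @ ys \<and> length ys = k \<and> stored xs s \<and> var s v_pos = int (l * length xs)"
  have loop1: "runs inp K (While ?b1 ?c) s (length u * (6 * l + 12) + 3)
      (\<lambda>s'. stored u s' \<and> var s' v_pos = int (l * length u) \<and> var s' v_found = int (length inp))"
  proof (rule runs_While[where I = ?I1 and m = "length u" and tb = "6 * l + 9"])
    show "?I1 (length u) s" by (rule exI[of _ "[]"]) (simp add: s initial_state_def stored_def)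
    fix k s1 assume "?I1 (Suc k) s1"
    then obtain xs x ys where I: "u = xs @ x # ys" "length ys = k" "stored xs s1" "var s1 v_pos = int (l * length xs)"
      by (metis length_Suc_conv)
    have w: "xs @ x # ys \<in> lists (letters {1..r})" using u unfolding I(1) .
    then have x: "x \<in> letters {1..r}" by (simp only: append_in_lists_conv Cons_in_lists_iff)
    note enc = nth_encoded[OF code w inp_u[unfolded I(1)], folded I(1), simplified]
    have "runs inp K (read_letter dec [] (length (code x)) ;; append_letter (V v_gen) (V v_sgn)) s1 (6 * length (code x) + 9)
        (\<lambda>s'. stored (xs @ [x]) s' \<and> var s' v_pos = int (l * length xs + length (code x)))"
      by (rule runs_read_and_append[OF I(3,4)]) (use enc letter[OF x] in simp_all)
    then have r: "runs inp K ?c s1 (6 * l + 9) (\<lambda>s'. stored (xs @ [x]) s' \<and> var s' v_pos = int (l * length xs + l))"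
      unfolding letter(1)[OF x] .
    have "runs inp K ?c s1 (6 * l + 9) (?I1 k)"
    proof (rule runs_mono[OF r order.refl])
      fix s' assume "stored (xs @ [x]) s' \<and> var s' v_pos = int (l * length xs + l)"
      with I(1,2) show "?I1 k s'"
        by (intro exI[of _ "xs @ [x]"] exI[of _ ys]) (simp add: algebra_simps)
    qed
    moreover have "inp ! (l * length xs) = of_bool (code x ! 0)" using enc(2)[of 0] l_pos by simp
    moreover have "l * length xs < length inp" using enc(1) l_pos by linarith
    ultimately show "csafe inp K ?b1 s1 \<and> cval inp ?b1 s1 \<and> runs inp K ?c s1 (6 * l + 9) (?I1 k)"
      using I(4) K_ge by (simp del: of_nat_mult)
  next
    fix s1 assume "?I1 0 s1" and same: "same_outside ?c s s1"
    then have I: "stored u s1" "var s1 v_pos = int (l * length u)" by auto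
    have f: "var s1 v_found = int (length inp)"
      using var_same_outside[OF same wv(2)] by (simp add: s initial_state_def)
    have "inp ! (l * length u) = 2"
      using length_encode_word[OF code u] by (simp add: encode_pair_def nth_append)
    moreover have "l * length u < length inp" unfolding length_inp by simp
    ultimately show "csafe inp K ?b1 s1 \<and> \<not> cval inp ?b1 s1 \<and>
        (stored u s1 \<and> var s1 v_pos = int (l * length u) \<and> var s1 v_found = int (length inp))"
      using I f K_ge by (simp del: of_nat_mult)
  qed simp
  let ?I2 = "\<lambda>k s. \<exists>xs ys. v = xs @ ys \<and> length ys = k \<and> stored (u @ xs) s \<and>
    var s v_pos = int (l * length u + 1 + l * length xs)"
  let ?s2 = "\<lambda>s1. result inp (incr v_pos) (result inp (v_a ::= V v_n) s1)"
  have loop2: "runs inp K (While ?b2 ?c) (?s2 s1) (length v * (6 * l + 11) + 2)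
      (\<lambda>s'. stored (u @ v) s' \<and> var s' v_a = int (length u))"
    if s1: "stored u s1" "var s1 v_pos = int (l * length u)" "var s1 v_found = int (length inp)" for s1
  proof (rule runs_While[where I = ?I2 and m = "length v" and tb = "6 * l + 9"])
    show "?I2 (length v) (?s2 s1)" by (rule exI[of _ "[]"]) (use s1 in \<open>simp add: stored_def\<close>)
    fix k s3 assume "?I2 (Suc k) s3" and same: "same_outside ?c (?s2 s1) s3"
    then obtain xs x ys where I: "v = xs @ x # ys" "length ys = k" "stored (u @ xs) s3"
      "var s3 v_pos = int (l * length u + 1 + l * length xs)"
      by (metis length_Suc_conv)
    have f: "var s3 v_found = int (length inp)" using var_same_outside[OF same wv(2)] s1(3) by simp
    have w: "xs @ x # ys \<in> lists (letters {1..r})" using v unfolding I(1) .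
    then have x: "x \<in> letters {1..r}" by (simp only: append_in_lists_conv Cons_in_lists_iff)
    have A: "length (encode_word code u @ [2]) = l * length u + 1" using length_encode_word[OF code u] by simp
    note enc = nth_encoded[OF code w inp_v[unfolded I(1)], folded I(1), unfolded A]
    have "runs inp K (read_letter dec [] (length (code x)) ;; append_letter (V v_gen) (V v_sgn)) s3 (6 * length (code x) + 9)
        (\<lambda>s'. stored ((u @ xs) @ [x]) s' \<and> var s' v_pos = int (l * length u + 1 + l * length xs + length (code x)))"
      by (rule runs_read_and_append[OF I(3,4)]) (use enc letter[OF x] in simp_all)
    then have r: "runs inp K ?c s3 (6 * l + 9)
        (\<lambda>s'. stored ((u @ xs) @ [x]) s' \<and> var s' v_pos = int (l * length u + 1 + l * length xs + l))"
      unfolding letter(1)[OF x] .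
    have "runs inp K ?c s3 (6 * l + 9) (?I2 k)"
    proof (rule runs_mono[OF r order.refl])
      fix s' assume "stored ((u @ xs) @ [x]) s' \<and> var s' v_pos = int (l * length u + 1 + l * length xs + l)"
      with I(1,2) show "?I2 k s'"
        by (intro exI[of _ "xs @ [x]"] exI[of _ ys]) (simp add: algebra_simps)
    qed
    moreover have "l * length u + 1 + l * length xs < length inp" using enc(1) l_pos by linarith
    ultimately show "csafe inp K ?b2 s3 \<and> cval inp ?b2 s3 \<and> runs inp K ?c s3 (6 * l + 9) (?I2 k)"
      using I(4) f by (simp del: of_nat_mult of_nat_add)
  next
    fix s3 assume "?I2 0 s3" and same: "same_outside ?c (?s2 s1) s3"
    then have I: "stored (u @ v) s3" "var s3 v_pos = int (length inp)" by (auto simp: length_inp)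
    have "var s3 v_found = int (length inp)" "var s3 v_a = int (length u)"
      using var_same_outside[OF same wv(2)] var_same_outside[OF same wv(1)] s1 by (simp_all add: stored_def)
    then show "csafe inp K ?b2 s3 \<and> \<not> cval inp ?b2 s3 \<and> (stored (u @ v) s3 \<and> var s3 v_a = int (length u))"
      using I by simp
  qed simp
  have fin: "runs inp K (v_b ::= V v_n) s3 1
      (\<lambda>s'. stored (u @ v) s' \<and> var s' v_a = int (length u) \<and> var s' v_b = int (length u + length v))"
    if "stored (u @ v) s3 \<and> var s3 v_a = int (length u)" for s3
    by (rule runs_block) (use that in \<open>simp_all add: stored_def\<close>)
  have rest: "runs inp K (v_a ::= V v_n ;; incr v_pos ;; While ?b2 ?c ;; v_b ::= V v_n) s1 (length v * (6 * l + 11) + 7)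
      (\<lambda>s'. stored (u @ v) s' \<and> var s' v_a = int (length u) \<and> var s' v_b = int (length u + length v))"
    if s1: "stored u s1 \<and> var s1 v_pos = int (l * length u) \<and> var s1 v_found = int (length inp)" for s1
  proof -
    have l2: "runs inp K (While ?b2 ?c ;; v_b ::= V v_n) (?s2 s1) (length v * (6 * l + 11) + 3)
      (\<lambda>s'. stored (u @ v) s' \<and> var s' v_a = int (length u) \<and> var s' v_b = int (length u + length v))"
      by (rule runs_Seq[OF loop2 fin]) (use s1 in simp_all)
    show ?thesis
      by (rule runs_block_Seq[OF _ _ runs_block_Seq[OF _ _ l2 order.refl]]) (use K_ge in simp_all)
  qed
  show ?thesis
    unfolding parse_def
  proof (rule runs_Seq[OF loop1 rest])
    show "length u * (6 * l + 12) + 3 + (length v * (6 * l + 11) + 7) \<le> (length u + length v) * (6 * l + 12) + 10"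
      by (simp add: algebra_simps)
  qed
qed

theorem runs_power_program:
  assumes d: "d \<le> K"
  shows "runs inp K (power_program r d dec l) (initial_state inp)
    ((a + length v) * (6 * l + 12) + 16 * (a + length v) + 14 * n + d * (level_time + 2) + 49)
    (\<lambda>s. correct_answer r d u v (if var s v_found = 0 then Fail else Exponent (var s v_exp)))"
proof -
  let ?Q = "\<lambda>s. correct_answer r d u v (if var s v_found = 0 then Fail else Exponent (var s v_exp))"
  let ?W = "u @ v @ inv_word u @ inv_word v"
  have wv: "wvars (append_inverse e e') = {v_q, v_n}" "warrs (append_inverse e e') = {a_gen, a_sgn}" for e e'
    by (auto simp: append_inverse_def append_letter_def)
  have wi: "v_a \<notin> wvars (init_ids r)" "v_c \<notin> wvars (init_ids r)"
    by (auto simp: init_ids_def)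
  have t5: "runs inp K (levels d) s (d * (level_time + 2) + 11) ?Q"
    if s: "tables s \<and> ids (\<lambda>_. 0) s" "var s v_a = int a" "var s v_c = int c" for s
    by (rule runs_mono[OF runs_levels[where a = a and c = c] order.refl answer_correct]) (use s d in simp_all)
  have t4: "runs inp K (init_ids r ;; levels d) s (14 * n + 21 + (d * (level_time + 2) + 11)) ?Q"
    if s: "stored ?W s" "var s v_a = int a" "var s v_c = int c" for s
  proof (rule runs_Seq[OF runs_init_ids[OF s(1)] t5])
    fix s1 assume "same_outside (init_ids r) s s1"
    then show "var s1 v_a = int a" "var s1 v_c = int c" using var_same_outside[OF _ wi(1)] var_same_outside[OF _ wi(2)] s(2,3) by metis+
  qed simp_all
  have t3: "runs inp K (append_inverse (V v_a) (V v_b) ;; init_ids r ;; levels d) s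
      (16 * length v + 3 + (14 * n + 21 + (d * (level_time + 2) + 11))) ?Q"
    if s: "stored (u @ v @ inv_word u) s" "var s v_a = int a" "var s v_b = int (a + length v)" "var s v_c = int c" for s
  proof (rule runs_Seq[OF runs_append_inverse[OF s(1), where hi = "a + length v" and lo = a] t4])
    fix s1 assume same: "same_outside (append_inverse (V v_a) (V v_b)) s s1"
      and st: "stored ((u @ v @ inv_word u) @ inv_word (drop a (take (a + length v) (u @ v @ inv_word u)))) s1"
    then show "stored ?W s1" by simp
    show "var s1 v_a = int a" "var s1 v_c = int c" using same s by (simp_all add: same_outside_def wv)
  qed (use s in simp_all)
  have t2: "runs inp K (append_inverse (N 0) (V v_a) ;; v_c ::= V v_n ;; append_inverse (V v_a) (V v_b) ;; init_ids r ;; levels d) s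
      (16 * a + 3 + (1 + (16 * length v + 3 + (14 * n + 21 + (d * (level_time + 2) + 11))))) ?Q"
    if s: "stored (u @ v) s \<and> var s v_a = int a \<and> var s v_b = int (a + length v)" for s
  proof (rule runs_Seq[OF runs_append_inverse[where xs = "u @ v" and hi = a and lo = 0]])
    fix s1 assume same: "same_outside (append_inverse (N 0) (V v_a)) s s1"
      and st: "stored ((u @ v) @ inv_word (drop 0 (take a (u @ v)))) s1"
    let ?s2 = "result inp (v_c ::= V v_n) s1"
    have "stored (u @ v @ inv_word u) ?s2" "var ?s2 v_c = int c" using st by (simp_all add: stored_def)
    moreover have "var ?s2 v_a = int a" "var ?s2 v_b = int (a + length v)"
      using same s by (simp_all add: same_outside_def wv)
    ultimately have "runs inp K (append_inverse (V v_a) (V v_b) ;; init_ids r ;; levels d) ?s2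
      (16 * length v + 3 + (14 * n + 21 + (d * (level_time + 2) + 11))) ?Q" by (intro t3)
    then show "runs inp K (v_c ::= V v_n ;; append_inverse (V v_a) (V v_b) ;; init_ids r ;; levels d) s1
      (1 + (16 * length v + 3 + (14 * n + 21 + (d * (level_time + 2) + 11)))) ?Q"
      by (intro runs_block_Seq[OF _ _ _ order.refl, of "v_c ::= V v_n", simplified max_time.simps esize.simps]) simp_all
  qed (use s in simp_all)
  show ?thesis
    unfolding power_program_def
    by (rule runs_Seq[OF runs_parse[OF HOL.refl] t2]) (simp_all add: algebra_simps)
qed

lemma level_time_le: "level_time \<le> (320 + 20 * r) * (Suc n)^2"
  unfolding level_time_def m_def by (simp add: algebra_simps power2_eq_square)

end

section \<open>The running time\<close>

text \<open>
Times the square of one plus the number of letters, this bounds the time of the structured program.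
\<close>

definition step_factor :: "nat \<Rightarrow> nat \<Rightarrow> nat"
  where "step_factor r d = 6 * code_length r + 105 + d * (4 * (320 + 20 * r) + 2)"

lemma floorlog_2_le: "floorlog 2 b \<le> b"
  by (rule floorlog_leI) (simp_all add: less_exp)

lemma mult_cost_le: "mult_cost b \<le> b ^ 3"
proof -
  have "floorlog 2 (floorlog 2 b) \<le> b" using floorlog_2_le order_trans by blast
  then have "b * floorlog 2 b * floorlog 2 (floorlog 2 b) \<le> b * b * b"
    by (intro mult_le_mono floorlog_2_le order.refl)
  then show ?thesis by (simp add: mult_cost_def power3_eq_cube)
qed

lemma bits_nat_le:
  assumes "1 \<le> v"
  shows "real (bits (int v)) \<le> 2 + log 2 (real v)"
proof -
  have "floorlog 2 v = nat \<lfloor>log 2 (real v)\<rfloor> + 1"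
    using assms by (simp add: floorlog_def)
  moreover have "0 \<le> log 2 (real v)" using assms by simp
  ultimately show ?thesis by (simp add: bits_def)
qed

text \<open>The numbers are at most quadratic in \<open>k\<close>, so that an instruction handles \<open>O(ln k)\<close> bits and costs
\<open>O((ln k)\<^sup>3)\<close>, multiplications included; the number of instructions is quadratic.\<close>

lemma quasi_quadratic_bound:
  assumes C: "1 \<le> C"
  shows "quasi_quadratic (\<lambda>k. real ((14 * (A * (Suc k)^2) + 1) * word_cost (C * (Suc k)^2)))"
  unfolding quasi_quadratic_def
proof (intro exI[of _ 3] bigoI)
  define D where "D = 2 + (ln (real C) + 4) / ln 2"
  have "0 \<le> ln (real C)" using C by simp
  then have D: "0 \<le> D" by (simp add: D_def)
  show "\<forall>\<^sub>F k in at_top. norm (real ((14 * (A * (Suc k)^2) + 1) * word_cost (C * (Suc k)^2)))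
      \<le> ((56 * real A + 1) * (3 * D ^ 3)) * norm (real k ^ 2 * ln (real k) ^ 3)"
    using eventually_ge_at_top[of 3]
  proof eventually_elim
    case (elim k)
    define v where "v = C * (Suc k)^2"
    define b where "b = bits (int v)"
    have v: "1 \<le> v" using C by (simp add: v_def)
    have "exp 1 \<le> real k" using exp_le elim by linarith
    then have lnk: "1 \<le> ln (real k)" using elim by (subst ln_ge_iff) auto
    have "Suc k \<le> k * k" using mult_le_mono1[of 3 k k] elim by linarith
    then have "(Suc k)^2 \<le> (k^2)^2" by (intro power_mono) (simp_all add: power2_eq_square)
    then have "v \<le> C * k ^ 4" by (simp add: v_def flip: power_mult)
    then have "real v \<le> real C * real k ^ 4" by (metis of_nat_mono of_nat_mult of_nat_power)
    then have "ln (real v) \<le> ln (real C * real k ^ 4)" using v by simp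
    also have "\<dots> = ln (real C) + 4 * ln (real k)" using C elim by (simp add: ln_mult ln_realpow)
    also have "\<dots> \<le> (ln (real C) + 4) * ln (real k)"
      using mult_left_mono[OF lnk \<open>0 \<le> ln (real C)\<close>] by (simp add: algebra_simps)
    finally have "log 2 (real v) \<le> (ln (real C) + 4) * ln (real k) / ln 2"
      unfolding log_def by (intro divide_right_mono) simp_all
    then have b: "real b \<le> D * ln (real k)"
      using bits_nat_le[OF v] lnk by (simp add: b_def D_def algebra_simps)
    have "1 \<le> b" by (simp add: b_def bits_def)
    then have "b * 1 \<le> b * b ^ 2" by (intro mult_left_mono one_le_power) simp_all
    then have "b \<le> b ^ 3" by (simp add: power3_eq_cube power2_eq_square)
    moreover have "word_cost v = 2 * b + mult_cost b" by (simp add: word_cost_def b_def)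
    ultimately have "word_cost v \<le> 3 * b ^ 3" using mult_cost_le[of b] by linarith
    then have "real (word_cost v) \<le> real (3 * b ^ 3)" by (rule of_nat_mono)
    also have "\<dots> \<le> 3 * (D * ln (real k)) ^ 3" using b by (simp add: power_mono)
    finally have w: "real (word_cost v) \<le> 3 * D ^ 3 * ln (real k) ^ 3" by (simp add: power_mult_distrib)
    have "Suc k \<le> 2 * k" using elim by simp
    then have sq: "(Suc k)^2 \<le> (2 * k)^2" by (rule power_mono) simp
    have "1 * 1 \<le> k * k" using elim by (intro mult_le_mono) simp_all
    then have "14 * (A * (Suc k)^2) + 1 \<le> 14 * (A * (2 * k)^2) + k ^ 2"
      using sq by (intro add_mono mult_left_mono) (simp_all add: power2_eq_square)
    then have "14 * (A * (Suc k)^2) + 1 \<le> (56 * A + 1) * k ^ 2" by (simp add: algebra_simps power2_eq_square)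
    then have "real (14 * (A * (Suc k)^2) + 1) \<le> real ((56 * A + 1) * k ^ 2)" by (rule of_nat_mono)
    then have A: "real (14 * (A * (Suc k)^2) + 1) \<le> (56 * real A + 1) * real k ^ 2"
      by (simp add: distrib_right)
    have "norm (real ((14 * (A * (Suc k)^2) + 1) * word_cost v)) =
        real (14 * (A * (Suc k)^2) + 1) * real (word_cost v)"
      by (simp only: of_nat_mult real_norm_def abs_mult abs_of_nat)
    also have "\<dots> \<le> ((56 * real A + 1) * real k ^ 2) * (3 * D ^ 3 * ln (real k) ^ 3)"
      using w by (intro mult_mono[OF A]) simp_all
    also have "\<dots> = ((56 * real A + 1) * (3 * D ^ 3)) * norm (real k ^ 2 * ln (real k) ^ 3)"
      using lnk by (simp add: abs_mult)
    finally show ?case unfolding v_def .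
  qed
qed

lemma cwf_power_program: "cwf 18 6 (power_program r d dec l)"
  by (simp add: power_program_def parse_def append_inverse_def append_letter_def init_ids_def levels_def
      compute_edges_def search_exponent_def compare_prefixes_def clear_counters_def count_segment_def
      count_letter_def cwf_read_letter)

theorem theorem5p1:
  fixes r d :: nat and code :: "nat letter \<Rightarrow> bool list"
  assumes "letter_code r code"
  shows "\<exists>P T. solves_power_problem_within r d code P T \<and> quasi_quadratic T"
proof -
  \<comment> \<open>bounds the symbols of the input, the constants in the program, and the generators that are added to numbers of prefixes\<close>
  define K where "K = r + d + 2"
  define A where "A = step_factor r d"
  \<comment> \<open>factor of the square in a bound for the input length and for all numbers of the structured program\<close>
  define C where "C = code_length r + 7 + K * A"
  \<comment> \<open>18 variables and 6 arrays\<close>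
  let ?com = "power_program r d (decode r code) (code_length r)"
  let ?P = "compile 18 6 ?com"
  define T where "T = (\<lambda>k. real ((14 * (A * (Suc k)^2) + 1) * word_cost (8 * C * (Suc k)^2)))"
  have "solves_power_problem_within r d code ?P T"
    unfolding solves_power_problem_within_def
  proof (intro ballI)
    fix u v assume u: "u \<in> lists (letters {1..r})" and v: "v \<in> lists (letters {1..r})"
    interpret encoded_instance code K r u v
      by unfold_locales (use u v assms K_def in simp_all)
    let ?z = "length u + length v"
    let ?Y = "(Suc ?z)^2"
    have Y: "?z \<le> ?Y" "1 \<le> ?Y" by (simp_all add: power2_eq_square)
    have time: "?z * (6 * code_length r + 12) + 16 * ?z + 14 * n + d * (level_time + 2) + 49 \<le> A * ?Y"
    proof -
      have "Suc n \<le> 2 * Suc ?z" by simp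
      then have "(Suc n)^2 \<le> (2 * Suc ?z)^2" by (rule power_mono) simp
      then have "(320 + 20 * r) * (Suc n)^2 \<le> (320 + 20 * r) * (2 * Suc ?z)^2" by (rule mult_left_mono) simp
      also have "\<dots> = 4 * (320 + 20 * r) * ?Y" by (simp only: power_mult_distrib mult.assoc mult.left_commute) simp
      finally have "level_time + 2 \<le> (4 * (320 + 20 * r) + 2) * ?Y"
        using level_time_le Y(2) unfolding distrib_right by linarith
      then have 1: "d * (level_time + 2) \<le> d * ((4 * (320 + 20 * r) + 2) * ?Y)" by (rule mult_left_mono) simp
      have 2: "?z * (6 * code_length r + 12) \<le> ?Y * (6 * code_length r + 12)"
        using Y(1) by (rule mult_right_mono) simp
      have "16 * z + 14 * (2 * z) + 49 \<le> 93 * y" if "z \<le> y" "1 \<le> y" for z y :: nat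
        using that by linarith
      from this[OF Y] have 3: "16 * ?z + 14 * n + 49 \<le> 93 * ?Y" by simp
      have "A * ?Y = ?Y * (6 * code_length r + 12) + 93 * ?Y + d * ((4 * (320 + 20 * r) + 2) * ?Y)"
        unfolding A_def step_factor_def by (simp only: distrib_right distrib_left mult.commute mult.left_commute)
      then show ?thesis using add_mono[OF add_mono[OF 2 3] 1] by (simp only: ac_simps)
    qed
    have "d \<le> K" by (simp add: K_def)
    have "runs inp K ?com (initial_state inp) (A * ?Y)
        (\<lambda>s. correct_answer r d u v (if var s v_found = 0 then Fail else Exponent (var s v_exp)))"
      by (rule runs_mono[OF runs_power_program[OF \<open>d \<le> K\<close>] time])
    then obtain t s where big: "big inp K ?com (initial_state inp) t s" "t \<le> A * ?Y"
      and ans: "correct_answer r d u v (if var s v_found = 0 then Fail else Exponent (var s v_exp))"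
      unfolding runs_def by blast
    have small: "\<bar>x\<bar> \<le> int K" if "x \<in> set inp" for x
      using that by (auto simp: K_def encode_pair_def encode_word_def)
    have M: "length inp + K * t \<le> C * ?Y" "6 \<le> C * ?Y"
    proof -
      have "code_length r * length u + code_length r * length v \<le> code_length r * ?Y"
        using mult_left_mono[OF Y(1), of "code_length r"] by (simp add: algebra_simps)
      moreover have "K * t \<le> K * (A * ?Y)" using big(2) by (rule mult_left_mono) simp
      moreover have "C * ?Y = code_length r * ?Y + 7 * ?Y + K * (A * ?Y)" by (simp add: C_def algebra_simps)
      ultimately show "length inp + K * t \<le> C * ?Y" "6 \<le> C * ?Y"
        using Y(2) unfolding length_inp by linarith+
    qed
    from compile_correct[OF big(1) cwf_power_program _ small M]
    obtain t' c where run: "run ?P (initial_config inp) t' c" "halted ?P c" "\<forall>x<18. reg c x = var s x"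
      "t' \<le> (14 * t + 1) * word_cost ((6 + 2) * (C * ?Y))" by auto
    have "answer_of c = (if var s v_found = 0 then Fail else Exponent (var s v_exp))"
      using run(3) by (simp add: answer_of_def)
    moreover have "real t' \<le> T ?z"
    proof -
      have le: "14 * t + 1 \<le> 14 * (A * ?Y) + 1"
        by (intro add_mono mult_left_mono big(2)) simp_all
      have eq: "(6 + 2) * (C * ?Y) = 8 * C * ?Y" by simp
      have "t' \<le> (14 * (A * ?Y) + 1) * word_cost (8 * C * ?Y)"
        using run(4) unfolding eq by (rule order.trans[OF _ mult_right_mono[OF le]]) simp
      then show ?thesis unfolding T_def of_nat_le_iff .
    qed
    ultimately show "\<exists>t c. run ?P (initial_config (encode_pair code u v)) t c \<and> halted ?P c \<and>
        correct_answer r d u v (answer_of c) \<and> real t \<le> T (length u + length v)"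
      using run(1,2) ans by (intro exI[of _ t'] exI[of _ c]) simp
  qed
  moreover have "quasi_quadratic T"
    unfolding T_def by (rule quasi_quadratic_bound) (simp add: C_def)
  ultimately show ?thesis by blast
qed

end
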